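(* Let $m\ge 0$ be an integer, let $\mathcal{G}=(G,\{a_1,\ldots,a_m\},b_1,b_2)$ be an $m$-rooted graph, and let $U\subseteq V(G)\setminus\{a_1,\ldots,a_m,b_1,b_2\}$. Suppose $\mathcal{G}$ is critically feasible with respect to $U$. Then there exists an $(\{a_1,\ldots,a_m,b_1,b_2\}\cup U)$-collection $\mathcal{X}$ in $G$ such that (i) $|N(X)|\le m+2$ for all $X\in\mathcal{X}$, and (ii) $e(\mathcal{G}/\mathcal{X})\le (m+2)\,v(G/\mathcal{X})-m^2/2-5m/2-3-|U|$.
   Context: All graphs are finite and simple; $v(H)$ and $e(H)$ denote the numbers of vertices and edges of $H$. For $A\subseteq V(G)$, $N(A)=N_G(A)$ is the set of vertices outside $A$ adjacent to some vertex of $A$, and $N[A]=N(A)\cup A$. An $m$-rooted graph $(G,\{a_1,\ldots,a_m\},b_1,b_2)$ consists of a graph $G$ and distinct vertices $a_1,\ldots,a_m,b_1,b_2$ of $G$ ($m=0$ allowed). A linkage pair in $\mathcal{G}$ is an ordered pair $(A,B)$ of vertex-disjoint subgraphs of $G$ where $A$ is connected with $\{a_1,\ldots,a_m\}\subseteq V(A)$ and $B$ is a $b_1$-$b_2$ path; when $m=0$, $(\emptyset,B)$ is a linkage pair for every $b_1$-$b_2$ path $B$ in $G$. $\mathcal{G}$ is feasible if it has a linkage pair. For $U\subseteq V(G)\setminus\{a_1,\ldots,a_m,b_1,b_2\}$, $\mathcal{G}$ is critically feasible with respect to $U$ if $\mathcal{G}$ is feasible and $U\subseteq V(B)$ for every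 linkage pair $(A,B)$ in $\mathcal{G}$. For $S\subseteq V(G)$, an $S$-collection in $G$ is a family $\mathcal{X}$ of subsets of $V(G)\setminus S$ such that $N[X_1]\cap X_2=\emptyset$ for all distinct $X_1,X_2\in\mathcal{X}$. $G/\mathcal{X}$ denotes the graph obtained from $G$ by, for each $X\in\mathcal{X}$, deleting $X$ and adding edges making $N_G(X)$ a clique. $\mathcal{G}/\mathcal{X}$ denotes the graph obtained from $G/\mathcal{X}$ by adding an edge between every pair of distinct vertices of $\{a_1,\ldots,a_m,b_1,b_2\}$ except the pair $\{b_1,b_2\}$ (if not already present). *)

theory Defs
  imports Complex_Main
begin

record 'a ugraph =
  verts :: "'a set"
  edges :: "'a set set"

definition simple_graph :: "'a ugraph \<Rightarrow> bool" where
  "simple_graph G \<longleftrightarrow> finite (verts G) \<and> (\<forall>e\<in>edges G. e \<subseteq> verts G \<and> card e = 2)"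

definition subgraph :: "'a ugraph \<Rightarrow> 'a ugraph \<Rightarrow> bool" where
  "subgraph H G \<longleftrightarrow> simple_graph H \<and> verts H \<subseteq> verts G \<and> edges H \<subseteq> edges G"

definition empty_graph :: "'a ugraph" where
  "empty_graph = \<lparr>verts = {}, edges = {}\<rparr>"

text \<open>The empty graph does not count as connected.\<close>

definition connected_graph :: "'a ugraph \<Rightarrow> bool" where
  "connected_graph G \<longleftrightarrow> verts G \<noteq> {} \<and>
     (\<forall>u\<in>verts G. \<forall>v\<in>verts G. (u, v) \<in> {(x, y). {x, y} \<in> edges G}\<^sup>*)"

text \<open>A path is a graph, not a vertex sequence; the list \<open>p\<close> enumerates its vertices in order.\<close>

definition is_path :: "'a ugraph \<Rightarrow> 'a \<Rightarrow> 'a \<Rightarrow> bool" where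
  "is_path P x y \<longleftrightarrow> (\<exists>p. p \<noteq> [] \<and> distinct p \<and> hd p = x \<and> last p = y \<and>
     verts P = set p \<and> edges P = {{p ! i, p ! Suc i} |i. Suc i < length p})"

definition nbhd :: "'a ugraph \<Rightarrow> 'a set \<Rightarrow> 'a set" where
  "nbhd G X = {v \<in> verts G - X. \<exists>x\<in>X. {x, v} \<in> edges G}"

definition closed_nbhd :: "'a ugraph \<Rightarrow> 'a set \<Rightarrow> 'a set" where
  "closed_nbhd G X = nbhd G X \<union> X"

text \<open>An \<open>m\<close>-rooted graph is given by \<open>G\<close>, the set \<open>R = {a\<^sub>1, \<dots>, a\<^sub>m}\<close> and \<open>b1\<close>, \<open>b2\<close>.
  Distinctness of the \<open>a\<^sub>i\<close> is \<open>card R = m\<close>; \<open>R\<close> is finite because \<open>G\<close> is.\<close>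

definition rooted_graph :: "nat \<Rightarrow> 'a ugraph \<Rightarrow> 'a set \<Rightarrow> 'a \<Rightarrow> 'a \<Rightarrow> bool" where
  "rooted_graph m G R b1 b2 \<longleftrightarrow> simple_graph G \<and> R \<subseteq> verts G \<and> card R = m \<and>
     b1 \<in> verts G \<and> b2 \<in> verts G \<and> b1 \<noteq> b2 \<and> b1 \<notin> R \<and> b2 \<notin> R"

definition linkage_pair ::
  "'a ugraph \<Rightarrow> 'a set \<Rightarrow> 'a \<Rightarrow> 'a \<Rightarrow> 'a ugraph \<Rightarrow> 'a ugraph \<Rightarrow> bool" where
  "linkage_pair G R b1 b2 A B \<longleftrightarrow>
     subgraph A G \<and> subgraph B G \<and> verts A \<inter> verts B = {} \<and>
     (connected_graph A \<or> (R = {} \<and> A = empty_graph)) \<and>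
     R \<subseteq> verts A \<and> is_path B b1 b2"

definition feasible :: "'a ugraph \<Rightarrow> 'a set \<Rightarrow> 'a \<Rightarrow> 'a \<Rightarrow> bool" where
  "feasible G R b1 b2 \<longleftrightarrow> (\<exists>A B. linkage_pair G R b1 b2 A B)"

definition critically_feasible :: "'a ugraph \<Rightarrow> 'a set \<Rightarrow> 'a \<Rightarrow> 'a \<Rightarrow> 'a set \<Rightarrow> bool" where
  "critically_feasible G R b1 b2 U \<longleftrightarrow>
     feasible G R b1 b2 \<and> (\<forall>A B. linkage_pair G R b1 b2 A B \<longrightarrow> U \<subseteq> verts B)"

definition collection :: "'a ugraph \<Rightarrow> 'a set \<Rightarrow> 'a set set \<Rightarrow> bool" where
  "collection G S \<X> \<longleftrightarrow> (\<forall>X\<in>\<X>. X \<subseteq> verts G - S) \<and>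
     (\<forall>X1\<in>\<X>. \<forall>X2\<in>\<X>. X1 \<noteq> X2 \<longrightarrow> closed_nbhd G X1 \<inter> X2 = {})"

text \<open>\<open>G/\<X>\<close>: for a collection \<open>\<X>\<close>, no \<open>N(X)\<close> meets \<open>\<Union>\<X>\<close>, so the added edges
  join surviving vertices.\<close>

definition quotient_graph :: "'a ugraph \<Rightarrow> 'a set set \<Rightarrow> 'a ugraph" where
  "quotient_graph G \<X> =
     \<lparr>verts = verts G - \<Union>\<X>,
      edges = {e \<in> edges G. e \<inter> \<Union>\<X> = {}} \<union>
        {{u, v} |u v X. X \<in> \<X> \<and> u \<in> nbhd G X \<and> v \<in> nbhd G X \<and> u \<noteq> v}\<rparr>"

text \<open>The rooted version of \<open>G/\<X>\<close>: the pair \<open>{b1, b2}\<close> is not added, but it remains an edge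
  if it already is one in \<open>G/\<X>\<close>.\<close>

definition rooted_quotient ::
  "'a ugraph \<Rightarrow> 'a set \<Rightarrow> 'a \<Rightarrow> 'a \<Rightarrow> 'a set set \<Rightarrow> 'a ugraph" where
  "rooted_quotient G R b1 b2 \<X> =
     \<lparr>verts = verts (quotient_graph G \<X>),
      edges = edges (quotient_graph G \<X>) \<union>
        ({{u, v} |u v. u \<in> R \<union> {b1, b2} \<and> v \<in> R \<union> {b1, b2} \<and> u \<noteq> v} - {{b1, b2}})\<rparr>"

end

theory Submission
  imports Defs
begin

text \<open>Call a connected set \<open>Y\<close> rigid if every choice of two ends among its neighbours can be linked
  inside \<open>Y \<union> N(Y)\<close> disjointly from a connected set containing the remaining neighbours. Replacing a
  rigid set off \<open>U\<close> by a clique on its neighbourhood preserves critical feasibility, so it suffices to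
  bound the number of edges when no such set has at most \<open>m + 2\<close> neighbours.

  For infeasible instances without rigid sets of order at most \<open>m + 1\<close>, contracting an edge between
  a root \<open>a\<close> and a suitable path vertex \<open>u\<close> shows by induction that at most \<open>(m + 1) n + 1\<close> edges
  meet the \<open>n\<close> nonterminal vertices, with \<open>+ 1\<close> removed if some root and some \<open>b\<^sub>i\<close> have no common
  nonterminal neighbour; this refinement is needed to carry the induction. In the critical case,
  deleting a vertex \<open>u \<in> U\<close> that misses some root leaves an infeasible instance, and the parts that
  are attached to \<open>u\<close> and still feasible are bounded by induction; at most two of them occur, one for
  each direction in which the \<open>b\<^sub>1\<close>-\<open>b\<^sub>2\<close> path leaves \<open>u\<close>. If every vertex of \<open>U\<close> sees all roots, stars
  on the roots replace the connected side of the linkage.\<close>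

text \<open>Both counts rest on one conversion. A connected set with k neighbours that is not rigid
  has two neighbours for which the instance on the set and its neighbourhood, with the other k - 2
  neighbours as roots, is infeasible. Apart from rigid sets of smaller order inside it, it therefore
  costs at most k - 1 edges per vertex plus 1. For k at most \<open>card R + 1\<close> there is a
  spare edge per vertex, which absorbs the 1. The obstacle is k = \<open>card R + 2\<close>, where
  nothing need be spare and each surplus 1 must be charged to a place of its own. After contracting
  \<open>u\<close> into a root \<open>a\<close>, a set of this order sees both \<open>u\<close> and
  \<open>a\<close>, and the charge goes to a common neighbour of the two. If there is none and one
  of the two is an end and the other a root of the local instance, the sharper bound for a root and
  an end without common neighbour removes the surplus; hence the form of the refinement. After
  deleting \<open>u\<close> in the critical case, the charge goes to an exit of the path from
  \<open>u\<close> or to a vertex off \<open>U\<close>. The \<open>+ 1\<close> of the critical count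
  is finally returned by the pair \<open>b1\<close>, \<open>b2\<close>, which is not an edge when
  \<open>U\<close> is nonempty.\<close>

text \<open>In contrast to \<open>connected_graph\<close>, the empty set is connected here.\<close>

definition conn :: "'a set set \<Rightarrow> 'a set \<Rightarrow> bool" where
  "conn E X \<longleftrightarrow> (\<forall>C\<subseteq>X. C \<noteq> {} \<longrightarrow> C \<noteq> X \<longrightarrow> (\<exists>x\<in>C. \<exists>y\<in>X - C. {x, y} \<in> E))"

definition nb :: "'a set set \<Rightarrow> 'a set \<Rightarrow> 'a set" where
  "nb E X = {v. v \<notin> X \<and> (\<exists>x\<in>X. {x, v} \<in> E)}"

text \<open>\<open>D\<close> is a part whose edges are counted separately; \<open>er_split\<close>
  then adds the two counts without overlap.\<close>

definition er :: "'a set set \<Rightarrow> 'a set \<Rightarrow> 'a set \<Rightarrow> nat" where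
  "er E X D = card {e \<in> E. e \<inter> X \<noteq> {} \<and> e \<inter> D = {}}"

definition graph :: "'a set \<Rightarrow> 'a set set \<Rightarrow> bool" where
  "graph V E \<longleftrightarrow> finite V \<and> (\<forall>e\<in>E. e \<subseteq> V \<and> card e = 2)"

text \<open>The path side is only a connected set containing both ends, which makes detours plain
  unions; a path is extracted where one is needed. The ambient set \<open>W\<close> is separate from
  \<open>E\<close>, so that rigidity of a subset can be stated over the same edges.\<close>

definition linked ::
  "'a set set \<Rightarrow> 'a set \<Rightarrow> 'a set \<Rightarrow> 'a \<Rightarrow> 'a \<Rightarrow> 'a set \<Rightarrow> 'a set \<Rightarrow> bool" where
  "linked E W P s t A B \<longleftrightarrow> A \<subseteq> W \<and> B \<subseteq> W \<and> A \<inter> B = {} \<and> P \<subseteq> A \<and> s \<in> B \<and> t \<in> B \<and>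
     conn E A \<and> conn E B"

definition feas :: "'a set set \<Rightarrow> 'a set \<Rightarrow> 'a set \<Rightarrow> 'a \<Rightarrow> 'a \<Rightarrow> bool" where
  "feas E W P s t \<longleftrightarrow> (\<exists>A B. linked E W P s t A B)"

text \<open>Deleting a rigid set and completing its neighbourhood to a clique cannot make an infeasible
  instance feasible (\<open>linked_quot_lift\<close>), so rigid sets of small order are what a collection may absorb.\<close>

definition rigid :: "'a set set \<Rightarrow> 'a set \<Rightarrow> bool" where
  "rigid E Y \<longleftrightarrow> Y \<noteq> {} \<and> conn E Y \<and>
     (\<forall>s\<in>nb E Y. \<forall>t\<in>nb E Y. s \<noteq> t \<longrightarrow> feas E (Y \<union> nb E Y) (nb E Y - {s, t}) s t)"

definition comps :: "'a set set \<Rightarrow> 'a set \<Rightarrow> 'a set set" where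
  "comps E D = {K. K \<subseteq> D \<and> K \<noteq> {} \<and> conn E K \<and> (\<forall>x\<in>K. \<forall>y\<in>D - K. {x, y} \<notin> E)}"

definition quot :: "'a set set \<Rightarrow> 'a set \<Rightarrow> 'a set set" where
  "quot E Y = {e \<in> E. e \<inter> Y = {}} \<union> {{u, v} |u v. u \<in> nb E Y \<and> v \<in> nb E Y \<and> u \<noteq> v}"

text \<open>The merged vertex keeps the name \<open>a\<close>, so a root set containing
  \<open>a\<close> but not \<open>u\<close> is unchanged.\<close>

definition contract :: "'a set set \<Rightarrow> 'a \<Rightarrow> 'a \<Rightarrow> 'a set set" where
  "contract E u a = {e \<in> E. u \<notin> e} \<union> {{a, w} |w. {u, w} \<in> E \<and> w \<noteq> a}"

section \<open>Connectivity through cuts, neighbourhoods and edge counts\<close>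

lemma connI:
  assumes "\<And>C. C \<subseteq> X \<Longrightarrow> C \<noteq> {} \<Longrightarrow> C \<noteq> X \<Longrightarrow> \<exists>x\<in>C. \<exists>y\<in>X - C. {x, y} \<in> E"
  shows "conn E X"
  unfolding conn_def by (intro allI impI) (rule assms)

lemma connD:
  assumes "conn E X" "C \<subseteq> X" "C \<noteq> {}" "C \<noteq> X"
  obtains x y where "x \<in> C" "y \<in> X" "y \<notin> C" "{x, y} \<in> E"
proof -
  have "\<exists>x\<in>C. \<exists>y\<in>X - C. {x, y} \<in> E" using assms unfolding conn_def by simp
  then show thesis using that by auto
qed

lemma conn_empty [simp]: "conn E {}"
  unfolding conn_def by simp

lemma conn_singleton [simp]: "conn E {x}"
  unfolding conn_def by (auto simp: subset_singleton_iff)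

lemma conn_mono:
  assumes "conn E X" "E \<subseteq> F"
  shows "conn F X"
proof (rule connI)
  fix C assume "C \<subseteq> X" "C \<noteq> {}" "C \<noteq> X"
  then obtain x y where "x \<in> C" "y \<in> X" "y \<notin> C" "{x, y} \<in> E" using connD[OF assms(1)] by metis
  then show "\<exists>x\<in>C. \<exists>y\<in>X - C. {x, y} \<in> F" using assms(2) by auto
qed

lemma conn_cong:
  assumes "\<And>x y. x \<in> X \<Longrightarrow> y \<in> X \<Longrightarrow> {x, y} \<in> E \<longleftrightarrow> {x, y} \<in> F"
  shows "conn E X \<longleftrightarrow> conn F X"
proof -
  have "(\<exists>x\<in>C. \<exists>y\<in>X - C. {x, y} \<in> E) \<longleftrightarrow> (\<exists>x\<in>C. \<exists>y\<in>X - C. {x, y} \<in> F)" if "C \<subseteq> X" for C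
    using assms that by (intro bex_cong refl) auto
  then show ?thesis unfolding conn_def by simp
qed

lemma conn_Un:
  assumes X: "conn E X" and Y: "conn E Y" and XY: "X \<inter> Y \<noteq> {} \<or> (\<exists>x\<in>X. \<exists>y\<in>Y. {x, y} \<in> E)"
  shows "conn E (X \<union> Y)"
proof (rule connI)
  fix C assume C: "C \<subseteq> X \<union> Y" "C \<noteq> {}" "C \<noteq> X \<union> Y"
  show "\<exists>x\<in>C. \<exists>y\<in>X \<union> Y - C. {x, y} \<in> E"
  proof (cases "X \<inter> C \<noteq> {} \<and> X \<inter> C \<noteq> X")
    case True
    then obtain x y where "x \<in> X \<inter> C" "y \<in> X" "y \<notin> X \<inter> C" "{x, y} \<in> E"
      using connD[OF X, of "X \<inter> C"] by blast
    then show ?thesis by blast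
  next
    case F1: False
    show ?thesis
    proof (cases "Y \<inter> C \<noteq> {} \<and> Y \<inter> C \<noteq> Y")
      case True
      then obtain x y where "x \<in> Y \<inter> C" "y \<in> Y" "y \<notin> Y \<inter> C" "{x, y} \<in> E"
        using connD[OF Y, of "Y \<inter> C"] by blast
      then show ?thesis by blast
    next
      case False
      have "X \<inter> C = {} \<and> Y \<subseteq> C \<or> X \<subseteq> C \<and> Y \<inter> C = {}"
        using False F1 C by auto
      then show ?thesis
      proof (elim disjE conjE)
        assume *: "X \<inter> C = {}" "Y \<subseteq> C"
        then obtain x y where "x \<in> X" "y \<in> Y" "{x, y} \<in> E" using XY by blast
        then show ?thesis using * by (intro bexI[of _ y] bexI[of _ x]) (auto simp: insert_commute)
      next
        assume *: "X \<subseteq> C" "Y \<inter> C = {}"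
        then obtain x y where "x \<in> X" "y \<in> Y" "{x, y} \<in> E" using XY by blast
        then show ?thesis using * by blast
      qed
    qed
  qed
qed

lemma conn_insert:
  assumes "conn E X" "y \<in> X" "{x, y} \<in> E"
  shows "conn E (insert x X)"
  using conn_Un[OF conn_singleton[of E x] assms(1)] assms(2,3) by auto

lemma conn_star:
  assumes "\<And>x. x \<in> X \<Longrightarrow> {c, x} \<in> E"
  shows "conn E (insert c X)"
proof (rule connI)
  fix C assume C: "C \<subseteq> insert c X" "C \<noteq> {}" "C \<noteq> insert c X"
  show "\<exists>x\<in>C. \<exists>y\<in>insert c X - C. {x, y} \<in> E"
  proof (cases "c \<in> C")
    case True
    then show ?thesis using C assms by blast
  next
    case False
    then show ?thesis using C assms by (metis insertE insertI1 DiffI all_not_in_conv insert_commute subsetD)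
  qed
qed

lemma conn_attach:
  assumes Y: "conn E Y" "Y \<noteq> {}" and X: "\<And>x. x \<in> X \<Longrightarrow> \<exists>y\<in>Y. {x, y} \<in> E"
  shows "conn E (Y \<union> X)"
proof (rule connI)
  fix C assume C: "C \<subseteq> Y \<union> X" "C \<noteq> {}" "C \<noteq> Y \<union> X"
  show "\<exists>x\<in>C. \<exists>y\<in>Y \<union> X - C. {x, y} \<in> E"
  proof (cases "Y \<inter> C \<noteq> {} \<and> Y \<inter> C \<noteq> Y")
    case True
    then obtain x y where "x \<in> Y \<inter> C" "y \<in> Y" "y \<notin> Y \<inter> C" "{x, y} \<in> E"
      using connD[OF Y(1), of "Y \<inter> C"] by blast
    then show ?thesis by blast
  next
    case False
    then consider "Y \<inter> C = {}" | "Y \<subseteq> C" by blast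
    then show ?thesis
    proof cases
      case 1
      then obtain x where "x \<in> C" "x \<in> X" using C by blast
      then show ?thesis using X[of x] 1 by blast
    next
      case 2
      then obtain x where "x \<in> X" "x \<notin> C" using C by blast
      then show ?thesis using X[of x] 2 by (metis DiffI UnI2 insert_commute subsetD)
    qed
  qed
qed

lemma nbI: "x \<in> X \<Longrightarrow> {x, v} \<in> E \<Longrightarrow> v \<notin> X \<Longrightarrow> v \<in> nb E X"
  unfolding nb_def by blast

lemma nbD: "v \<in> nb E X \<Longrightarrow> v \<notin> X \<and> (\<exists>x\<in>X. {x, v} \<in> E)"
  unfolding nb_def by blast

lemma conn_nb_Un:
  assumes "conn E Y" "X \<subseteq> nb E Y"
  shows "conn E (Y \<union> X)"
proof (cases "Y = {}")
  case True
  then show ?thesis using assms unfolding nb_def by simp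
next
  case False
  have "\<exists>y\<in>Y. {x, y} \<in> E" if "x \<in> X" for x
    using assms(2) that nbD[of x E Y] by (metis insert_commute subsetD)
  then show ?thesis using conn_attach[OF assms(1) False] by blast
qed

lemma conn_crosses:
  assumes "conn E A" "A \<inter> K \<noteq> {}" "A - K \<noteq> {}"
  shows "A \<inter> nb E K \<noteq> {}"
proof -
  obtain x y where "x \<in> A \<inter> K" "y \<in> A" "y \<notin> A \<inter> K" "{x, y} \<in> E"
    using connD[OF assms(1), of "A \<inter> K"] assms(2,3) by blast
  then show ?thesis unfolding nb_def by blast
qed

lemma graph_edge: "graph V E \<Longrightarrow> {x, y} \<in> E \<Longrightarrow> x \<in> V \<and> y \<in> V \<and> x \<noteq> y"
  unfolding graph_def by (cases "x = y") auto

lemma graph_finite: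
  assumes "graph V E"
  shows "finite V" "finite E"
proof -
  show "finite V" using assms by (simp add: graph_def)
  have "E \<subseteq> Pow V" using assms by (auto simp: graph_def)
  then show "finite E" using \<open>finite V\<close> finite_subset by blast
qed

lemma graph_edgeE:
  assumes "graph V E" "e \<in> E"
  obtains x y where "e = {x, y}" "x \<noteq> y" "x \<in> V" "y \<in> V"
proof -
  have "e \<subseteq> V" "card e = 2" using assms unfolding graph_def by auto
  then obtain x y where "e = {x, y}" "x \<noteq> y" by (auto simp: card_2_iff)
  then show thesis using that \<open>e \<subseteq> V\<close> by auto
qed

lemma nb_subset: "graph V E \<Longrightarrow> nb E X \<subseteq> V"
  unfolding nb_def by (auto dest: graph_edge)

lemma nb_finite: "graph V E \<Longrightarrow> finite (nb E X)"
  by (rule finite_subset[OF nb_subset graph_finite(1)])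

lemma graph_restrict: "graph V E \<Longrightarrow> W \<subseteq> V \<Longrightarrow> graph W {e \<in> E. e \<subseteq> W}"
  unfolding graph_def by (auto intro: finite_subset)

lemma graph_delete: "graph V E \<Longrightarrow> graph (V - {a}) {e \<in> E. a \<notin> e}"
  unfolding graph_def by auto

lemma conn_restrict: "X \<subseteq> W \<Longrightarrow> conn {e \<in> E. e \<subseteq> W} X \<longleftrightarrow> conn E X"
  by (rule conn_cong) auto

lemma conn_delete: "a \<notin> X \<Longrightarrow> conn {e \<in> E. a \<notin> e} X \<longleftrightarrow> conn E X"
  by (rule conn_cong) auto

lemma er_split:
  assumes "finite E" "D \<subseteq> X"
  shows "er E X {} = er E D {} + er E (X - D) D"
proof -
  have "{e \<in> E. e \<inter> X \<noteq> {}} = {e \<in> E. e \<inter> D \<noteq> {}} \<union> {e \<in> E. e \<inter> (X - D) \<noteq> {} \<and> e \<inter> D = {}}"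
    using assms(2) by blast
  moreover have "card ({e \<in> E. e \<inter> D \<noteq> {}} \<union> {e \<in> E. e \<inter> (X - D) \<noteq> {} \<and> e \<inter> D = {}}) =
      card {e \<in> E. e \<inter> D \<noteq> {}} + card {e \<in> E. e \<inter> (X - D) \<noteq> {} \<and> e \<inter> D = {}}"
    by (rule card_Un_disjoint) (use assms(1) in auto)
  ultimately show ?thesis unfolding er_def by simp
qed

lemma er_empty [simp]: "er E {} D = 0"
  unfolding er_def by simp

subsection \<open>Components\<close>

lemma compsD:
  assumes "K \<in> comps E D"
  shows "K \<subseteq> D" "K \<noteq> {}" "conn E K" "\<And>x y. x \<in> K \<Longrightarrow> y \<in> D \<Longrightarrow> {x, y} \<in> E \<Longrightarrow> y \<in> K"
  using assms unfolding comps_def by blast+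

lemma comps_conn_subset:
  assumes "K \<in> comps E D" "conn E X" "X \<subseteq> D" "X \<inter> K \<noteq> {}"
  shows "X \<subseteq> K"
proof (rule ccontr)
  assume "\<not> X \<subseteq> K"
  then obtain x y where "x \<in> X \<inter> K" "y \<in> X" "y \<notin> X \<inter> K" "{x, y} \<in> E"
    using connD[OF assms(2), of "X \<inter> K"] assms(4) by blast
  then show False using compsD(4)[OF assms(1)] assms(3) by blast
qed

lemma comps_disjoint:
  assumes "K \<in> comps E D" "L \<in> comps E D" "K \<noteq> L"
  shows "K \<inter> L = {}"
proof (rule ccontr)
  assume ne: "K \<inter> L \<noteq> {}"
  have "L \<subseteq> K" using comps_conn_subset[OF assms(1) compsD(3,1)[OF assms(2)]] ne by (simp add: Int_commute)
  moreover have "K \<subseteq> L" using comps_conn_subset[OF assms(2) compsD(3,1)[OF assms(1)]] ne by simp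
  ultimately show False using assms(3) by simp
qed

lemma comps_exists:
  assumes "finite D" "x \<in> D"
  obtains K where "K \<in> comps E D" "x \<in> K"
proof -
  let ?F = "{K. K \<subseteq> D \<and> x \<in> K \<and> conn E K}"
  have "finite ?F" "{x} \<in> ?F" using assms by auto
  moreover have "\<forall>K. K \<in> ?F \<longrightarrow> card K < Suc (card D)"
    using assms(1) by (simp add: card_mono le_imp_less_Suc)
  ultimately obtain K where K: "K \<in> ?F" "\<forall>L\<in>?F. card L \<le> card K"
    using ex_has_greatest_nat[of "\<lambda>K. K \<in> ?F" "{x}" card "Suc (card D)"] by auto
  have "{u, v} \<notin> E" if "u \<in> K" "v \<in> D - K" for u v
  proof
    assume "{u, v} \<in> E"
    then have "conn E (insert v K)" using conn_insert[of E K u v] K that by (simp add: insert_commute)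
    then have "card (insert v K) \<le> card K" using K that by blast
    then show False using that K assms(1) finite_subset[of K D] by (simp add: card_insert_if)
  qed
  then have "K \<in> comps E D" unfolding comps_def using K by blast
  then show thesis using that K by blast
qed

lemma comps_Union:
  assumes "finite D"
  shows "\<Union>(comps E D) = D"
proof
  show "\<Union>(comps E D) \<subseteq> D" using compsD(1) by fast
  show "D \<subseteq> \<Union>(comps E D)"
  proof
    fix x assume "x \<in> D"
    then obtain K where "K \<in> comps E D" "x \<in> K" using comps_exists[OF assms] by blast
    then show "x \<in> \<Union>(comps E D)" by blast
  qed
qed

lemma comps_finite: "finite D \<Longrightarrow> finite (comps E D)"
  by (rule finite_subset[of _ "Pow D"]) (auto simp: comps_def)

lemma comps_nb:
  assumes "K \<in> comps E D"
  shows "nb E K \<inter> D = {}"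
  using compsD[OF assms] unfolding nb_def by blast

lemma comps_card_Int:
  assumes "finite D"
  shows "card (D \<inter> X) = (\<Sum>K\<in>comps E D. card (K \<inter> X))"
proof -
  have "D \<inter> X = (\<Union>K\<in>comps E D. K \<inter> X)" using comps_Union[OF assms, of E] by blast
  also have "card \<dots> = (\<Sum>K\<in>comps E D. card (K \<inter> X))"
  proof (rule card_UN_disjoint)
    show "\<forall>K\<in>comps E D. finite (K \<inter> X)"
      using compsD(1) assms finite_subset by (metis finite_Int)
    show "\<forall>K\<in>comps E D. \<forall>L\<in>comps E D. K \<noteq> L \<longrightarrow> (K \<inter> X) \<inter> (L \<inter> X) = {}"
      using comps_disjoint by fast
  qed (rule comps_finite[OF assms])
  finally show ?thesis .
qed

lemma comps_er:
  assumes "finite D" "finite E" "\<And>e. e \<in> E \<Longrightarrow> card e = 2"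
  shows "er E D {} = (\<Sum>K\<in>comps E D. er E K {})"
proof -
  let ?T = "\<lambda>K. {e \<in> E. e \<inter> K \<noteq> {}}"
  have "?T D = (\<Union>K\<in>comps E D. ?T K)" using comps_Union[OF assms(1), of E] by blast
  also have "card \<dots> = (\<Sum>K\<in>comps E D. card (?T K))"
  proof (rule card_UN_disjoint)
    show "\<forall>K\<in>comps E D. \<forall>L\<in>comps E D. K \<noteq> L \<longrightarrow> ?T K \<inter> ?T L = {}"
    proof (intro ballI impI)
      fix K L assume KL: "K \<in> comps E D" "L \<in> comps E D" "K \<noteq> L"
      have False if "e \<in> E" "x \<in> e" "x \<in> K" "y \<in> e" "y \<in> L" for e x y
      proof -
        have "x \<noteq> y" using comps_disjoint[OF KL] that by blast
        then have "e = {x, y}" using assms(3)[OF that(1)] that by (auto simp: card_2_iff)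
        then have "y \<in> K" using compsD(4)[OF KL(1) that(3)] compsD(1)[OF KL(2)] that by blast
        then show False using comps_disjoint[OF KL] that by blast
      qed
      then show "?T K \<inter> ?T L = {}" by blast
    qed
  qed (use comps_finite[OF assms(1)] assms(2) in auto)
  finally show ?thesis unfolding er_def by simp
qed

text \<open>No edge meets two components, so bounds per component add up. The term
  \<open>card (K \<inter> X)\<close> is the surplus that a component may charge to its vertices in
  \<open>X\<close>.\<close>

lemma comps_er_Int_le:
  assumes "finite D" "finite E" "\<And>e. e \<in> E \<Longrightarrow> card e = 2"
    and "\<And>K. K \<in> comps E D \<Longrightarrow> er E K {} + card (K \<inter> U) \<le> c * card K + card (K \<inter> X)"
  shows "er E D {} + card (D \<inter> U) \<le> c * card D + card (D \<inter> X)"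
proof -
  have "er E D {} + card (D \<inter> U) = (\<Sum>K\<in>comps E D. er E K {} + card (K \<inter> U))"
    using comps_er[OF assms(1-3)] comps_card_Int[OF assms(1), of U E] by (simp add: sum.distrib)
  also have "\<dots> \<le> (\<Sum>K\<in>comps E D. c * card (K \<inter> UNIV) + card (K \<inter> X))"
    by (rule sum_mono) (use assms(4) in simp)
  also have "\<dots> = c * card D + card (D \<inter> X)"
    using comps_card_Int[OF assms(1), of UNIV E] comps_card_Int[OF assms(1), of X E]
    by (simp add: sum.distrib sum_distrib_left)
  finally show ?thesis .
qed

lemma comps_er_le:
  assumes "finite D" "finite E" "\<And>e. e \<in> E \<Longrightarrow> card e = 2"
    and "\<And>K. K \<in> comps E D \<Longrightarrow> er E K {} \<le> c * card K + card (K \<inter> X)"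
  shows "er E D {} \<le> c * card D + card (D \<inter> X)"
  using comps_er_Int_le[OF assms(1-3), of "{}" c X] assms(4) by simp

subsection \<open>Paths\<close>

definition walk :: "'a set set \<Rightarrow> 'a list \<Rightarrow> bool" where
  "walk E p \<longleftrightarrow> p \<noteq> [] \<and> (\<forall>i. Suc i < length p \<longrightarrow> {p ! i, p ! Suc i} \<in> E)"

definition induced_path :: "'a set set \<Rightarrow> 'a \<Rightarrow> 'a \<Rightarrow> 'a list \<Rightarrow> bool" where
  "induced_path E s t p \<longleftrightarrow> walk E p \<and> distinct p \<and> hd p = s \<and> last p = t \<and>
     (\<forall>i j. i < j \<longrightarrow> j < length p \<longrightarrow> {p ! i, p ! j} \<in> E \<longrightarrow> j = Suc i)"

lemma walk_append:
  assumes "walk E p" "walk E q" "{last p, hd q} \<in> E"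
  shows "walk E (p @ q)"
proof -
  have "{(p @ q) ! i, (p @ q) ! Suc i} \<in> E" if "Suc i < length (p @ q)" for i
  proof -
    consider "Suc i < length p" | "Suc i = length p" | "Suc i > length p" by linarith
    then show ?thesis
    proof cases
      case 1
      then show ?thesis using assms(1) by (auto simp: walk_def nth_append)
    next
      case 2
      then have "(p @ q) ! i = last p"
        by (metis assms(1) diff_Suc_1 last_conv_nth lessI nth_append walk_def)
      moreover have "(p @ q) ! Suc i = hd q"
        using 2 assms(2) by (simp add: nth_append hd_conv_nth walk_def)
      ultimately show ?thesis using assms(3) by simp
    next
      case 3
      then have *: "Suc i - length p = Suc (i - length p)" "Suc (i - length p) < length q"
        using that by auto
      then show ?thesis using assms(2) 3 by (simp add: nth_append walk_def)
    qed
  qed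
  then show ?thesis using assms(1) unfolding walk_def by simp
qed

lemma walk_snoc: "walk E p \<Longrightarrow> {last p, y} \<in> E \<Longrightarrow> walk E (p @ [y])"
  by (rule walk_append) (simp_all add: walk_def)

lemma walk_take: "walk E p \<Longrightarrow> 0 < n \<Longrightarrow> walk E (take n p)"
  unfolding walk_def by auto

lemma walk_drop: "walk E p \<Longrightarrow> n < length p \<Longrightarrow> walk E (drop n p)"
  unfolding walk_def by auto

lemma walk_rev: 
  assumes "walk E p" shows "walk E (rev p)"
proof -
  have "{rev p ! i, rev p ! Suc i} \<in> E" if "Suc i < length p" for i
  proof -
    have "{p ! (length p - Suc (Suc i)), p ! Suc (length p - Suc (Suc i))} \<in> E"
      using assms that unfolding walk_def by auto
    moreover have "Suc (length p - Suc (Suc i)) = length p - Suc i" using that by linarith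
    ultimately show ?thesis using that by (simp add: rev_nth insert_commute)
  qed
  then show ?thesis using assms unfolding walk_def by simp
qed

lemma last_take_Suc: "k < length p \<Longrightarrow> last (take (Suc k) p) = p ! k"
  by (simp add: take_Suc_conv_app_nth)

lemma walk_conn: "walk E p \<Longrightarrow> conn E (set p)"
proof (induction p rule: rev_induct)
  case Nil
  then show ?case by (simp add: walk_def)
next
  case (snoc y p)
  show ?case
  proof (cases "p = []")
    case True
    then show ?thesis by simp
  next
    case False
    then have "walk E p" using walk_take[OF snoc.prems, of "length p"] by simp
    then have "conn E (set p)" using snoc.IH by blast
    moreover have "{last p, y} \<in> E"
    proof -
      have "{(p @ [y]) ! (length p - 1), (p @ [y]) ! Suc (length p - 1)} \<in> E"
        using snoc.prems False unfolding walk_def by (metis One_nat_def Suc_pred length_append_singleton length_greater_0_conv lessI)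
      then show ?thesis using False by (simp add: nth_append last_conv_nth)
    qed
    ultimately show ?thesis using conn_insert[of E "set p" "last p" y] False
      by (simp add: insert_commute)
  qed
qed

lemma conn_walk:
  assumes "conn E X" "s \<in> X" "t \<in> X"
  shows "\<exists>p. walk E p \<and> hd p = s \<and> last p = t \<and> set p \<subseteq> X"
proof -
  let ?C = "{t. \<exists>p. walk E p \<and> hd p = s \<and> last p = t \<and> set p \<subseteq> X}"
  have "[s] \<in> {p. walk E p \<and> hd p = s \<and> last p = s \<and> set p \<subseteq> X}"
    using assms(2) by (simp add: walk_def)
  then have "s \<in> ?C" by blast
  have "?C \<subseteq> X"
    by (smt (verit) last_in_set mem_Collect_eq subsetD subsetI walk_def)
  have "?C = X"
  proof (rule ccontr)
    assume "?C \<noteq> X"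
    then obtain x y where xy: "x \<in> ?C" "y \<in> X" "y \<notin> ?C" "{x, y} \<in> E"
      using connD[OF assms(1) \<open>?C \<subseteq> X\<close>] \<open>s \<in> ?C\<close> by blast
    then obtain p where p: "walk E p" "hd p = s" "last p = x" "set p \<subseteq> X" by blast
    then have "walk E (p @ [y])" "hd (p @ [y]) = s" "last (p @ [y]) = y" "set (p @ [y]) \<subseteq> X"
      using xy walk_snoc[of E p y] by (auto simp: walk_def)
    then show False using xy(3) by blast
  qed
  then show ?thesis using assms(3) by blast
qed

text \<open>A shortest walk qualifies: a repeated vertex or a chord would allow a segment to be cut
  out.\<close>

lemma conn_induced_path:
  assumes "conn E X" "s \<in> X" "t \<in> X"
  obtains p where "induced_path E s t p" "set p \<subseteq> X"
proof -
  let ?P = "\<lambda>p. walk E p \<and> hd p = s \<and> last p = t \<and> set p \<subseteq> X"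
  obtain p0 where "?P p0" using conn_walk[OF assms] by blast
  then obtain p where p: "?P p" and min: "\<And>q. ?P q \<Longrightarrow> length p \<le> length q"
    using ex_has_least_nat[of ?P p0 length] by blast
  have short: False if ij: "i < j" "j < length p" "p ! i = p ! j \<or> {p ! i, p ! j} \<in> E \<and> j \<noteq> Suc i" for i j
  proof (cases "p ! i = p ! j")
    case True
    let ?q = "take i p @ drop j p"
    have "?P ?q"
    proof (cases "i = 0")
      case True
      then show ?thesis using p ij \<open>p ! i = p ! j\<close> walk_drop[of E p j]
        by (auto simp: hd_drop_conv_nth hd_conv_nth walk_def dest: in_set_dropD)
    next
      case False
      have "last (take i p) = p ! (i - 1)" using last_take_Suc[of "i - 1" p] False ij by simp
      moreover have "{p ! (i - 1), p ! Suc (i - 1)} \<in> E"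
      proof -
        have "Suc (i - 1) < length p" using ij by linarith
        then show ?thesis using p unfolding walk_def by blast
      qed
      ultimately have "{last (take i p), hd (drop j p)} \<in> E"
        using True ij False by (simp add: hd_drop_conv_nth)
      then have "walk E ?q" using walk_append[OF walk_take walk_drop] p ij False by auto
      then show ?thesis using p ij False by (auto simp: walk_def dest: in_set_dropD in_set_takeD)
    qed
    then show False using min[of ?q] ij by simp
  next
    case False
    let ?q = "take (Suc i) p @ drop j p"
    have "last (take (Suc i) p) = p ! i" "hd (drop j p) = p ! j"
      using ij by (simp_all add: last_take_Suc hd_drop_conv_nth)
    then have "walk E ?q" using walk_append[OF walk_take walk_drop, of E p "Suc i" p j] p ij False by auto
    then have "?P ?q" using p ij by (auto simp: walk_def dest: in_set_dropD in_set_takeD)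
    then have "length p \<le> Suc i + (length p - j)" using min[of ?q] ij by simp
    moreover have "Suc i < j" using ij False by linarith
    ultimately show False using ij by linarith
  qed
  have "distinct p" unfolding distinct_conv_nth using short by (metis linorder_neqE_nat)
  then have "induced_path E s t p" unfolding induced_path_def using p short by blast
  then show thesis using that p by blast
qed

text \<open>The detour through \<open>K\<close> skips \<open>p ! j\<close>. It contradicts any claim
  that \<open>p ! j\<close> is unavoidable, and so limits how many vertices of \<open>p\<close> a
  component can see.\<close>

lemma bypass:
  assumes p: "walk E p" "distinct p" and ij: "i < j" "j < l" "l < length p"
    and K: "conn E K" "p ! i \<in> nb E K" "p ! l \<in> nb E K" "p ! j \<notin> K"
  shows "conn E (set (take (Suc i) p) \<union> K \<union> set (drop l p))" "hd p \<in> set (take (Suc i) p)"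
    "last p \<in> set (drop l p)" "p ! j \<notin> set (take (Suc i) p) \<union> K \<union> set (drop l p)"
proof -
  have i: "p ! i \<in> set (take (Suc i) p)" using ij by (auto simp: in_set_conv_nth)
  have l: "p ! l \<in> set (drop l p)" using ij by (auto simp: in_set_conv_nth intro!: exI[of _ 0])
  obtain x where x: "x \<in> K" "{x, p ! i} \<in> E" using nbD[OF K(2)] by blast
  obtain y where y: "y \<in> K" "{y, p ! l} \<in> E" using nbD[OF K(3)] by blast
  have "{p ! i, x} \<in> E" using x by (simp add: insert_commute)
  then have "conn E (set (take (Suc i) p) \<union> K)"
    using conn_Un[OF walk_conn[OF walk_take[OF p(1)]] K(1)] i x(1) by blast
  then show "conn E (set (take (Suc i) p) \<union> K \<union> set (drop l p))"
    by (rule conn_Un[OF _ walk_conn[OF walk_drop[OF p(1)]]]) (use ij l y in \<open>simp, blast\<close>)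
  show "hd p \<in> set (take (Suc i) p)" using ij by (cases p) auto
  show "last p \<in> set (drop l p)" using ij by (metis drop_eq_Nil2 last_drop last_in_set not_le)
  show "p ! j \<notin> set (take (Suc i) p) \<union> K \<union> set (drop l p)"
    using ij K(4) p(2) by (auto simp: in_set_conv_nth nth_eq_iff_index_eq)
qed

lemma card_le_2_if_no_triple:
  fixes I :: "nat set"
  assumes "finite I" "\<And>i j l. i \<in> I \<Longrightarrow> j \<in> I \<Longrightarrow> l \<in> I \<Longrightarrow> i < j \<Longrightarrow> j < l \<Longrightarrow> False"
  shows "card I \<le> 2"
proof (cases "I = {}")
  case False
  have "I \<subseteq> {Min I, Max I}"
  proof
    fix j assume j: "j \<in> I"
    show "j \<in> {Min I, Max I}"
    proof (rule ccontr)
      assume "j \<notin> {Min I, Max I}"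
      then have "Min I < j" "j < Max I" using assms(1) j by (auto simp: order_less_le)
      then show False using assms(2)[of "Min I" j "Max I"] assms(1) j False by auto
    qed
  qed
  then have "card I \<le> card {Min I, Max I}" by (rule card_mono[rotated]) simp
  also have "\<dots> \<le> 2" by (simp add: card_insert_if)
  finally show ?thesis .
qed simp

subsection \<open>Replacing a rigid set by a clique\<close>

definition inst :: "'a set \<Rightarrow> 'a set set \<Rightarrow> 'a set \<Rightarrow> 'a \<Rightarrow> 'a \<Rightarrow> bool" where
  "inst V E R b1 b2 \<longleftrightarrow> graph V E \<and> R \<subseteq> V \<and> b1 \<in> V \<and> b2 \<in> V \<and> b1 \<noteq> b2 \<and> b1 \<notin> R \<and> b2 \<notin> R"

text \<open>The unit saved in the second clause concerns one root and one end, because this is the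
  position of a contracted edge in a local instance that \<open>bad_set\<close> cannot treat
  otherwise.\<close>

definition sparse :: "'a set set \<Rightarrow> 'a set \<Rightarrow> 'a set \<Rightarrow> 'a set \<Rightarrow> 'a \<Rightarrow> 'a \<Rightarrow> bool" where
  "sparse E W D R b1 b2 \<longleftrightarrow> er E W D \<le> (card R + 1) * card W + 1 \<and>
     (\<forall>a\<in>R. \<forall>b\<in>{b1, b2}. (\<forall>w\<in>W. {w, a} \<in> E \<longrightarrow> {w, b} \<notin> E) \<longrightarrow>
        er E W D \<le> (card R + 1) * card W)"

lemma quot_edge:
  "{x, y} \<in> quot E Y \<longleftrightarrow>
     {x, y} \<in> E \<and> x \<notin> Y \<and> y \<notin> Y \<or> x \<in> nb E Y \<and> y \<in> nb E Y \<and> x \<noteq> y"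
  unfolding quot_def by (auto simp: doubleton_eq_iff)

lemma graph_quot:
  assumes "graph V E"
  shows "graph (V - Y) (quot E Y)"
proof -
  have "e \<subseteq> V - Y \<and> card e = 2" if "e \<in> quot E Y" for e
    using that assms nb_subset[OF assms, of Y] nbD[of _ E Y]
    unfolding quot_def graph_def by auto
  then show ?thesis using graph_finite[OF assms] unfolding graph_def by blast
qed

text \<open>A cut with vertices of \<open>nb E Y\<close> on both sides is crossed by a clique edge.
  If one side has none, the edge of \<open>E\<close> leaving that side cannot lead into
  \<open>Y\<close> and survives.\<close>

lemma conn_quot:
  assumes "conn E X"
  shows "conn (quot E Y) (X - Y)"
proof (rule connI)
  fix C assume C: "C \<subseteq> X - Y" "C \<noteq> {}" "C \<noteq> X - Y"
  have sep: "\<exists>x\<in>C. \<exists>y\<in>X - Y - C. {x, y} \<in> quot E Y"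
    if C: "C \<subseteq> X - Y" "C \<noteq> {}" "C \<noteq> X - Y" and "C \<inter> nb E Y = {}" for C
  proof -
    have "C \<subseteq> X" "C \<noteq> X" using C by auto
    then obtain x y where xy: "x \<in> C" "y \<in> X" "y \<notin> C" "{x, y} \<in> E"
      using connD[OF assms, of C] C(2) by metis
    then have "y \<notin> Y" using that nbI[of y Y x E] C by (auto simp: insert_commute)
    then show ?thesis using xy C quot_edge[of x y E Y] by blast
  qed
  show "\<exists>x\<in>C. \<exists>y\<in>X - Y - C. {x, y} \<in> quot E Y"
  proof (cases "C \<inter> nb E Y = {}")
    case True
    then show ?thesis using sep C by blast
  next
    case F: False
    show ?thesis
    proof (cases "(X - Y - C) \<inter> nb E Y = {}")
      case True
      moreover have "X - Y - C \<noteq> {}" "X - Y - C \<noteq> X - Y" using C by blast+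
      ultimately obtain x y where "x \<in> X - Y - C" "y \<in> X - Y - (X - Y - C)" "{x, y} \<in> quot E Y"
        using sep[of "X - Y - C"] by auto
      then show ?thesis by (intro bexI[of _ y] bexI[of _ x]) (auto simp: insert_commute)
    next
      case False
      then obtain x y where "x \<in> C" "x \<in> nb E Y" "y \<in> X - Y - C" "y \<in> nb E Y" using F by auto
      then show ?thesis using quot_edge[of x y E Y] by auto
    qed
  qed
qed

text \<open>An \<open>F\<close>-edge that is missing from \<open>E\<close> has both ends in
  \<open>Z\<close>, and \<open>Z\<close> is connected in \<open>E\<close> by itself. So a cut either
  splits \<open>Z\<close> or is crossed by an \<open>F\<close>-edge with an end outside
  \<open>Z\<close>.\<close>

lemma conn_extend:
  assumes X: "conn F X" and Z: "conn E Z" and XZ: "X \<inter> Z \<noteq> {}"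
    and FE: "\<And>x y. x \<in> X - Z \<Longrightarrow> y \<in> X \<Longrightarrow> {x, y} \<in> F \<Longrightarrow> {x, y} \<in> E"
  shows "conn E (X \<union> Z)"
proof (rule connI)
  fix C assume C: "C \<subseteq> X \<union> Z" "C \<noteq> {}" "C \<noteq> X \<union> Z"
  have sep: "\<exists>x\<in>D. \<exists>y\<in>X \<union> Z - D. {x, y} \<in> E" if D: "D \<subseteq> X" "D \<inter> Z = {}" "D \<noteq> {}" for D
  proof -
    have "D \<noteq> X" using D XZ by auto
    then obtain x y where "x \<in> D" "y \<in> X" "y \<notin> D" "{x, y} \<in> F"
      using connD[OF X D(1,3)] by metis
    then show ?thesis using FE[of x y] D by auto
  qed
  show "\<exists>x\<in>C. \<exists>y\<in>X \<union> Z - C. {x, y} \<in> E"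
  proof (cases "Z \<inter> C = {}")
    case True
    then show ?thesis using sep[of C] C by auto
  next
    case ne: False
    show ?thesis
    proof (cases "Z \<subseteq> C")
      case True
      then obtain x y where "x \<in> X \<union> Z - C" "y \<in> X \<union> Z - (X \<union> Z - C)" "{x, y} \<in> E"
        using sep[of "X \<union> Z - C"] C by auto
      then show ?thesis by (intro bexI[of _ y] bexI[of _ x]) (auto simp: insert_commute)
    next
      case False
      then have "Z \<inter> C \<noteq> Z" by auto
      then obtain x y where "x \<in> Z \<inter> C" "y \<in> Z" "y \<notin> Z \<inter> C" "{x, y} \<in> E"
        using connD[OF Z Int_lower1 ne] by metis
      then show ?thesis by auto
    qed
  qed
qed

lemma conn_quot_few:
  assumes X: "conn (quot E Y) X" "X \<inter> Y = {}"
    and few: "\<And>u v. u \<in> X \<inter> nb E Y \<Longrightarrow> v \<in> X \<inter> nb E Y \<Longrightarrow> u = v"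
  shows "conn E X"
proof -
  have "{x, y} \<in> quot E Y \<longleftrightarrow> {x, y} \<in> E" if "x \<in> X" "y \<in> X" for x y
    using few[of x y] quot_edge[of x y E Y] X(2) that by auto
  then show ?thesis using X(1) conn_cong[of X "quot E Y" E] by simp
qed

lemma conn_quot_extend:
  assumes "conn (quot E Y) X" "X \<inter> Y = {}" "conn E Z" "X \<inter> nb E Y \<subseteq> Z" "X \<inter> nb E Y \<noteq> {}"
  shows "conn E (X \<union> Z)"
  by (rule conn_extend[OF assms(1,3)]) (use assms quot_edge[of _ _ E Y] in auto)

lemma rigidD:
  assumes "rigid E Y" "s \<in> nb E Y" "t \<in> nb E Y" "s \<noteq> t"
  obtains A B where "linked E (Y \<union> nb E Y) (nb E Y - {s, t}) s t A B"
  using assms unfolding rigid_def feas_def by metis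

text \<open>A shortest path uses at most one edge of the clique on \<open>nb E Y\<close>; rigidity replaces it
  by a path through \<open>Y\<close> while keeping the other vertices of \<open>nb E Y\<close> connected.\<close>

lemma linked_quot_lift:
  assumes Y: "rigid E Y" and W: "Y \<subseteq> W" "nb E Y \<subseteq> W"
    and L: "linked (quot E Y) (W - Y) P s t A' B'"
  shows "\<exists>A B. linked E W P s t A B \<and> B \<subseteq> B' \<union> Y"
proof -
  let ?N = "nb E Y"
  have L': "A' \<subseteq> W - Y" "B' \<subseteq> W - Y" "A' \<inter> B' = {}" "P \<subseteq> A'" "s \<in> B'" "t \<in> B'"
    "conn (quot E Y) A'" "conn (quot E Y) B'"
    using L unfolding linked_def by auto
  obtain p where p: "induced_path (quot E Y) s t p" "set p \<subseteq> B'"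
    using conn_induced_path[OF L'(8,5,6)] by metis
  let ?B = "set p"
  have pw: "walk (quot E Y) p" "distinct p" "hd p = s" "last p = t" "p \<noteq> []"
    using p(1) unfolding induced_path_def walk_def by auto
  have B: "conn (quot E Y) ?B" "s \<in> ?B" "t \<in> ?B" "?B \<inter> Y = {}" "?B \<subseteq> W" "A' \<inter> ?B = {}" "A' \<inter> Y = {}"
    using walk_conn[OF pw(1)] pw(3-5) p(2) L' by auto
  have Yc: "conn E Y" "Y \<noteq> {}" using Y unfolding rigid_def by auto
  have two: "x \<in> {u, v}" if "u \<in> ?B \<inter> ?N" "v \<in> ?B \<inter> ?N" "u \<noteq> v" "x \<in> ?B \<inter> ?N" for u v x
  proof (rule ccontr)
    assume x: "x \<notin> {u, v}"
    let ?I = "{i. i < length p \<and> p ! i \<in> ?N}"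
    have "card ?I \<le> 2"
    proof (rule card_le_2_if_no_triple)
      fix i j l assume "i \<in> ?I" "j \<in> ?I" "l \<in> ?I" "i < j" "j < l"
      then have "p ! i \<in> ?N" "p ! l \<in> ?N" "l < length p" "i < l" "i < length p" by auto
      moreover from this have "p ! i \<noteq> p ! l" using pw(2) by (simp add: nth_eq_iff_index_eq)
      ultimately have "{p ! i, p ! l} \<in> quot E Y" using quot_edge[of "p ! i" "p ! l" E Y] by auto
      then have "l = Suc i" using p(1) \<open>l < length p\<close> \<open>i < l\<close> unfolding induced_path_def by blast
      then show False using \<open>i < j\<close> \<open>j < l\<close> by linarith
    qed auto
    moreover have "{u, v, x} \<subseteq> (!) p ` ?I" using that by (auto simp: in_set_conv_nth)
    then have "card {u, v, x} \<le> card ?I"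
      using surj_card_le[of ?I "{u, v, x}" "(!) p"] by simp
    ultimately show False using x that(3) by auto
  qed
  show ?thesis
  proof (cases "\<exists>u v. u \<in> ?B \<inter> ?N \<and> v \<in> ?B \<inter> ?N \<and> u \<noteq> v")
    case True
    then obtain u v where uv: "u \<in> ?B \<inter> ?N" "v \<in> ?B \<inter> ?N" "u \<noteq> v" by blast
    then obtain A0 B0 where "linked E (Y \<union> ?N) (?N - {u, v}) u v A0 B0"
      using rigidD[OF Y, of u v] by blast
    then have AB: "A0 \<subseteq> Y \<union> ?N" "B0 \<subseteq> Y \<union> ?N" "A0 \<inter> B0 = {}" "?N - {u, v} \<subseteq> A0" "u \<in> B0" "v \<in> B0"
      "conn E A0" "conn E B0"
      unfolding linked_def by auto
    have BN: "?B \<inter> ?N \<subseteq> {u, v}" using two[OF uv] by auto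
    have "conn E (?B \<union> B0)"
      by (rule conn_quot_extend[OF B(1,4) AB(8)]) (use BN AB uv in auto)
    \<comment> \<open>The other neighbours of \<open>Y\<close> lie in \<open>A0\<close>. Hence the
      path side grows only inside \<open>Y\<close>, which is what later carries
      \<open>U \<subseteq> B\<close> back and forth for \<open>U\<close> disjoint from
      \<open>Y\<close>.\<close>
    have "B0 \<subseteq> Y \<union> {u, v}" using AB by auto
    then have B0: "?B \<union> B0 \<subseteq> B' \<union> Y" "?B \<union> B0 \<subseteq> W" using p(2) uv AB(2) W B(5) by auto
    have "\<exists>A. conn E A \<and> A' \<subseteq> A \<and> A \<inter> (?B \<union> B0) = {} \<and> A \<subseteq> W"
    proof (cases "A' \<inter> ?N = {}")
      case True
      then have "conn E A'" using conn_quot_few[OF L'(7) B(7)] by auto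
      moreover have "A' \<inter> B0 = {}" using AB(2) True L'(1) by auto
      ultimately show ?thesis using B(6) L'(1) by auto
    next
      case False
      have "conn E (A' \<union> A0)"
        by (rule conn_quot_extend[OF L'(7) B(7) AB(7)]) (use False AB(4) uv B(6) in auto)
      moreover have "A' \<inter> B0 = {}" using \<open>B0 \<subseteq> Y \<union> {u, v}\<close> uv B(6,7) by auto
      moreover have "A0 \<inter> ?B = {}" using AB(1,3,5,6) BN B(4) by auto
      ultimately have "(A' \<union> A0) \<inter> (?B \<union> B0) = {}" using B(6) AB(3) by auto
      moreover have "A' \<union> A0 \<subseteq> W" using AB(1) W L'(1) by auto
      ultimately show ?thesis using \<open>conn E (A' \<union> A0)\<close> by auto
    qed
    then obtain A where "conn E A" "A' \<subseteq> A" "A \<inter> (?B \<union> B0) = {}" "A \<subseteq> W" by auto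
    then have "linked E W P s t A (?B \<union> B0)"
      unfolding linked_def using \<open>conn E (?B \<union> B0)\<close> B0 B L'(4) by auto
    then show ?thesis using B0(1) by blast
  next
    case False
    then have "conn E ?B" using conn_quot_few[OF B(1,4)] by blast
    have "\<exists>A. conn E A \<and> A' \<subseteq> A \<and> A \<inter> ?B = {} \<and> A \<subseteq> W"
    proof (cases "A' \<inter> ?N = {}")
      case True
      then have "conn E A'" using conn_quot_few[OF L'(7) B(7)] by auto
      then show ?thesis using B(6) L'(1) by auto
    next
      case False
      \<comment> \<open>The path needs nothing from \<open>Y\<close> here, so all of
        \<open>Y\<close> may serve to rejoin \<open>A'\<close>.\<close>
      have "conn E (Y \<union> (A' \<inter> ?N))" by (rule conn_nb_Un[OF Yc(1)]) auto
      then have "conn E (A' \<union> (Y \<union> (A' \<inter> ?N)))"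
        by (rule conn_quot_extend[OF L'(7) B(7)]) (use False in auto)
      moreover have "A' \<union> (Y \<union> (A' \<inter> ?N)) \<subseteq> W" using W L'(1) by auto
      moreover have "(A' \<union> (Y \<union> (A' \<inter> ?N))) \<inter> ?B = {}" using B(4,6) by auto
      ultimately show ?thesis by auto
    qed
    then obtain A where "conn E A" "A' \<subseteq> A" "A \<inter> ?B = {}" "A \<subseteq> W" by auto
    then have "linked E W P s t A ?B"
      unfolding linked_def using \<open>conn E ?B\<close> B L'(4) by auto
    then show ?thesis using p(2) by blast
  qed
qed

text \<open>Bounds on orders survive the return of \<open>Y\<close>. A component that touches
  \<open>Y\<close> without being \<open>Y\<close> stems from one component of the quotient, since
  the clique merges its pieces and lets them see the rest of \<open>nb E Y\<close>.\<close>

lemma comps_quot: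
  assumes Y: "conn E Y" "Y \<noteq> {}" "D \<inter> Y = {}" "finite D" and K: "K \<in> comps E (D \<union> Y)"
  shows "K = Y \<or> (\<exists>L\<in>comps (quot E Y) D. nb E K \<subseteq> nb (quot E Y) L)"
proof (cases "K \<inter> Y = {}")
  case True
  note c = compsD[OF K]
  have KN: "v \<notin> nb E Y" if "v \<in> K" for v
  proof
    assume "v \<in> nb E Y"
    then obtain y where "y \<in> Y" "{v, y} \<in> E" using nbD[of v E Y] by (auto simp: insert_commute)
    then show False using c(4)[of v y] that True by auto
  qed
  have eq: "{x, y} \<in> quot E Y \<longleftrightarrow> {x, y} \<in> E \<and> y \<notin> Y" if "x \<in> K" for x y
    using KN[OF that] True that quot_edge[of x y E Y] by auto
  have noY: "{x, y} \<notin> E" if "x \<in> K" "y \<in> Y" for x y using c(4)[of x y] that True by auto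
  have "conn (quot E Y) K" using c(3) conn_cong[of K E "quot E Y"] eq True by auto
  moreover have "{x, y} \<notin> quot E Y" if "x \<in> K" "y \<in> D - K" for x y
    using eq[OF that(1)] c(4)[of x y] that by auto
  ultimately have "K \<in> comps (quot E Y) D" using c(1,2) True unfolding comps_def by auto
  moreover have "nb E K \<subseteq> nb (quot E Y) K"
    using eq noY unfolding nb_def by blast
  ultimately show ?thesis by auto
next
  case False
  note c = compsD[OF K]
  have YK: "Y \<subseteq> K" using comps_conn_subset[OF K Y(1)] False by auto
  show ?thesis
  proof (cases "K = Y")
    case False
    let ?L = "K - Y"
    have ne: "?L \<noteq> {}" using False YK by auto
    obtain u where u: "u \<in> ?L" "u \<in> nb E Y"
    proof -
      have "K \<inter> nb E Y \<noteq> {}" by (rule conn_crosses[OF c(3)]) (use YK Y(2) ne in auto)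
      then show thesis using that nbD[of _ E Y] by auto
    qed
    have "conn (quot E Y) ?L" by (rule conn_quot[OF c(3)])
    moreover have "{x, y} \<notin> quot E Y" if "x \<in> ?L" "y \<in> D - ?L" for x y
    proof
      assume "{x, y} \<in> quot E Y"
      moreover have "y \<notin> K" "y \<in> D" using that Y(3) by auto
      moreover have "{x, y} \<notin> E" using c(4)[of x y] that calculation by auto
      ultimately have "y \<in> nb E Y" using quot_edge[of x y E Y] by auto
      then obtain z where "z \<in> Y" "{z, y} \<in> E" using nbD[of y E Y] by auto
      then show False using c(4)[of z y] YK \<open>y \<notin> K\<close> \<open>y \<in> D\<close> by auto
    qed
    ultimately have L: "?L \<in> comps (quot E Y) D" using ne c(1) unfolding comps_def by auto
    have "v \<in> nb (quot E Y) ?L" if v: "v \<in> nb E K" for v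
    proof -
      obtain x where x: "x \<in> K" "{x, v} \<in> E" "v \<notin> K" using nbD[OF v] by auto
      show ?thesis
      proof (cases "x \<in> Y")
        case True
        then have "v \<in> nb E Y" using x YK by (auto intro: nbI)
        then have "{u, v} \<in> quot E Y" using u quot_edge[of u v E Y] x(3) by auto
        then show ?thesis using nbI[OF u(1)] x(3) by auto
      next
        case False
        then have "{x, v} \<in> quot E Y" using x YK quot_edge[of x v E Y] by auto
        then show ?thesis using nbI[of x ?L v] x False by auto
      qed
    qed
    then show ?thesis using L by blast
  qed simp
qed

text \<open>The strict version lets an edge created by the clique pay for a \<open>+ 1\<close>: it
  is counted in the quotient but not in \<open>E\<close>.\<close>

lemma er_quot: 
  assumes "graph V E" "W \<inter> Y = {}"
  shows "er E W (D \<union> Y) \<le> er (quot E Y) W D"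
    and "\<lbrakk>e \<in> quot E Y; e \<notin> E; e \<inter> W \<noteq> {}; e \<inter> D = {}\<rbrakk> \<Longrightarrow> er E W (D \<union> Y) < er (quot E Y) W D"
proof -
  let ?S = "{e \<in> E. e \<inter> W \<noteq> {} \<and> e \<inter> (D \<union> Y) = {}}"
  let ?T = "{e \<in> quot E Y. e \<inter> W \<noteq> {} \<and> e \<inter> D = {}}"
  have fin: "finite ?T" using graph_finite(2)[OF graph_quot[OF assms(1)]] by simp
  have sub: "?S \<subseteq> ?T" unfolding quot_def by auto
  show "er E W (D \<union> Y) \<le> er (quot E Y) W D" unfolding er_def by (rule card_mono[OF fin sub])
  assume "e \<in> quot E Y" "e \<notin> E" "e \<inter> W \<noteq> {}" "e \<inter> D = {}"
  then have "?S \<subset> ?T" using sub by blast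
  then show "er E W (D \<union> Y) < er (quot E Y) W D" unfolding er_def by (rule psubset_card_mono[OF fin])
qed

text \<open>A predicate, so that it can serve as an induction hypothesis for arbitrary smaller
  vertex sets, edges and terminals before it is proved.\<close>

definition reduced_bound :: "'a set \<Rightarrow> 'a set set \<Rightarrow> 'a set \<Rightarrow> 'a \<Rightarrow> 'a \<Rightarrow> bool" where
  "reduced_bound V E R b1 b2 \<longleftrightarrow>
     (inst V E R b1 b2 \<longrightarrow> \<not> feas E V R b1 b2 \<longrightarrow>
      (\<forall>Y\<subseteq>V - (R \<union> {b1, b2}). card (nb E Y) \<le> card R + 1 \<longrightarrow> \<not> rigid E Y) \<longrightarrow>
      sparse E (V - (R \<union> {b1, b2})) {} R b1 b2)"

text \<open>Rigid sets are replaced by cliques one at a time; \<open>D\<close> is their union.\<close>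

lemma infeasible_decomposition:
  assumes "\<And>V' E'. card V' \<le> card V \<Longrightarrow> reduced_bound V' E' R b1 b2"
    and "inst V E R b1 b2" "\<not> feas E V R b1 b2"
  shows "\<exists>D\<subseteq>V - (R \<union> {b1, b2}). (\<forall>K\<in>comps E D. card (nb E K) \<le> card R + 1) \<and>
    sparse E (V - (R \<union> {b1, b2}) - D) D R b1 b2"
  using assms
proof (induction "card V" arbitrary: V E rule: less_induct)
  case less
  let ?S = "R \<union> {b1, b2}"
  have G: "graph V E" and I: "R \<subseteq> V" "b1 \<in> V" "b2 \<in> V" "b1 \<noteq> b2" "b1 \<notin> R" "b2 \<notin> R"
    using less.prems(2) unfolding inst_def by auto
  show ?case
  proof (cases "\<exists>Y\<subseteq>V - ?S. card (nb E Y) \<le> card R + 1 \<and> rigid E Y")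
    case False
    then have "sparse E (V - ?S - {}) {} R b1 b2"
      using less.prems(1)[of V E] less.prems(2,3) unfolding reduced_bound_def by auto
    moreover have "comps E {} = {}" unfolding comps_def by auto
    ultimately show ?thesis by (intro exI[of _ "{}"]) auto
  next
    case True
    then obtain Y where Y: "Y \<subseteq> V - ?S" "card (nb E Y) \<le> card R + 1" "rigid E Y" by auto
    have Yc: "conn E Y" "Y \<noteq> {}" using Y(3) unfolding rigid_def by auto
    have lt: "card (V - Y) < card V"
      using Y(1) Yc(2) graph_finite(1)[OF G] by (intro psubset_card_mono) auto
    have G': "graph (V - Y) (quot E Y)" by (rule graph_quot[OF G])
    have "inst (V - Y) (quot E Y) R b1 b2" unfolding inst_def using G' I Y(1) by auto
    moreover have "\<not> feas (quot E Y) (V - Y) R b1 b2"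
      using linked_quot_lift[OF Y(3), of V R b1 b2] Y(1) nb_subset[OF G, of Y] less.prems(3)
      unfolding feas_def by blast
    ultimately obtain D where D: "D \<subseteq> V - Y - ?S"
      "\<forall>K\<in>comps (quot E Y) D. card (nb (quot E Y) K) \<le> card R + 1"
      "sparse (quot E Y) (V - Y - ?S - D) D R b1 b2"
      using less.hyps[OF lt] less.prems(1) lt by (meson less_imp_le order_trans)
    let ?W = "V - Y - ?S - D"
    have W: "V - ?S - (D \<union> Y) = ?W" by auto
    have "card (nb E K) \<le> card R + 1" if K: "K \<in> comps E (D \<union> Y)" for K
    proof -
      have "finite D" using D(1) graph_finite(1)[OF G] by (meson Diff_subset finite_subset subset_trans)
      then consider "K = Y" | L where "L \<in> comps (quot E Y) D" "nb E K \<subseteq> nb (quot E Y) L"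
        using comps_quot[OF Yc _ _ K] D(1) by auto
      then show ?thesis
      proof cases
        case 1
        then show ?thesis using Y(2) by simp
      next
        case 2
        have "card (nb E K) \<le> card (nb (quot E Y) L)"
          using 2(2) nb_finite[OF G'] card_mono by metis
        then show ?thesis using D(2) 2(1) by fastforce
      qed
    qed
    moreover have "sparse E ?W (D \<union> Y) R b1 b2"
      unfolding sparse_def
    proof (intro conjI ballI impI)
      have WY: "?W \<inter> Y = {}" by auto
      have le: "er E ?W (D \<union> Y) \<le> er (quot E Y) ?W D" by (rule er_quot(1)[OF G WY])
      show "er E ?W (D \<union> Y) \<le> (card R + 1) * card ?W + 1" using le D(3) unfolding sparse_def by linarith
      fix a b assume ab: "a \<in> R" "b \<in> {b1, b2}" "\<forall>w\<in>?W. {w, a} \<in> E \<longrightarrow> {w, b} \<notin> E"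
      show "er E ?W (D \<union> Y) \<le> (card R + 1) * card ?W"
      proof (cases "\<forall>w\<in>?W. {w, a} \<in> quot E Y \<longrightarrow> {w, b} \<notin> quot E Y")
        case True
        then have "er (quot E Y) ?W D \<le> (card R + 1) * card ?W"
          using D(3) ab(1,2) unfolding sparse_def by blast
        then show ?thesis using le by linarith
      next
        case False
        then obtain w where w: "w \<in> ?W" "{w, a} \<in> quot E Y" "{w, b} \<in> quot E Y" by auto
        have nD: "a \<notin> D" "b \<notin> D" "w \<notin> D" using ab(1,2) D(1) w(1) by auto
        \<comment> \<open>\<open>w\<close> is a common neighbour only through a clique edge. That
          edge is absent from \<open>E\<close>, and the strict count makes up for the weaker bound
          of the quotient.\<close>
        have "{w, a} \<notin> E \<or> {w, b} \<notin> E" using ab(3) w(1) by auto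
        then have "er E ?W (D \<union> Y) < er (quot E Y) ?W D"
          using er_quot(2)[OF G WY w(2)] er_quot(2)[OF G WY w(3)] w(1) nD by auto
        then show ?thesis using D(3) unfolding sparse_def by linarith
      qed
    qed
    moreover have "D \<union> Y \<subseteq> V - ?S" using D(1) Y(1) by auto
    ultimately show ?thesis unfolding W[symmetric] by blast
  qed
qed

subsection \<open>Restriction, deletion and contraction\<close>

lemma graph_edge_at:
  assumes "graph V E" "e \<in> E" "x \<in> e"
  obtains y where "e = {x, y}" "x \<noteq> y"
proof -
  obtain u v where "e = {u, v}" "u \<noteq> v" using graph_edgeE[OF assms(1,2)] by metis
  then consider "x = u" | "x = v" using assms(3) by auto
  then show thesis
  proof cases
    case 1
    then show thesis using that[of v] \<open>e = {u, v}\<close> \<open>u \<noteq> v\<close> by simp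
  next
    case 2
    then show thesis using that[of u] \<open>e = {u, v}\<close> \<open>u \<noteq> v\<close> by (simp add: insert_commute)
  qed
qed

lemma graph_edge_meet:
  assumes "graph V E" "e \<in> E" "e \<inter> W \<noteq> {}"
  obtains x y where "e = {x, y}" "x \<in> W" "x \<noteq> y"
proof -
  obtain x where "x \<in> e" "x \<in> W" using assms(3) by auto
  then show thesis using graph_edge_at[OF assms(1,2), of x] that by metis
qed

lemma feas_commute: "feas E W P s t \<longleftrightarrow> feas E W P t s"
  unfolding feas_def linked_def by (intro iff_exI) auto

lemma feas_restrict:
  assumes "W \<subseteq> W'"
  shows "feas {e \<in> E. e \<subseteq> W'} W P s t \<longleftrightarrow> feas E W P s t"
    (is "feas ?E _ _ _ _ \<longleftrightarrow> _")
proof -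
  have "conn {e \<in> E. e \<subseteq> W'} A \<longleftrightarrow> conn E A" if "A \<subseteq> W" for A
    using conn_restrict[of A W' E] assms that by auto
  then have "linked ?E W P s t A B \<longleftrightarrow> linked E W P s t A B" for A B
    unfolding linked_def by (cases "A \<subseteq> W \<and> B \<subseteq> W") auto
  then show ?thesis unfolding feas_def by (intro iff_exI)
qed

lemma feas_delete:
  assumes "a \<notin> W"
  shows "feas {e \<in> E. a \<notin> e} W P s t \<longleftrightarrow> feas E W P s t"
    (is "feas ?E _ _ _ _ \<longleftrightarrow> _")
proof -
  have "conn {e \<in> E. a \<notin> e} A \<longleftrightarrow> conn E A" if "A \<subseteq> W" for A
    using conn_delete[of a A E] assms that by auto
  then have "linked ?E W P s t A B \<longleftrightarrow> linked E W P s t A B" for A B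
    unfolding linked_def by (cases "A \<subseteq> W \<and> B \<subseteq> W") auto
  then show ?thesis unfolding feas_def by (intro iff_exI)
qed

text \<open>Once the two ends are taken away, at most one neighbour remains; it is connected by
  itself, and \<open>Y\<close> is free to join the ends.\<close>

lemma rigid_if_card_nb_le_3:
  assumes "conn E Y" "Y \<noteq> {}" "card (nb E Y) \<le> 3" "finite (nb E Y)"
  shows "rigid E Y"
  unfolding rigid_def
proof (intro conjI ballI impI assms(1,2))
  fix s t assume st: "s \<in> nb E Y" "t \<in> nb E Y" "s \<noteq> t"
  have "card (nb E Y - {s, t}) \<le> 1" using st assms(3,4) by (simp add: card_Diff_subset)
  then have "\<exists>x. nb E Y - {s, t} \<subseteq> {x}"
    using assms(4) by (metis card_le_Suc0_iff_eq finite_Diff One_nat_def insertCI subsetI)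
  then have "conn E (nb E Y - {s, t})" by (metis conn_empty conn_singleton subset_singletonD)
  moreover have "conn E (Y \<union> {s, t})" by (rule conn_nb_Un[OF assms(1)]) (use st in auto)
  moreover have "nb E Y \<inter> Y = {}" using nbD[of _ E Y] by auto
  ultimately have "linked E (Y \<union> nb E Y) (nb E Y - {s, t}) s t (nb E Y - {s, t}) (Y \<union> {s, t})"
    unfolding linked_def using st by auto
  then show "feas E (Y \<union> nb E Y) (nb E Y - {s, t}) s t" unfolding feas_def by blast
qed

lemma nb_restrict:
  assumes "Z \<subseteq> Y"
  shows "nb {e \<in> E. e \<subseteq> Y \<union> nb E Y} Z = nb E Z"
proof -
  have "{x, v} \<subseteq> Y \<union> nb E Y" if "x \<in> Z" "{x, v} \<in> E" for x v
    using that assms nbI[of x Y v E] by auto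
  then show ?thesis unfolding nb_def by blast
qed

lemma nb_nb_subset:
  assumes "Z \<subseteq> Y"
  shows "nb E Z \<subseteq> Y \<union> nb E Y"
proof
  fix v assume "v \<in> nb E Z"
  with assms obtain x where "x \<in> Y" "{x, v} \<in> E" using nbD[of v E Z] by auto
  then show "v \<in> Y \<union> nb E Y" using nbI[of x Y v E] by auto
qed

lemma rigid_restrict:
  assumes "Z \<subseteq> Y"
  shows "rigid {e \<in> E. e \<subseteq> Y \<union> nb E Y} Z \<longleftrightarrow> rigid E Z"
proof -
  have ZN: "Z \<union> nb E Z \<subseteq> Y \<union> nb E Y" using assms nb_nb_subset[OF assms] by auto
  then have Z: "Z \<subseteq> Y \<union> nb E Y" by auto
  show ?thesis
    unfolding rigid_def nb_restrict[OF assms] feas_restrict[OF ZN] conn_restrict[OF Z] ..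
qed

lemma er_restrict:
  assumes "graph V E" "W \<subseteq> Y"
  shows "er {e \<in> E. e \<subseteq> Y \<union> nb E Y} W D = er E W D"
proof -
  have "e \<subseteq> Y \<union> nb E Y" if e: "e \<in> E" "e \<inter> W \<noteq> {}" for e
  proof -
    obtain x y where xy: "e = {x, y}" "x \<in> W" using graph_edge_meet[OF assms(1) e] by metis
    then show ?thesis using assms(2) e(1) nbI[of x Y y E] by auto
  qed
  then have "{e \<in> {e \<in> E. e \<subseteq> Y \<union> nb E Y}. e \<inter> W \<noteq> {} \<and> e \<inter> D = {}} = {e \<in> E. e \<inter> W \<noteq> {} \<and> e \<inter> D = {}}"
    by auto
  then show ?thesis unfolding er_def by simp
qed

lemma inst_nb:
  assumes "graph V E" "s \<in> nb E Y" "t \<in> nb E Y" "s \<noteq> t" "Y \<subseteq> V"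
  shows "inst (Y \<union> nb E Y) {e \<in> E. e \<subseteq> Y \<union> nb E Y} (nb E Y - {s, t}) s t"
  unfolding inst_def using assms graph_restrict[OF assms(1)] nb_subset[OF assms(1), of Y] by auto

lemma nonterminals_nb:
  assumes "s \<in> nb E Y" "t \<in> nb E Y"
  shows "Y \<union> nb E Y - (nb E Y - {s, t} \<union> {s, t}) = Y"
  using assms nbD[of _ E Y] by auto

lemma card_nb_minus2:
  assumes "graph V E" "s \<in> nb E Y" "t \<in> nb E Y" "s \<noteq> t"
  shows "card (nb E Y) = card (nb E Y - {s, t}) + 2"
proof -
  have "card {s, t} \<le> card (nb E Y)" using nb_finite[OF assms(1)] assms(2,3) by (intro card_mono) auto
  then show ?thesis using assms by (simp add: card_Diff_subset)
qed

text \<open>The local instance has \<open>card (nb E Y) - 2\<close> roots, so exactly the rigid sets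
  with fewer neighbours than \<open>Y\<close> have to be excluded. Subsets of \<open>Y\<close> have
  the same neighbourhood locally and globally.\<close>

lemma sparse_nb:
  assumes G: "graph V E" and Y: "Y \<subseteq> V" and st: "s \<in> nb E Y" "t \<in> nb E Y" "s \<noteq> t"
    and inf: "\<not> feas E (Y \<union> nb E Y) (nb E Y - {s, t}) s t"
    and IH: "reduced_bound (Y \<union> nb E Y) {e \<in> E. e \<subseteq> Y \<union> nb E Y} (nb E Y - {s, t}) s t"
    and nr: "\<And>Z. Z \<subseteq> Y \<Longrightarrow> card (nb E Z) < card (nb E Y) \<Longrightarrow> \<not> rigid E Z"
  shows "sparse E Y {} (nb E Y - {s, t}) s t"
proof -
  let ?V = "Y \<union> nb E Y" and ?P = "nb E Y - {s, t}"
  let ?E = "{e \<in> E. e \<subseteq> ?V}"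
  have "\<not> feas ?E ?V ?P s t" using inf feas_restrict[of ?V ?V] by auto
  moreover have "\<not> rigid ?E Z" if "Z \<subseteq> Y" "card (nb ?E Z) \<le> card ?P + 1" for Z
    using that nr[of Z] rigid_restrict[of Z Y E] nb_restrict[of Z Y E] card_nb_minus2[OF G st] by auto
  ultimately have sp: "sparse ?E Y {} ?P s t"
    using IH inst_nb[OF G st Y] nonterminals_nb[OF st(1,2)] unfolding reduced_bound_def by simp
  have "{w, b} \<in> ?E \<longleftrightarrow> {w, b} \<in> E" if "w \<in> Y" "b \<in> nb E Y" for w b using that by auto
  then show ?thesis
    using sp st er_restrict[OF G subset_refl, of Y "{}"] unfolding sparse_def by auto
qed

lemma er_delete:
  assumes "graph V E" "a \<notin> W"
  shows "er E W D \<le> er {e \<in> E. a \<notin> e} W D + card (W \<inter> {w. {w, a} \<in> E})"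
proof -
  let ?S = "{e \<in> E. e \<inter> W \<noteq> {} \<and> e \<inter> D = {}}"
  let ?T = "{e \<in> {e \<in> E. a \<notin> e}. e \<inter> W \<noteq> {} \<and> e \<inter> D = {}}"
  let ?N = "W \<inter> {w. {w, a} \<in> E}"
  have fin: "finite ?T" "finite ?N"
    using graph_finite[OF assms(1)] finite_subset[of ?N V] graph_edge[OF assms(1)] by auto
  have "?S \<subseteq> ?T \<union> (\<lambda>w. {w, a}) ` ?N"
  proof
    fix e assume e: "e \<in> ?S"
    then have "e \<in> E" "e \<inter> W \<noteq> {}" by auto
    then obtain x y where xy: "e = {x, y}" "x \<in> W" using graph_edge_meet[OF assms(1)] by metis
    then show "e \<in> ?T \<union> (\<lambda>w. {w, a}) ` ?N" using e assms(2) by (cases "y = a") auto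
  qed
  then have "card ?S \<le> card (?T \<union> (\<lambda>w. {w, a}) ` ?N)" using fin by (intro card_mono) auto
  also have "\<dots> \<le> card ?T + card ((\<lambda>w. {w, a}) ` ?N)" by (rule card_Un_le)
  also have "\<dots> \<le> card ?T + card ?N" using card_image_le[OF fin(2)] by simp
  finally show ?thesis unfolding er_def .
qed

lemma graph_contract:
  assumes "graph V E" "a \<in> V" "u \<noteq> a"
  shows "graph (V - {u}) (contract E u a)"
proof -
  have "e \<subseteq> V - {u} \<and> card e = 2" if e: "e \<in> contract E u a" for e
  proof (cases "e \<in> E \<and> u \<notin> e")
    case True
    then show ?thesis using assms(1) unfolding graph_def by auto
  next
    case False
    then obtain w where "e = {a, w}" "{u, w} \<in> E" "w \<noteq> a" using e unfolding contract_def by auto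
    then show ?thesis using graph_edge[OF assms(1), of u w] assms(2,3) by auto
  qed
  then show ?thesis using graph_finite[OF assms(1)] unfolding graph_def by blast
qed

lemma contract_edge_graph:
  assumes "graph V E" "u \<noteq> a"
  shows "{x, y} \<in> contract E u a \<longleftrightarrow> x \<noteq> u \<and> y \<noteq> u \<and> ({x, y} \<in> E \<or>
    (x = a \<and> y \<noteq> a \<and> {u, y} \<in> E) \<or> (y = a \<and> x \<noteq> a \<and> {u, x} \<in> E))"
proof -
  have uu: "w \<noteq> u" if "{u, w} \<in> E" for w using graph_edge[OF assms(1) that] by auto
  have "{x, y} \<in> {{a, w} |w. {u, w} \<in> E \<and> w \<noteq> a} \<longleftrightarrow>
      (x = a \<and> y \<noteq> a \<and> {u, y} \<in> E) \<or> (y = a \<and> x \<noteq> a \<and> {u, x} \<in> E)"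
    unfolding mem_Collect_eq doubleton_eq_iff by metis
  then show ?thesis using uu assms(2) unfolding contract_def by auto
qed

lemma conn_contract_lift:
  assumes G: "graph V E" and ua: "{u, a} \<in> E" and A: "conn (contract E u a) A" "a \<in> A" "u \<notin> A"
  shows "conn E (insert u A)"
proof (rule connI)
  fix C assume C: "C \<subseteq> insert u A" "C \<noteq> {}" "C \<noteq> insert u A"
  have ne: "u \<noteq> a" using A by auto
  have sep: "\<exists>x\<in>D. \<exists>y\<in>insert u A - D. {x, y} \<in> E" if D: "D \<subseteq> A - {a}" "D \<noteq> {}" for D
  proof -
    have "D \<subseteq> A" "D \<noteq> A" using D A(2) by auto
    then obtain x y where xy: "x \<in> D" "y \<in> A" "y \<notin> D" "{x, y} \<in> contract E u a"
      using connD[OF A(1), of D] D(2) by metis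
    then have "{x, y} \<in> E \<or> {x, u} \<in> E"
      using contract_edge_graph[OF G ne, of x y] D by (auto simp: insert_commute)
    then show ?thesis using xy D A(3) by auto
  qed
  show "\<exists>x\<in>C. \<exists>y\<in>insert u A - C. {x, y} \<in> E"
  proof (cases "u \<in> C \<longleftrightarrow> a \<in> C")
    case False
    show ?thesis
    proof (cases "u \<in> C")
      case True
      then show ?thesis using False ua A(2) by (intro bexI[of _ u] bexI[of _ a]) auto
    next
      case F: False
      then show ?thesis using False ua A(2)
        by (intro bexI[of _ a] bexI[of _ u]) (auto simp: insert_commute)
    qed
  next
    case same: True
    show ?thesis
    proof (cases "u \<in> C")
      case False
      then show ?thesis using sep[of C] same C by auto
    next
      case True
      then obtain x y where "x \<in> insert u A - C" "y \<in> insert u A - (insert u A - C)" "{x, y} \<in> E"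
        using sep[of "insert u A - C"] same C by auto
      then show ?thesis by (intro bexI[of _ y] bexI[of _ x]) (auto simp: insert_commute)
    qed
  qed
qed

text \<open>The merged vertex lies on the root side, where \<open>u\<close> can be put back next to
  \<open>a\<close>. Writing \<open>P - {u}\<close> lets \<open>u\<close> be a root itself, as in the
  nested contraction of \<open>bad_set\<close>.\<close>

lemma feas_contract_lift:
  assumes G: "graph V E" and ua: "{u, a} \<in> E" "u \<in> W" "a \<in> P"
    and F: "feas (contract E u a) (W - {u}) (P - {u}) s t"
  shows "feas E W P s t"
proof -
  have ne: "u \<noteq> a" using graph_edge[OF G ua(1)] by simp
  obtain A B where L: "linked (contract E u a) (W - {u}) (P - {u}) s t A B"
    using F unfolding feas_def by blast
  then have AB: "A \<subseteq> W - {u}" "B \<subseteq> W - {u}" "A \<inter> B = {}" "P - {u} \<subseteq> A" "s \<in> B" "t \<in> B"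
    "conn (contract E u a) A" "conn (contract E u a) B" unfolding linked_def by auto
  have a: "a \<in> A" "a \<notin> B" using AB ua(3) ne by auto
  have "conn E (insert u A)" by (rule conn_contract_lift[OF G ua(1) AB(7) a(1)]) (use AB in auto)
  moreover have "conn E B"
    using AB(8) conn_cong[of B "contract E u a" E] contract_edge_graph[OF G ne] a(2) AB(2) by auto
  ultimately have "linked E W P s t (insert u A) B"
    unfolding linked_def using AB ua(2) by auto
  then show ?thesis unfolding feas_def by blast
qed

text \<open>An edge \<open>{u, w}\<close> becomes \<open>{a, w}\<close>; the count drops only where
  \<open>{a, w}\<close> was already present.\<close>

lemma er_contract:
  assumes G: "graph V E" and ne: "u \<noteq> a" and W: "u \<notin> W" "a \<notin> W" "u \<notin> D" "a \<notin> D" "finite W"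
  shows "er E W D \<le> er (contract E u a) W D + card (W \<inter> {w. {u, w} \<in> E \<and> {a, w} \<in> E})"
proof -
  let ?N = "W \<inter> {w. {u, w} \<in> E \<and> {a, w} \<in> E}"
  let ?M = "{w \<in> W. {u, w} \<in> E \<and> {a, w} \<notin> E \<and> w \<notin> D}"
  let ?S = "{e \<in> E. e \<inter> W \<noteq> {} \<and> e \<inter> D = {}}"
  let ?S1 = "{e \<in> E. u \<notin> e \<and> e \<inter> W \<noteq> {} \<and> e \<inter> D = {}}"
  let ?T = "{e \<in> contract E u a. e \<inter> W \<noteq> {} \<and> e \<inter> D = {}}"
  have finE: "finite E" using graph_finite[OF G] by simp
  have finC: "finite ?T" unfolding contract_def
  proof -
    have "{{a, w} |w. {u, w} \<in> E \<and> w \<noteq> a} \<subseteq> (\<lambda>w. {a, w}) ` V" using graph_edge[OF G] by auto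
    then have "finite {{a, w} |w. {u, w} \<in> E \<and> w \<noteq> a}"
      using graph_finite(1)[OF G] finite_subset by blast
    then show "finite {e \<in> {e \<in> E. u \<notin> e} \<union> {{a, w} |w. {u, w} \<in> E \<and> w \<noteq> a}. e \<inter> W \<noteq> {} \<and> e \<inter> D = {}}"
      using finE by simp
  qed
  have "?S \<subseteq> ?S1 \<union> (\<lambda>w. {u, w}) ` ?M \<union> (\<lambda>w. {u, w}) ` ?N"
  proof
    fix e assume e: "e \<in> ?S"
    show "e \<in> ?S1 \<union> (\<lambda>w. {u, w}) ` ?M \<union> (\<lambda>w. {u, w}) ` ?N"
    proof (cases "u \<in> e")
      case True
      moreover have "e \<in> E" using e by simp
      ultimately obtain w where "e = {u, w}" using graph_edge_at[OF G] by metis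
      then show ?thesis using e W(1) by auto
    qed (use e in auto)
  qed
  then have "card ?S \<le> card (?S1 \<union> (\<lambda>w. {u, w}) ` ?M \<union> (\<lambda>w. {u, w}) ` ?N)"
    using finE W(5) by (intro card_mono) auto
  also have "\<dots> \<le> card (?S1 \<union> (\<lambda>w. {u, w}) ` ?M) + card ((\<lambda>w. {u, w}) ` ?N)" by (rule card_Un_le)
  also have "\<dots> \<le> card ?S1 + card ((\<lambda>w. {u, w}) ` ?M) + card ?N"
    using card_Un_le[of ?S1 "(\<lambda>w. {u, w}) ` ?M"] card_image_le[of ?N "\<lambda>w. {u, w}"] W(5) by simp
  also have "\<dots> \<le> card ?S1 + card ?M + card ?N"
    using card_image_le[of ?M "\<lambda>w. {u, w}"] W(5) by simp
  also have "card ?M = card ((\<lambda>w. {a, w}) ` ?M)"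
    by (rule card_image[symmetric]) (use W(2) in \<open>auto simp: inj_on_def doubleton_eq_iff\<close>)
  also have "card ?S1 + card ((\<lambda>w. {a, w}) ` ?M) = card (?S1 \<union> (\<lambda>w. {a, w}) ` ?M)"
    by (rule card_Un_disjoint[symmetric]) (use finE W(5) in auto)
  also have "\<dots> \<le> card ?T"
    using W(2,4) by (intro card_mono finC) (auto simp: contract_def)
  finally show ?thesis unfolding er_def by simp
qed

lemma card_ge_1: "finite Y \<Longrightarrow> Y \<noteq> {} \<Longrightarrow> 1 \<le> card Y"
  using card_gt_0_iff[of Y] by linarith

subsection \<open>Rerouting through a rigid set\<close>

text \<open>\<open>i\<close> and \<open>l\<close> are the first and last index at which
  \<open>p\<close> meets \<open>nb E K\<close>. As both ends of \<open>p\<close> lie off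
  \<open>K\<close>, every visit to \<open>K\<close> falls between them, and the outer segments are
  clean apart from their contact vertices.\<close>

lemma reroute_ends:
  assumes p: "walk E p" "distinct p" and K: "hd p \<notin> K" "last p \<notin> K" "set p \<inter> K \<noteq> {}"
  obtains i l where "i < l" "l < length p" "p ! i \<in> nb E K" "p ! l \<in> nb E K"
    "set (take (Suc i) p) \<inter> (K \<union> nb E K) = {p ! i}" "set (drop l p) \<inter> (K \<union> nb E K) = {p ! l}"
    "\<And>k. k < length p \<Longrightarrow> p ! k \<in> K \<Longrightarrow> i < k \<and> k < l"
    "\<And>k. k < length p \<Longrightarrow> p ! k \<in> nb E K \<Longrightarrow> i \<le> k \<and> k \<le> l"
proof -
  have pne: "p \<noteq> []" using p(1) unfolding walk_def by simp
  have ends: "p ! 0 \<notin> K" "p ! (length p - 1) \<notin> K"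
    using K pne by (simp_all add: hd_conv_nth last_conv_nth)
  have step: "{p ! i, p ! Suc i} \<in> E" if "Suc i < length p" for i
    using p(1) that unfolding walk_def by blast
  have before: "\<exists>i<k. p ! i \<in> nb E K" if "k < length p" "p ! k \<in> K" for k
    using that
  proof (induction k)
    case 0
    then show ?case using ends by simp
  next
    case (Suc k)
    show ?case
    proof (cases "p ! k \<in> K")
      case True
      then show ?thesis using Suc by (meson Suc_lessD less_SucI)
    next
      case False
      then have "p ! k \<in> nb E K" using nbI[of "p ! Suc k" K "p ! k" E] Suc step[of k]
        by (simp add: insert_commute)
      then show ?thesis by blast
    qed
  qed
  have after: "\<exists>i. k < i \<and> i < length p \<and> p ! i \<in> nb E K" if "k < length p" "p ! k \<in> K" for k
    using that
  proof (induction "length p - k" arbitrary: k rule: less_induct)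
    case less
    have "k \<noteq> length p - 1" using less.prems ends by auto
    then have k: "Suc k < length p" using less.prems by linarith
    show ?case
    proof (cases "p ! Suc k \<in> K")
      case True
      moreover have "length p - Suc k < length p - k" using k by linarith
      ultimately obtain i where "Suc k < i" "i < length p" "p ! i \<in> nb E K"
        using less.hyps[of "Suc k"] k by blast
      then show ?thesis by (intro exI[of _ i]) auto
    next
      case False
      then have "p ! Suc k \<in> nb E K" using nbI[of "p ! k" K "p ! Suc k" E] less.prems step[of k] k by simp
      then show ?thesis using k by blast
    qed
  qed
  let ?I = "{i. i < length p \<and> p ! i \<in> nb E K}"
  obtain k0 where k0: "k0 < length p" "p ! k0 \<in> K" using K(3) by (auto simp: in_set_conv_nth)
  obtain i0 where i0: "i0 < k0" "p ! i0 \<in> nb E K" using before[OF k0] by blast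
  have "i0 \<in> ?I" using i0 k0(1) by simp
  then have fin: "finite ?I" "?I \<noteq> {}" by auto
  define i l where "i = Min ?I" and "l = Max ?I"
  have i: "i \<in> ?I" and l: "l \<in> ?I" unfolding i_def l_def using Min_in[OF fin] Max_in[OF fin] by auto
  have range: "i \<le> k" "k \<le> l" if "k < length p" "p ! k \<in> nb E K" for k
    unfolding i_def l_def using fin that by auto
  have Kin: "i < k \<and> k < l" if k: "k < length p" "p ! k \<in> K" for k
  proof -
    obtain j where "j < k" "p ! j \<in> nb E K" using before[OF k] by blast
    moreover obtain j' where "k < j'" "j' < length p" "p ! j' \<in> nb E K" using after[OF k] by blast
    ultimately show ?thesis using range(1)[of j] range(2)[of j'] k(1) by auto
  qed
  have "i < l" using Kin[OF k0] by simp
  moreover have "set (take (Suc i) p) \<inter> (K \<union> nb E K) = {p ! i}"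
  proof
    show "{p ! i} \<subseteq> set (take (Suc i) p) \<inter> (K \<union> nb E K)"
      using i by (auto simp: in_set_conv_nth)
    show "set (take (Suc i) p) \<inter> (K \<union> nb E K) \<subseteq> {p ! i}"
    proof
      fix x assume x: "x \<in> set (take (Suc i) p) \<inter> (K \<union> nb E K)"
      then obtain k where k: "k < Suc i" "k < length p" "x = p ! k" by (auto simp: in_set_conv_nth)
      then have "k = i" using x Kin[of k] range(1)[of k] by (cases "x \<in> K") auto
      then show "x \<in> {p ! i}" using k by simp
    qed
  qed
  moreover have "set (drop l p) \<inter> (K \<union> nb E K) = {p ! l}"
  proof
    have "p ! l \<in> set (drop l p)" using l by (auto simp: in_set_conv_nth intro!: exI[of _ 0])
    then show "{p ! l} \<subseteq> set (drop l p) \<inter> (K \<union> nb E K)" using l by auto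
    show "set (drop l p) \<inter> (K \<union> nb E K) \<subseteq> {p ! l}"
    proof
      fix x assume x: "x \<in> set (drop l p) \<inter> (K \<union> nb E K)"
      then obtain k where k: "l \<le> k" "k < length p" "x = p ! k"
      proof -
        have "x \<in> set (drop l p)" using x by simp
        then obtain j where "j < length (drop l p)" "x = drop l p ! j"
          unfolding in_set_conv_nth by auto
        then have "l + j < length p" "x = p ! (l + j)" by auto
        then show thesis using that[of "l + j"] by simp
      qed
      then have "k = l" using x Kin[of k] range(2)[of k] by (cases "x \<in> K") auto
      then show "x \<in> {p ! l}" using k by simp
    qed
  qed
  ultimately show thesis using that[of i l] i l Kin range by blast
qed

lemma reroute_path_conn:
  assumes p: "walk E p" and il: "i < l" "l < length p"
    and B: "conn E B" "p ! i \<in> B" "p ! l \<in> B"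
  shows "conn E (set (take (Suc i) p) \<union> B \<union> set (drop l p))"
proof -
  have i: "p ! i \<in> set (take (Suc i) p)" using il by (auto simp: in_set_conv_nth)
  have l: "p ! l \<in> set (drop l p)" using il by (auto simp: in_set_conv_nth intro!: exI[of _ 0])
  have "conn E (set (take (Suc i) p) \<union> B)"
    using conn_Un[OF walk_conn[OF walk_take[OF p, of "Suc i"]] B(1)] i B(2) by auto
  moreover have "(set (take (Suc i) p) \<union> B) \<inter> set (drop l p) \<noteq> {}" using l B(3) by auto
  ultimately show ?thesis using conn_Un[OF _ walk_conn[OF walk_drop[OF p il(2)]]] by blast
qed

text \<open>\<open>A\<close> enters \<open>K\<close> only from vertices of \<open>nb E K\<close>,
  and those of them in \<open>A\<close> lie in \<open>A0\<close>. So every piece of \<open>A\<close>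
  left after removing \<open>K\<close> is attached to \<open>A0\<close>.\<close>

lemma reroute_rest_conn:
  assumes A: "conn E A" and A0: "conn E A0" "A \<inter> nb E K \<subseteq> A0" "A \<inter> nb E K \<noteq> {}"
  shows "conn E (A - K \<union> A0)"
proof (rule connI)
  fix C assume C: "C \<subseteq> A - K \<union> A0" "C \<noteq> {}" "C \<noteq> A - K \<union> A0"
  have sep: "\<exists>x\<in>D. \<exists>y\<in>A - K \<union> A0 - D. {x, y} \<in> E" if D: "D \<subseteq> A - K" "D \<inter> A0 = {}" "D \<noteq> {}" for D
  proof -
    have "D \<subseteq> A" "D \<noteq> A" using D A0(2,3) by auto
    then obtain x y where xy: "x \<in> D" "y \<in> A" "y \<notin> D" "{x, y} \<in> E"
      using connD[OF A, of D] D(3) by metis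
    have "y \<notin> K"
    proof
      assume "y \<in> K"
      then have "x \<in> nb E K" using xy D(1) nbI[of y K x E] by (auto simp: insert_commute)
      then show False using xy(1) D A0(2) by auto
    qed
    then show ?thesis using xy by auto
  qed
  show "\<exists>x\<in>C. \<exists>y\<in>A - K \<union> A0 - C. {x, y} \<in> E"
  proof (cases "A0 \<inter> C = {}")
    case True
    then show ?thesis using sep[of C] C by auto
  next
    case ne: False
    show ?thesis
    proof (cases "A0 \<subseteq> C")
      case True
      let ?D = "A - K \<union> A0 - C"
      have "?D \<subseteq> A - K" "?D \<inter> A0 = {}" "?D \<noteq> {}" using True C by auto
      then obtain x y where "x \<in> ?D" "y \<in> A - K \<union> A0 - ?D" "{x, y} \<in> E" using sep[of ?D] by auto
      then show ?thesis by (intro bexI[of _ y] bexI[of _ x]) (auto simp: insert_commute)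
    next
      case False
      then have "A0 \<inter> C \<noteq> A0" by auto
      then obtain x y where "x \<in> A0 \<inter> C" "y \<in> A0" "y \<notin> A0 \<inter> C" "{x, y} \<in> E"
        using connD[OF A0(1) Int_lower1 ne] by metis
      then show ?thesis by auto
    qed
  qed
qed

text \<open>The root side gains every neighbour of \<open>K\<close> except the two contacts, not
  only those it had before. This is how a root outside \<open>A\<close> can be brought in.\<close>

lemma reroute_linked:
  assumes A: "conn E A" "A \<inter> set p = {}" "A \<inter> nb E K \<noteq> {}"
    and p: "walk E p" and il: "i < l" "l < length p"
    and it: "set (take (Suc i) p) \<inter> (K \<union> nb E K) = {p ! i}" "set (drop l p) \<inter> (K \<union> nb E K) = {p ! l}"
    and L: "linked E (K \<union> nb E K) (nb E K - {p ! i, p ! l}) (p ! i) (p ! l) A0 B0"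
    and W: "A \<union> set p \<union> K \<union> nb E K \<subseteq> W"
  shows "linked E W (A - K \<union> (nb E K - {p ! i, p ! l})) (hd p) (last p)
    (A - K \<union> A0) (set (take (Suc i) p) \<union> B0 \<union> set (drop l p))"
proof -
  have L': "A0 \<subseteq> K \<union> nb E K" "B0 \<subseteq> K \<union> nb E K" "A0 \<inter> B0 = {}" "nb E K - {p ! i, p ! l} \<subseteq> A0"
    "p ! i \<in> B0" "p ! l \<in> B0" "conn E A0" "conn E B0"
    using L unfolding linked_def by auto
  have pil: "p ! i \<in> set p" "p ! l \<in> set p" using il by auto
  have "conn E (A - K \<union> A0)"
    by (rule reroute_rest_conn[OF A(1) L'(7) _ A(3)]) (use L'(4) pil A(2) in auto)
  moreover have "conn E (set (take (Suc i) p) \<union> B0 \<union> set (drop l p))"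
    by (rule reroute_path_conn[OF p il L'(8,5,6)])
  moreover have "hd p \<in> set (take (Suc i) p)" using il by (cases p) auto
  moreover have "last p \<in> set (drop l p)" using il by (metis drop_eq_Nil2 last_drop last_in_set not_le)
  moreover have "(A - K \<union> A0) \<inter> (set (take (Suc i) p) \<union> B0 \<union> set (drop l p)) = {}"
  proof -
    have "set (take (Suc i) p) \<union> set (drop l p) \<subseteq> set p" by (auto dest: in_set_takeD in_set_dropD)
    moreover have "A0 \<inter> set (take (Suc i) p) = {}"
    proof -
      have "A0 \<inter> set (take (Suc i) p) \<subseteq> {p ! i}" using it(1) L'(1) by blast
      then show ?thesis using L'(3,5) by auto
    qed
    moreover have "A0 \<inter> set (drop l p) = {}"
    proof -
      have "A0 \<inter> set (drop l p) \<subseteq> {p ! l}" using it(2) L'(1) by blast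
      then show ?thesis using L'(3,6) by auto
    qed
    moreover have "(A - K) \<inter> B0 = {}" using L'(2,3,4) pil A(2) by auto
    ultimately show ?thesis using A(2) L'(3) by auto
  qed
  moreover have "set (take (Suc i) p) \<union> set (drop l p) \<subseteq> W" using W by (auto dest: in_set_takeD in_set_dropD)
  ultimately show ?thesis unfolding linked_def using W L' by auto
qed

lemma induced_pathD:
  assumes "induced_path E s t p"
  shows "walk E p" "distinct p" "hd p = s" "last p = t" "p \<noteq> []" "p ! 0 = s" "p ! (length p - 1) = t"
    "\<And>i j. i < j \<Longrightarrow> j < length p \<Longrightarrow> {p ! i, p ! j} \<in> E \<Longrightarrow> j = Suc i"
  using assms unfolding induced_path_def walk_def by (auto simp: hd_conv_nth last_conv_nth)

lemma card_nth_image_le_2: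
  assumes "X \<subseteq> set p"
    and "\<And>i j l. i < j \<Longrightarrow> j < l \<Longrightarrow> l < length p \<Longrightarrow> p ! i \<in> X \<Longrightarrow> p ! j \<in> X \<Longrightarrow> p ! l \<in> X \<Longrightarrow> False"
  shows "card X \<le> 2"
proof -
  let ?I = "{i. i < length p \<and> p ! i \<in> X}"
  have "card ?I \<le> 2" by (rule card_le_2_if_no_triple) (use assms(2) in auto)
  moreover have "X \<subseteq> (!) p ` ?I"
  proof
    fix x assume x: "x \<in> X"
    then have "x \<in> set p" using assms(1) by auto
    then obtain i where "i < length p" "x = p ! i" by (auto simp: in_set_conv_nth)
    then show "x \<in> (!) p ` ?I" using x by auto
  qed
  then have "card X \<le> card ?I" using surj_card_le[of ?I X "(!) p"] by simp
  ultimately show ?thesis by linarith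
qed

subsection \<open>Infeasible instances without small rigid sets\<close>

text \<open>The setting of the induction step. \<open>IH\<close> ranges over all terminals, because
  it is applied to instances whose terminals form the neighbourhood of a set, and to instances with
  a root deleted.\<close>

locale reduced_instance =
  fixes V :: "'a set" and E :: "'a set set" and R :: "'a set" and b1 b2 :: 'a
  assumes inst: "inst V E R b1 b2"
    and infeasible: "\<not> feas E V R b1 b2"
    and no_rigid: "\<And>Y. Y \<subseteq> V - (R \<union> {b1, b2}) \<Longrightarrow> card (nb E Y) \<le> card R + 1 \<Longrightarrow> \<not> rigid E Y"
    and IH: "\<And>V' E' R' s t. card V' < card V \<Longrightarrow> reduced_bound V' E' (R' :: 'a set) s t"
begin

abbreviation "S \<equiv> R \<union> {b1, b2}"

lemma G: "graph V E" and RV: "R \<subseteq> V" "b1 \<in> V" "b2 \<in> V" "b1 \<noteq> b2" "b1 \<notin> R" "b2 \<notin> R"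
  using inst unfolding inst_def by auto

lemma fin: "finite V" "finite E" "finite R" "\<And>e. e \<in> E \<Longrightarrow> card e = 2"
  using graph_finite[OF G] G RV(1) finite_subset unfolding graph_def by auto

lemma swap: "reduced_instance V E R b2 b1"
  using inst infeasible no_rigid IH feas_commute[of E V R b1 b2]
  unfolding reduced_instance_def inst_def by (auto simp: insert_commute)

lemma card_S: "card S = card R + 2"
  using RV fin(3) by simp

lemma not_linked: "A \<inter> B = {} \<Longrightarrow> A \<subseteq> V \<Longrightarrow> B \<subseteq> V \<Longrightarrow> R \<subseteq> A \<Longrightarrow> b1 \<in> B \<Longrightarrow> b2 \<in> B \<Longrightarrow>
    conn E A \<Longrightarrow> conn E B \<Longrightarrow> False"
  using infeasible unfolding feas_def linked_def by blast

text \<open>Such a set is not rigid, so its local instance is infeasible for some pair of ends. This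
  instance is smaller than \<open>V\<close>, since the neighbourhood cannot contain all
  \<open>card R + 2\<close> terminals, and it has \<open>card (nb E Y) - 2\<close> roots.\<close>

lemma small_sets:
  assumes Y: "Y \<subseteq> V - S" "conn E Y" "Y \<noteq> {}" "card (nb E Y) \<le> card R + 1"
  shows "2 \<le> card (nb E Y)" "er E Y {} \<le> (card (nb E Y) - 1) * card Y + 1"
proof -
  have "\<not> rigid E Y" using no_rigid Y by auto
  then obtain s t where st: "s \<in> nb E Y" "t \<in> nb E Y" "s \<noteq> t"
    and inf: "\<not> feas E (Y \<union> nb E Y) (nb E Y - {s, t}) s t"
    using Y(2,3) unfolding rigid_def by blast
  note c = card_nb_minus2[OF G st]
  then show "2 \<le> card (nb E Y)" by simp
  have "\<not> S \<subseteq> nb E Y" using card_mono[OF nb_finite[OF G], of S Y] card_S Y(4) by auto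
  then have "Y \<union> nb E Y \<noteq> V" using Y(1) RV by auto
  then have "Y \<union> nb E Y \<subset> V" using Y(1) nb_subset[OF G, of Y] by auto
  then have lt: "card (Y \<union> nb E Y) < card V" by (rule psubset_card_mono[OF fin(1)])
  have "sparse E Y {} (nb E Y - {s, t}) s t"
    by (rule sparse_nb[OF G _ st inf IH[OF lt]]) (use Y no_rigid in auto)
  then show "er E Y {} \<le> (card (nb E Y) - 1) * card Y + 1"
    using c unfolding sparse_def by simp
qed

lemma small_sets_le_Suc:
  assumes Y: "Y \<subseteq> V - S" "conn E Y" "Y \<noteq> {}" "card (nb E Y) \<le> card R + 1"
  shows "er E Y {} \<le> card R * card Y + 1"
proof -
  have "(card (nb E Y) - 1) * card Y \<le> card R * card Y" using Y(4) by (intro mult_le_mono1) simp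
  then show ?thesis using small_sets(2)[OF Y] by linarith
qed

lemma small_sets_le:
  assumes Y: "Y \<subseteq> V - S" "conn E Y" "Y \<noteq> {}" "card (nb E Y) \<le> card R + 1"
  shows "er E Y {} \<le> (card R + 1) * card Y"
proof -
  have "er E Y {} \<le> card R * card Y + 1" by (rule small_sets_le_Suc[OF Y])
  moreover have "card Y \<ge> 1" using card_ge_1[of Y] Y(1,3) fin(1) finite_subset[of Y V] by auto
  ultimately show ?thesis by simp
qed

lemma all_small:
  assumes "W \<subseteq> V - S" "\<And>K. K \<in> comps E W \<Longrightarrow> card (nb E K) \<le> card R + 1"
  shows "er E W {} \<le> (card R + 1) * card W"
proof -
  have "er E W {} \<le> (card R + 1) * card W + card (W \<inter> {})"
  proof (rule comps_er_le[OF _ fin(2,4)])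
    show "finite W" using assms(1) fin(1) finite_subset by auto
    fix K assume K: "K \<in> comps E W"
    show "er E K {} \<le> (card R + 1) * card K + card (K \<inter> {})"
      using small_sets_le[of K] compsD(1-3)[OF K] assms(1) assms(2)[OF K] by auto
  qed
  then show ?thesis by simp
qed

text \<open>Induction with one root less yields the coefficient \<open>card R\<close>; the edges at
  \<open>a\<close> are added back by their number.\<close>

lemma delete_root:
  assumes a: "a \<in> R" and inf: "\<not> feas E (V - {a}) (R - {a}) b1 b2"
  shows "er E (V - S) {} \<le> card R * card (V - S) + 1 + card ((V - S) \<inter> {w. {w, a} \<in> E})"
proof -
  let ?E = "{e \<in> E. a \<notin> e}" and ?V = "V - {a}" and ?R = "R - {a}" and ?N = "{w. {w, a} \<in> E}"
  have cR: "card R = card ?R + 1" using card_Suc_Diff1[OF fin(3) a] by simp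
  have lt: "card ?V < card V" using a RV(1) fin(1) by (intro psubset_card_mono) auto
  have "inst ?V ?E ?R b1 b2" using graph_delete[OF G] RV a unfolding inst_def by auto
  moreover have "\<not> feas ?E ?V ?R b1 b2" using inf feas_delete[of a ?V E] by simp
  moreover have "reduced_bound V' E' ?R b1 b2" if "card V' \<le> card ?V" for V' E'
    using IH that lt by auto
  ultimately obtain D where D: "D \<subseteq> ?V - (?R \<union> {b1, b2})"
    "\<forall>K\<in>comps ?E D. card (nb ?E K) \<le> card ?R + 1"
    "sparse ?E (?V - (?R \<union> {b1, b2}) - D) D ?R b1 b2"
    using infeasible_decomposition[of ?V ?R b1 b2 ?E] by blast
  let ?W = "V - S - D"
  have W: "?V - (?R \<union> {b1, b2}) - D = ?W" "D \<subseteq> V - S" using a D(1) by auto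
  have aD: "a \<notin> D" using D(1) by auto
  have finD: "finite D" using W(2) fin(1) finite_subset by auto
  have "er E D {} \<le> card R * card D + card (D \<inter> ?N)"
  proof (rule comps_er_le[OF finD fin(2,4)])
    fix K assume K: "K \<in> comps E D"
    note c = compsD[OF K]
    have aK: "a \<notin> K" using c(1) aD by auto
    have "conn ?E K" using c(3) conn_delete[OF aK] by auto
    then have "K \<in> comps ?E D" using K unfolding comps_def by auto
    then have le: "card (nb ?E K) \<le> card R" using D(2) cR by auto
    have sub: "nb E K - {a} \<subseteq> nb ?E K" using aK unfolding nb_def by auto
    have fnb: "finite (nb ?E K)" using nb_finite[OF graph_delete[OF G]] by auto
    have c1: "card (nb E K - {a}) \<le> card R" using card_mono[OF fnb sub] le by linarith
    show "er E K {} \<le> card R * card K + card (K \<inter> ?N)"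
    \<comment> \<open>A component that sees \<open>a\<close> may have \<open>card R + 1\<close>
      neighbours, and its surplus 1 is charged to a neighbour of \<open>a\<close> in it. One that
      misses \<open>a\<close> has at most \<open>card R\<close> neighbours, so the surplus fits into
      the coefficient.\<close>
    proof (cases "K \<inter> ?N = {}")
      case False
      then have N1: "card (K \<inter> ?N) \<ge> 1"
        using card_ge_1[of "K \<inter> ?N"] c(1) finD finite_subset[of K D] by auto
      have "card (nb E K) \<le> card R + 1" using c1 nb_finite[OF G, of K]
        by (cases "a \<in> nb E K") (simp_all add: card_Diff_singleton)
      then have "er E K {} \<le> card R * card K + 1"
        using small_sets_le_Suc[of K] c W(2) by auto
      then show ?thesis using N1 by linarith
    next
      case True
      then have "a \<notin> nb E K" using nbD[of a E K] by auto
      then have c2: "card (nb E K) \<le> card R" using c1 by simp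
      then have s: "er E K {} \<le> (card (nb E K) - 1) * card K + 1" "2 \<le> card (nb E K)"
        using small_sets[of K] c W(2) by auto
      have "card K \<ge> 1" using card_ge_1[of K] c(1,2) finD finite_subset[of K D] by auto
      then have "(card (nb E K) - 1) * card K + 1 \<le> (card (nb E K) - 1 + 1) * card K" by simp
      also have "\<dots> \<le> card R * card K" using c2 s(2) by (intro mult_le_mono1) simp
      finally show ?thesis using s(1) by linarith
    qed
  qed
  moreover have "er E ?W D \<le> card R * card ?W + 1 + card (?W \<inter> ?N)"
  proof -
    have "er E ?W D \<le> er ?E ?W D + card (?W \<inter> ?N)" by (rule er_delete[OF G]) (use a in auto)
    moreover have "er ?E ?W D \<le> card R * card ?W + 1" using D(3) cR W(1) unfolding sparse_def by simp
    ultimately show ?thesis by linarith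
  qed
  moreover have "er E (V - S) {} = er E D {} + er E ?W D" by (rule er_split[OF fin(2) W(2)])
  moreover have "card (V - S) = card D + card ?W"
    using W(2) fin(1) finD by (simp add: card_Diff_subset card_mono)
  moreover have "card ((V - S) \<inter> ?N) = card (D \<inter> ?N) + card (?W \<inter> ?N)"
  proof -
    have "(V - S) \<inter> ?N = D \<inter> ?N \<union> ?W \<inter> ?N" using W(2) by auto
    moreover have "finite (D \<inter> ?N)" "finite (?W \<inter> ?N)" "(D \<inter> ?N) \<inter> (?W \<inter> ?N) = {}"
      using finD fin(1) by auto
    ultimately show ?thesis using card_Un_disjoint by metis
  qed
  ultimately show ?thesis by (simp add: add_mult_distrib2)
qed

end

section \<open>Contracting an edge at a root\<close>

context reduced_instance
begin

text \<open>After the contraction of \<open>u\<close> into \<open>a\<close>, a component with at most \<open>card R + 1\<close> neighbours can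
  have one more neighbour in \<open>E\<close>, but only if it sees both \<open>u\<close> and \<open>a\<close>.\<close>

lemma bad_set:
  assumes K: "K \<subseteq> V - S" "conn E K" "K \<noteq> {}" "u \<notin> K" and nbK: "a \<in> nb E K" "u \<in> nb E K"
    and ua: "{u, a} \<in> E" and c: "card (nb E K) = card R + 2" and nr: "\<not> rigid E K"
    and lt: "card (K \<union> nb E K) < card V"
  shows "er E K {} \<le> (card R + 1) * card K + card (K \<inter> {w. {u, w} \<in> E \<and> {a, w} \<in> E})"
proof -
  let ?C = "{w. {u, w} \<in> E \<and> {a, w} \<in> E}"
  have ne: "u \<noteq> a" using graph_edge[OF G ua] by simp
  obtain s t where st: "s \<in> nb E K" "t \<in> nb E K" "s \<noteq> t"
    and inf: "\<not> feas E (K \<union> nb E K) (nb E K - {s, t}) s t"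
    using nr K(2,3) unfolding rigid_def by blast
  let ?P = "nb E K - {s, t}" and ?V = "K \<union> nb E K"
  have KV: "K \<subseteq> V" using K(1) by auto
  have finK: "finite K" using KV fin(1) finite_subset by auto
  have cP: "card ?P = card R" using card_nb_minus2[OF G st] c by simp
  have nbK': "nb E K \<inter> K = {}" using nbD[of _ E K] by auto
  have sp: "sparse E K {} ?P s t"
    by (rule sparse_nb[OF G KV st inf IH[OF lt]]) (use K(1) no_rigid c in auto)
  consider "a \<in> {s, t}" "u \<in> {s, t}" | "a \<in> ?P" "u \<in> ?P" | "a \<in> ?P" "u \<in> {s, t}" | "u \<in> ?P" "a \<in> {s, t}"
    using nbK by auto
  then show ?thesis
  proof cases
    case 1
    \<comment> \<open>The contracted edge itself joins the ends, and \<open>K\<close> holds the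
      remaining neighbours together.\<close>
    then have "{s, t} = {u, a}" using ne by auto
    then have "conn E {s, t}" using conn_insert[of E "{a}" a u] ua by simp
    moreover have "conn E (K \<union> ?P)" by (rule conn_nb_Un[OF K(2)]) auto
    ultimately have "linked E ?V ?P s t (K \<union> ?P) {s, t}"
      unfolding linked_def using st nbK' by auto
    then show ?thesis using inf unfolding feas_def by blast
  next
    case 2
    \<comment> \<open>Both ends of the edge are roots here. Contracting it once more leaves one root
      less, so the coefficient on \<open>?W\<close> drops to \<open>card R\<close> and any vertex of
      \<open>?W\<close> covers the surplus.\<close>
    let ?E = "{e \<in> E. e \<subseteq> ?V}"
    let ?H = "contract ?E u a"
    have G': "graph ?V ?E" using graph_restrict[OF G] KV nb_subset[OF G] by (simp add: Un_least)
    have ua': "{u, a} \<in> ?E" using ua nbK by auto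
    have "inst (?V - {u}) ?H (?P - {u}) s t"
      unfolding inst_def using graph_contract[OF G' _ ne] nbK st 2 by auto
    moreover have "\<not> feas ?H (?V - {u}) (?P - {u}) s t"
      using feas_contract_lift[OF G' ua', of ?V ?P s t] inf feas_restrict[of ?V ?V E] 2 nbK by auto
    moreover have "reduced_bound V' E' (?P - {u}) s t" if "card V' \<le> card (?V - {u})" for V' E'
    proof -
      have "card (?V - {u}) \<le> card ?V" using finK nb_finite[OF G] by (intro card_mono) auto
      then show ?thesis using IH that lt by auto
    qed
    ultimately obtain D where D: "D \<subseteq> ?V - {u} - (?P - {u} \<union> {s, t})"
      "\<forall>L\<in>comps ?H D. card (nb ?H L) \<le> card (?P - {u}) + 1"
      "sparse ?H (?V - {u} - (?P - {u} \<union> {s, t}) - D) D (?P - {u}) s t"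
      using infeasible_decomposition[of "?V - {u}" "?P - {u}" s t ?H] by blast
    have cP': "card (?P - {u}) + 1 = card R"
      using cP card_Suc_Diff1[of ?P u] 2 nb_finite[OF G] by simp
    let ?W = "K - D"
    have W: "?V - {u} - (?P - {u} \<union> {s, t}) - D = ?W" using K(4) nbK' st by auto
    have DK: "D \<subseteq> K" using D(1) by auto
    have aD: "a \<notin> D" "u \<notin> D" "a \<notin> K" using DK K(4) nbK nbK' by auto
    have eqH: "{x, y} \<in> ?H \<longleftrightarrow> {x, y} \<in> E" if xy: "x \<in> D" "y \<in> D" for x y
    proof -
      have n: "x \<noteq> a" "y \<noteq> a" "x \<noteq> u" "y \<noteq> u" using xy aD by metis+
      have "{x, y} \<in> ?E \<longleftrightarrow> {x, y} \<in> E" using xy DK by auto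
      then show ?thesis using contract_edge_graph[OF G' ne, of x y] n by simp
    qed
    have "er E D {} \<le> (card R + 1) * card D"
    proof (rule all_small)
      fix L assume L: "L \<in> comps E D"
      note cL = compsD[OF L]
      have "conn ?H L" using cL(3) conn_cong[of L E ?H] eqH cL(1) by blast
      moreover have "\<forall>x\<in>L. \<forall>y\<in>D - L. {x, y} \<notin> ?H" using eqH cL(1,4) by blast
      ultimately have "L \<in> comps ?H D" using cL(1,2) unfolding comps_def by auto
      then have le: "card (nb ?H L) \<le> card R" using D(2) cP' by auto
      have "nb E L \<subseteq> insert u (nb ?H L)"
      proof
        fix v assume "v \<in> nb E L"
        then obtain x where x: "x \<in> L" "{x, v} \<in> E" "v \<notin> L" using nbD[of v E L] by auto
        have "x \<in> K" using x(1) cL(1) DK by auto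
        then have "{x, v} \<in> ?E" using x(2) nbI[of x K v E] by auto
        then have "v \<noteq> u \<Longrightarrow> {x, v} \<in> ?H"
          using contract_edge_graph[OF G' ne, of x v] x(1) cL(1) aD(2) by auto
        then show "v \<in> insert u (nb ?H L)" using nbI[OF x(1) _ x(3)] by auto
      qed
      then have "card (nb E L) \<le> card (insert u (nb ?H L))"
        using nb_finite[OF graph_contract[OF G' _ ne]] nbK(1) by (intro card_mono) auto
      also have "\<dots> \<le> card R + 1" using le by (simp add: card_insert_le_m1 le_SucI card_insert_if)
      finally show "card (nb E L) \<le> card R + 1" .
    qed (use DK K(1) in auto)
    moreover have "er E ?W D \<le> (card R + 1) * card ?W + card (K \<inter> ?C)"
    proof (cases "?W = {}")
      case False
      have "er E ?W D = er ?E ?W D" using er_restrict[OF G, of ?W K D] by auto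
      also have "\<dots> \<le> er ?H ?W D + card (?W \<inter> {w. {u, w} \<in> ?E \<and> {a, w} \<in> ?E})"
        by (rule er_contract[OF G' ne]) (use K(4) aD finK in auto)
      also have "er ?H ?W D \<le> card R * card ?W + 1"
        using D(3) unfolding sparse_def W cP' by blast
      also have "card (?W \<inter> {w. {u, w} \<in> ?E \<and> {a, w} \<in> ?E}) \<le> card (K \<inter> ?C)"
        using finK by (intro card_mono) auto
      finally have "er E ?W D \<le> card R * card ?W + 1 + card (K \<inter> ?C)" by simp
      moreover have "1 \<le> card ?W" using card_ge_1[OF _ False] finK by blast
      ultimately show ?thesis by simp
    next
      case True
      then show ?thesis by (simp only: True er_empty)
    qed
    moreover have "er E K {} = er E D {} + er E ?W D" by (rule er_split[OF fin(2) DK])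
    moreover have "card K = card D + card ?W"
      using DK finK finite_subset[OF DK] by (simp add: card_Diff_subset card_mono)
    ultimately show ?thesis by (simp add: add_mult_distrib2)
  next
    case 3
    \<comment> \<open>A root faces an end: without a common neighbour in \<open>K\<close> the second
      clause of \<open>sparse\<close> removes the surplus; otherwise such a neighbour pays for
      it.\<close>
    have "er E K {} \<le> (card R + 1) * card K" if KC: "K \<inter> ?C = {}"
    proof -
      have "\<forall>w\<in>K. {w, a} \<in> E \<longrightarrow> {w, u} \<notin> E" using KC by (auto simp: insert_commute)
      then show ?thesis using sp 3 unfolding sparse_def cP by blast
    qed
    moreover have "K \<inter> ?C \<noteq> {} \<Longrightarrow> 1 \<le> card (K \<inter> ?C)" by (rule card_ge_1) (use finK in auto)
    moreover have "er E K {} \<le> (card R + 1) * card K + 1" using sp cP unfolding sparse_def by auto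
    ultimately show ?thesis by linarith
  next
    case 4
    have "er E K {} \<le> (card R + 1) * card K" if KC: "K \<inter> ?C = {}"
    proof -
      have "\<forall>w\<in>K. {w, u} \<in> E \<longrightarrow> {w, a} \<notin> E" using KC by (auto simp: insert_commute)
      then show ?thesis using sp 4 unfolding sparse_def cP by blast
    qed
    moreover have "K \<inter> ?C \<noteq> {} \<Longrightarrow> 1 \<le> card (K \<inter> ?C)" by (rule card_ge_1) (use finK in auto)
    moreover have "er E K {} \<le> (card R + 1) * card K + 1" using sp cP unfolding sparse_def by auto
    ultimately show ?thesis by linarith
  qed
qed

text \<open>Contracting \<open>u\<close> into \<open>a\<close> destroys at most the edges from \<open>u\<close> to \<open>S\<close> and one edge for each
  common neighbour of \<open>u\<close> and \<open>a\<close>.\<close>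

abbreviation "loss u a \<equiv> card (S \<inter> {w. {u, w} \<in> E}) + card ((V - S) \<inter> {w. {u, w} \<in> E \<and> {a, w} \<in> E})"

text \<open>Since \<open>u\<close> ceases to be a nonterminal, the target drops by
  \<open>card R + 1\<close>, to be weighed against \<open>loss u a\<close>. The hypothesis on rigid
  sets goes beyond \<open>no_rigid\<close>: a component of the removed part that sees both
  \<open>u\<close> and \<open>a\<close> can have \<open>card R + 2\<close> neighbours.\<close>

lemma contract_bound:
  assumes a: "a \<in> R" and u: "u \<in> V - S" and ua: "{u, a} \<in> E"
    and nr: "\<And>K. K \<subseteq> V - S \<Longrightarrow> u \<notin> K \<Longrightarrow> conn E K \<Longrightarrow> K \<noteq> {} \<Longrightarrow> a \<in> nb E K \<Longrightarrow> u \<in> nb E K \<Longrightarrow>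
      \<not> rigid E K"
  obtains \<epsilon> :: nat where "\<epsilon> \<le> 1"
    "er E (V - S) {} + (card R + 1) \<le> (card R + 1) * card (V - S) + \<epsilon> + loss u a"
    "\<And>b. b \<in> {b1, b2} \<Longrightarrow> \<forall>w\<in>V - S. {w, a} \<in> E \<longrightarrow> {w, b} \<notin> E \<Longrightarrow>
       \<forall>w\<in>V - S. {u, w} \<in> E \<longrightarrow> {w, b} \<notin> E \<Longrightarrow> \<epsilon> = 0"
proof -
  let ?C = "{w. {u, w} \<in> E \<and> {a, w} \<in> E}" and ?H = "contract E u a" and ?V = "V - {u}"
  have ne: "u \<noteq> a" using u a by auto
  have aV: "a \<in> V" using a RV by auto
  have lt: "card ?V < card V" using u fin(1) by (intro psubset_card_mono) auto
  have GH: "graph ?V ?H" by (rule graph_contract[OF G aV ne])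
  have "inst ?V ?H R b1 b2" unfolding inst_def using GH RV u by auto
  moreover have "\<not> feas ?H ?V R b1 b2"
    using feas_contract_lift[OF G ua, of V R b1 b2] infeasible u a by auto
  moreover have "reduced_bound V' E' R b1 b2" if "card V' \<le> card ?V" for V' E'
    using IH that lt by auto
  ultimately obtain D where D: "D \<subseteq> ?V - S"
    "\<forall>K\<in>comps ?H D. card (nb ?H K) \<le> card R + 1" "sparse ?H (?V - S - D) D R b1 b2"
    using infeasible_decomposition[of ?V R b1 b2 ?H] by blast
  let ?W = "?V - S - D"
  have DV: "D \<subseteq> V - S" "u \<notin> D" "a \<notin> D" using D(1) a by auto
  have finD: "finite D" using DV fin(1) finite_subset by auto
  have eqH: "{x, y} \<in> ?H \<longleftrightarrow> {x, y} \<in> E" if "x \<in> D" "y \<in> D" for x y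
    using contract_edge_graph[OF G ne, of x y] that DV by auto
  have e1: "er E D {} \<le> (card R + 1) * card D + card (D \<inter> ?C)"
  proof (rule comps_er_le[OF finD fin(2,4)])
    fix K assume K: "K \<in> comps E D"
    note c = compsD[OF K]
    have "conn ?H K" using c(3) conn_cong[of K E ?H] eqH c(1) by blast
    moreover have "\<forall>x\<in>K. \<forall>y\<in>D - K. {x, y} \<notin> ?H" using eqH c(1,4) by blast
    ultimately have "K \<in> comps ?H D" using c(1,2) unfolding comps_def by auto
    then have le: "card (nb ?H K) \<le> card R + 1" using D(2) by auto
    have KV: "K \<subseteq> V - S" "u \<notin> K" "a \<notin> K" using c(1) DV by auto
    have edgeH: "{x, v} \<in> ?H" if "x \<in> K" "{x, v} \<in> E" "v \<noteq> u" for x v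
      using contract_edge_graph[OF G ne, of x v] that KV(2) by auto
    have sub: "nb E K - {u} \<subseteq> nb ?H K"
      using edgeH nbD[of _ E K] nbI[of _ K _ ?H] by blast
    have aH: "a \<in> nb ?H K" if uK: "u \<in> nb E K"
    proof -
      obtain x where x: "x \<in> K" "{x, u} \<in> E" using nbD[OF uK] by auto
      then have "{x, a} \<in> ?H"
        using contract_edge_graph[OF G ne, of x a] KV ne by (auto simp: insert_commute)
      then show ?thesis using nbI[OF x(1)] KV(3) by auto
    qed
    have fH: "finite (nb ?H K)" by (rule nb_finite[OF GH])
    show "er E K {} \<le> (card R + 1) * card K + card (K \<inter> ?C)"
    proof (cases "card (nb E K) \<le> card R + 1")
      case True
      then show ?thesis using small_sets_le[OF KV(1) c(3,2)] by linarith
    next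
      case False
      have uK: "u \<in> nb E K"
      proof (rule ccontr)
        assume "u \<notin> nb E K"
        then have "nb E K \<subseteq> nb ?H K" using sub by auto
        then have "card (nb E K) \<le> card (nb ?H K)" by (rule card_mono[OF fH])
        then show False using le False by linarith
      qed
      have aK: "a \<in> nb E K"
      proof (rule ccontr)
        assume "a \<notin> nb E K"
        then have "nb E K - {u} \<subseteq> nb ?H K - {a}" using sub by auto
        then have "card (nb E K - {u}) \<le> card (nb ?H K - {a})" using fH by (intro card_mono) auto
        moreover have "card (nb E K) = Suc (card (nb E K - {u}))"
          using card_Suc_Diff1[OF nb_finite[OF G] uK] by simp
        moreover have "card (nb ?H K) = Suc (card (nb ?H K - {a}))"
          using card_Suc_Diff1[OF fH aH[OF uK]] by simp
        ultimately have "card (nb E K) \<le> card (nb ?H K)" by linarith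
        then show False using le False by linarith
      qed
      have "card (nb E K - {u}) \<le> card R + 1" using card_mono[OF fH sub] le by linarith
      then have cK: "card (nb E K) = card R + 2"
        using False card_Suc_Diff1[OF nb_finite[OF G] uK] by linarith
      \<comment> \<open>\<open>u\<close> and all terminals together would be
        \<open>card R + 3\<close> neighbours. So a terminal is missed, and the local instance is
        smaller than \<open>V\<close>.\<close>
      have "\<not> S \<subseteq> nb E K"
      proof
        assume "S \<subseteq> nb E K"
        then have "insert u S \<subseteq> nb E K" using uK by auto
        then have "card (insert u S) \<le> card (nb E K)" using nb_finite[OF G] by (intro card_mono)
        then show False using cK card_S u fin(3) by simp
      qed
      then have "K \<union> nb E K \<noteq> V" using KV(1) RV by auto
      then have "K \<union> nb E K \<subset> V" using KV(1) nb_subset[OF G, of K] by auto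
      then have ltK: "card (K \<union> nb E K) < card V" by (rule psubset_card_mono[OF fin(1)])
      show ?thesis
        by (rule bad_set[OF KV(1) c(3,2) KV(2) aK uK ua cK nr[OF KV(1,2) c(3,2) aK uK] ltK])
    qed
  qed
  have e2: "er E (V - S) {} = er E D {} + er E (V - S - D) D" by (rule er_split[OF fin(2) DV(1)])
  have WU: "V - S - D = insert u ?W" using u DV(2) by auto
  have e3: "er E (insert u ?W) D \<le> er E ?W D + card (S \<inter> {w. {u, w} \<in> E})"
  proof -
    let ?T = "{e \<in> E. e \<inter> ?W \<noteq> {} \<and> e \<inter> D = {}}" and ?N = "S \<inter> {w. {u, w} \<in> E}"
    have "{e \<in> E. e \<inter> insert u ?W \<noteq> {} \<and> e \<inter> D = {}} \<subseteq> ?T \<union> (\<lambda>w. {u, w}) ` ?N"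
    proof
      fix e assume e: "e \<in> {e \<in> E. e \<inter> insert u ?W \<noteq> {} \<and> e \<inter> D = {}}"
      show "e \<in> ?T \<union> (\<lambda>w. {u, w}) ` ?N"
      proof (cases "e \<inter> ?W = {}")
        case True
        then have "u \<in> e" "e \<in> E" using e by auto
        then obtain w where w: "e = {u, w}" "u \<noteq> w" using graph_edge_at[OF G] by metis
        then have "w \<in> V" using graph_edge[OF G, of u w] e by auto
        then have "w \<in> S" using w e True by auto
        then show ?thesis using w \<open>e \<in> E\<close> by auto
      qed (use e in auto)
    qed
    moreover have fs: "finite ?T" "finite ?N" using fin by auto
    ultimately have "er E (insert u ?W) D \<le> card (?T \<union> (\<lambda>w. {u, w}) ` ?N)"
      unfolding er_def by (intro card_mono) auto
    also have "\<dots> \<le> card ?T + card ((\<lambda>w. {u, w}) ` ?N)" by (rule card_Un_le)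
    also have "\<dots> \<le> card ?T + card ?N" using card_image_le[OF fs(2)] by simp
    finally show ?thesis unfolding er_def .
  qed
  have e4: "er E ?W D \<le> er ?H ?W D + card (?W \<inter> ?C)"
    by (rule er_contract[OF G ne]) (use a DV fin(1) in auto)
  have cV: "card (V - S) = card D + card ?W + 1"
  proof -
    have "card (V - S) = card D + card (V - S - D)"
      using DV(1) fin(1) finD by (simp add: card_Diff_subset card_mono)
    then show ?thesis unfolding WU using fin(1) by simp
  qed
  have e5: "card ((V - S) \<inter> ?C) = card (D \<inter> ?C) + card (?W \<inter> ?C)"
  proof -
    have "u \<notin> ?C" using graph_edge[OF G, of u u] by auto
    then have 1: "(V - S) \<inter> ?C = D \<inter> ?C \<union> ?W \<inter> ?C" using DV(1) by auto
    have 2: "finite (D \<inter> ?C)" "finite (?W \<inter> ?C)" "(D \<inter> ?C) \<inter> (?W \<inter> ?C) = {}"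
      using finD fin(1) by auto
    show ?thesis unfolding 1 by (rule card_Un_disjoint[OF 2])
  qed
  have "(card R + 1) * card (V - S) = (card R + 1) * card D + (card R + 1) * card ?W + (card R + 1)"
    unfolding cV by (simp add: add_mult_distrib2)
  then have main: "er E (V - S) {} + (card R + 1) \<le>
      (card R + 1) * card (V - S) + (er ?H ?W D - (card R + 1) * card ?W) + loss u a"
    using e1 e2 e3 e4 e5 unfolding WU by linarith
  \<comment> \<open>This truncated difference is \<open>\<epsilon>\<close>, the surplus of the
    contracted instance.\<close>
  have "er ?H ?W D - (card R + 1) * card ?W \<le> 1" using D(3) unfolding sparse_def by linarith
  moreover have "er ?H ?W D - (card R + 1) * card ?W = 0"
    if b: "b \<in> {b1, b2}" and ab: "\<forall>w\<in>V - S. {w, a} \<in> E \<longrightarrow> {w, b} \<notin> E"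
      and ub: "\<forall>w\<in>V - S. {u, w} \<in> E \<longrightarrow> {w, b} \<notin> E" for b
  proof -
    have "{w, b} \<notin> ?H" if w: "w \<in> ?W" "{w, a} \<in> ?H" for w
    proof -
      have wV: "w \<in> V - S" "w \<noteq> u" "w \<noteq> a" "b \<noteq> a" using w(1) a b RV by auto
      have "{w, a} \<in> E \<or> {u, w} \<in> E" using w(2) contract_edge_graph[OF G ne, of w a] wV by auto
      then have "{w, b} \<notin> E" using ab ub wV(1) by blast
      then show ?thesis using contract_edge_graph[OF G ne, of w b] wV by auto
    qed
    then have "er ?H ?W D \<le> (card R + 1) * card ?W" using D(3) a b unfolding sparse_def by blast
    then show ?thesis by simp
  qed
  ultimately show thesis using that main by blast
qed

end

lemma induced_path_interior:
  assumes "induced_path E s t p" "0 < i" "i < length p - 1"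
  shows "p ! i \<noteq> s" "p ! i \<noteq> t" "i < length p" "p ! i \<in> set p"
proof -
  note q = induced_pathD[OF assms(1)]
  show i: "i < length p" using assms by simp
  then show "p ! i \<in> set p" by simp
  have "p ! i \<noteq> p ! 0" using q(2,5) i assms(2) by (simp add: nth_eq_iff_index_eq)
  then show "p ! i \<noteq> s" using q(6) by simp
  have "p ! i \<noteq> p ! (length p - 1)" using q(2,5) i assms(3) by (subst nth_eq_iff_index_eq) auto
  then show "p ! i \<noteq> t" using q(7) by simp
qed

lemma induced_path_index:
  assumes "induced_path E s t p" "x \<in> set p" "x \<noteq> s" "x \<noteq> t"
  obtains i where "x = p ! i" "0 < i" "i < length p - 1"
proof -
  note q = induced_pathD[OF assms(1)]
  obtain i where i: "i < length p" "x = p ! i" using assms(2) by (auto simp: in_set_conv_nth)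
  have "i \<noteq> 0" using q(6) i(2) assms(3) by metis
  moreover have "i \<noteq> length p - 1" using q(7) i(2) assms(4) by metis
  ultimately show thesis using that[of i] i by simp
qed

lemma linked_subset: "linked E W P s t A B \<Longrightarrow> Q \<subseteq> P \<Longrightarrow> linked E W Q s t A B"
  unfolding linked_def by auto

text \<open>A path vertex that sees all of \<open>P\<close> can leave the path, once a detour around
  it exists, and hold \<open>P\<close> together as the centre of a star.\<close>

lemma star_bypass:
  assumes p: "walk E p" "distinct p" "hd p = s" "last p = t"
    and W: "set p \<union> K \<union> P \<subseteq> W" "(set p \<union> K) \<inter> P = {}"
    and ijl: "i < j" "j < l" "l < length p"
    and K: "conn E K" "p ! i \<in> nb E K" "p ! l \<in> nb E K" "p ! j \<notin> K"
    and star: "\<And>r. r \<in> P \<Longrightarrow> {p ! j, r} \<in> E"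
  shows "\<exists>B. linked E W P s t (insert (p ! j) P) B \<and> p ! j \<notin> B"
proof -
  let ?B = "set (take (Suc i) p) \<union> K \<union> set (drop l p)"
  note b = bypass[OF p(1,2) ijl K]
  have sub: "?B \<subseteq> set p \<union> K" by (auto dest: in_set_takeD in_set_dropD)
  have "conn E (insert (p ! j) P)" using star by (rule conn_star)
  moreover have "p ! j \<in> W" using ijl W(1) by auto
  ultimately have "linked E W P s t (insert (p ! j) P) ?B"
    unfolding linked_def using b p(3,4) W sub by auto
  then show ?thesis using b(4) by blast
qed

section \<open>Instances that become feasible when a root is deleted\<close>

context reduced_instance
begin

text \<open>Choose \<open>A\<close> of maximal size: then every vertex outside \<open>A\<close> with a neighbour in \<open>A\<close> lies on
  every \<open>b1\<close>-\<open>b2\<close> path avoiding \<open>A\<close> and \<open>a\<close>, and whatever hangs off the path \<open>p\<close> has at most three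
  neighbours, hence is rigid.\<close>

lemma path_structure:
  assumes a: "a \<in> R" "2 \<le> card R" and F: "feas E (V - {a}) (R - {a}) b1 b2"
  obtains A p where "conn E A" "R - {a} \<subseteq> A" "induced_path E b1 b2 p" "A \<inter> set p = {}"
    "A \<union> set p = V - {a}" "\<And>x. x \<in> A \<Longrightarrow> {a, x} \<notin> E"
    "\<And>i. 0 < i \<Longrightarrow> i < length p - 1 \<Longrightarrow> \<exists>x\<in>A. {p ! i, x} \<in> E"
proof -
  let ?L = "\<lambda>A B. linked E (V - {a}) (R - {a}) b1 b2 A B"
  obtain A0 where A0: "\<exists>B. ?L A0 B" using F unfolding feas_def by blast
  have bound: "\<forall>A. (\<exists>B. ?L A B) \<longrightarrow> card A < Suc (card V)"
  proof (intro allI impI)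
    fix A assume "\<exists>B. ?L A B"
    then have "A \<subseteq> V" unfolding linked_def by auto
    then show "card A < Suc (card V)" using card_mono[OF fin(1)] by (simp add: le_imp_less_Suc)
  qed
  obtain A where A: "\<exists>B. ?L A B" and max: "\<And>A'. \<exists>B. ?L A' B \<Longrightarrow> card A' \<le> card A"
    using ex_has_greatest_nat[of "\<lambda>A. \<exists>B. ?L A B", OF A0 bound] by blast
  then obtain B where "?L A B" by blast
  then have AB: "A \<subseteq> V - {a}" "B \<subseteq> V - {a}" "A \<inter> B = {}" "R - {a} \<subseteq> A" "b1 \<in> B" "b2 \<in> B"
    "conn E A" "conn E B" unfolding linked_def by auto
  have ne: "R - {a} \<noteq> {}"
  proof
    assume "R - {a} = {}"
    then have "R \<subseteq> {a}" by auto
    then have "card R \<le> 1" using card_mono[of "{a}" R] by simp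
    then show False using a(2) by simp
  qed
  have noa: "{a, x} \<notin> E" if x: "x \<in> A" for x
  proof
    assume "{a, x} \<in> E"
    then have cA: "conn E (insert a A)" by (rule conn_insert[OF AB(7) x])
    show False by (rule not_linked[of "insert a A" B]) (use cA AB RV a in auto)
  qed
  let ?B = "V - {a} - A"
  have mand: "x \<in> B0" if x: "x \<in> ?B" "x \<notin> {b1, b2}" "y \<in> A" "{x, y} \<in> E"
    and B0: "B0 \<subseteq> ?B" "b1 \<in> B0" "b2 \<in> B0" "conn E B0" for x y B0
  proof (rule ccontr)
    assume nx: "x \<notin> B0"
    have "conn E (insert x A)" by (rule conn_insert[OF AB(7) x(3,4)])
    then have "?L (insert x A) B0" unfolding linked_def using nx x AB B0 by auto
    then have "card (insert x A) \<le> card A" using max by blast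
    moreover have "finite A" using AB(1) fin(1) finite_subset by auto
    ultimately show False using x(1) by simp
  qed
  obtain p where p: "induced_path E b1 b2 p" "set p \<subseteq> B" using conn_induced_path[OF AB(8,5,6)] by metis
  note q = induced_pathD[OF p(1)]
  have pB: "set p \<subseteq> ?B" using p(2) AB by auto
  have bp: "b1 \<in> set p" "b2 \<in> set p"
    using q(3-5) hd_in_set[of p] last_in_set[of p] by auto
  let ?C = "{x \<in> ?B - {b1, b2}. \<exists>y\<in>A. {x, y} \<in> E}"
  have Cp: "?C \<subseteq> set p"
  proof
    fix x assume "x \<in> ?C"
    then obtain y where "x \<in> ?B" "x \<notin> {b1, b2}" "y \<in> A" "{x, y} \<in> E" by auto
    then show "x \<in> set p" using mand[of x y "set p"] pB bp walk_conn[OF q(1)] by blast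
  qed
  let ?D = "?B - ?C - {b1, b2}"
  have D: "?D = {}"
  proof (rule ccontr)
    assume "?D \<noteq> {}"
    then obtain z where z: "z \<in> ?D" by blast
    have "finite ?D" using fin(1) by simp
    then obtain K where K: "K \<in> comps E ?D" by (rule comps_exists[OF _ z])
    note c = compsD[OF K]
    have KS: "K \<subseteq> V - S" using c(1) AB(4) a by auto
    have nbK: "nb E K \<subseteq> insert a (?C \<union> {b1, b2})"
    proof
      fix v assume v: "v \<in> nb E K"
      then obtain x where x: "x \<in> K" "{x, v} \<in> E" "v \<notin> K" using nbD[of v E K] by auto
      have xD: "x \<in> ?B - {b1, b2}" "x \<notin> ?C" using x(1) c(1) by auto
      have "v \<notin> A" using xD x(2) by auto
      moreover have "v \<in> V" using graph_edge[OF G x(2)] by simp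
      moreover have "v \<notin> ?D" using c(4)[OF x(1) _ x(2)] x(3) by auto
      ultimately show "v \<in> insert a (?C \<union> {b1, b2})" by auto
    qed
    \<comment> \<open>With three such vertices on \<open>p\<close>, a detour through
      \<open>K\<close> would skip the middle one, against \<open>mand\<close>.\<close>
    have "card (nb E K - {a}) \<le> 2"
    proof (rule card_nth_image_le_2)
      show "nb E K - {a} \<subseteq> set p" using nbK Cp bp by auto
      fix i j l assume ij: "i < j" "j < l" "l < length p"
        and N: "p ! i \<in> nb E K - {a}" "p ! j \<in> nb E K - {a}" "p ! l \<in> nb E K - {a}"
      have "0 < j" "j < length p - 1" using ij by auto
      note jj = induced_path_interior[OF p(1) this]
      then have "p ! j \<in> ?C" using N(2) nbK by auto
      then obtain y where y: "p ! j \<in> ?B" "p ! j \<notin> {b1, b2}" "y \<in> A" "{p ! j, y} \<in> E" by auto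
      have nj: "p ! j \<notin> K" using N(2) nbD[of _ E K] by auto
      note b = bypass[OF q(1,2) ij c(3) _ _ nj]
      have "p ! j \<in> set (take (Suc i) p) \<union> K \<union> set (drop l p)"
      proof (rule mand[OF y])
        show "set (take (Suc i) p) \<union> K \<union> set (drop l p) \<subseteq> ?B"
          using pB c(1) by (auto dest: in_set_takeD in_set_dropD)
      qed (use b q(3,4) N in auto)
      then show False using b(4) N by auto
    qed
    then have c3: "card (nb E K) \<le> 3" using nb_finite[OF G, of K]
      by (cases "a \<in> nb E K") (simp_all add: card_Diff_singleton)
    have "rigid E K" by (rule rigid_if_card_nb_le_3[OF c(3,2) c3 nb_finite[OF G]])
    then show False using no_rigid[OF KS] c3 a(2) by simp
  qed
  then have Bp: "?B = set p" using Cp bp pB by auto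
  show thesis
  proof (rule that[OF AB(7,4) p(1) _ _ noa])
    show "A \<inter> set p = {}" using pB by auto
    show "A \<union> set p = V - {a}" using Bp AB(1) by auto
    fix i assume i: "0 < i" "i < length p - 1"
    note ii = induced_path_interior[OF p(1) i]
    have "p ! i \<in> ?B" using pB ii(4) by (rule subsetD)
    moreover have "p ! i \<notin> ?D" unfolding D by simp
    ultimately show "\<exists>x\<in>A. {p ! i, x} \<in> E" using ii(1,2) by blast
  qed
qed

text \<open>Every component of the nonterminals misses \<open>x\<close>, so it has at most
  \<open>card R + 1\<close> neighbours and leaves no surplus.\<close>

lemma avoid_terminal:
  assumes x: "x \<in> S" "\<And>w. w \<in> V - S \<Longrightarrow> {w, x} \<notin> E"
  shows "er E (V - S) {} \<le> (card R + 1) * card (V - S)"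
proof (rule all_small[OF subset_refl])
  fix K assume K: "K \<in> comps E (V - S)"
  note c = compsD[OF K]
  have "nb E K \<subseteq> S - {x}"
  proof
    fix v assume v: "v \<in> nb E K"
    then have "v \<in> V" "v \<notin> V - S" using nb_subset[OF G] comps_nb[OF K] by auto
    moreover obtain y where "y \<in> K" "{y, v} \<in> E" using nbD[OF v] by auto
    then have "v \<noteq> x" using x(2)[of y] c(1) by auto
    ultimately show "v \<in> S - {x}" by auto
  qed
  then have "card (nb E K) \<le> card (S - {x})" using fin(3) by (intro card_mono) auto
  also have "\<dots> = card R + 1" using x(1) fin(3) card_S by (subst card_Diff_singleton) auto
  finally show "card (nb E K) \<le> card R + 1" .
qed

text \<open>Rerouting \<open>p\<close> through \<open>K\<close> would hand the other neighbours of
  \<open>K\<close>, \<open>a\<close> among them, to the side that already contains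
  \<open>R - {a}\<close>. The order of \<open>K\<close> does not enter, so this supplies the
  hypothesis of \<open>contract_bound\<close>.\<close>

lemma structure_no_rigid:
  assumes a: "a \<in> R" "2 \<le> card R" and A: "conn E A" "R - {a} \<subseteq> A" "A \<inter> set p = {}"
      "A \<union> set p = V - {a}" "\<And>x. x \<in> A \<Longrightarrow> {a, x} \<notin> E"
    and p: "induced_path E b1 b2 p"
      "\<And>i. 0 < i \<Longrightarrow> i < length p - 1 \<Longrightarrow> \<exists>x\<in>A. {p ! i, x} \<in> E"
    and K: "K \<subseteq> V - S" "conn E K" "K \<noteq> {}" "a \<in> nb E K"
  shows "\<not> rigid E K"
proof
  assume rig: "rigid E K"
  note q = induced_pathD[OF p(1)]
  obtain x where x: "x \<in> K" "{x, a} \<in> E" using nbD[OF K(4)] by auto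
  have "x \<notin> A" using A(5)[of x] x(2) by (auto simp: insert_commute)
  moreover have "x \<in> V - S" using x(1) K(1) by auto
  ultimately have xp: "x \<in> set p" "x \<noteq> b1" "x \<noteq> b2" using A(4) a(1) by auto
  have hl: "hd p \<notin> K" "last p \<notin> K" "set p \<inter> K \<noteq> {}" using q(3,4) K(1) x(1) xp(1) by auto
  obtain i l where il: "i < l" "l < length p" "p ! i \<in> nb E K" "p ! l \<in> nb E K"
    "set (take (Suc i) p) \<inter> (K \<union> nb E K) = {p ! i}" "set (drop l p) \<inter> (K \<union> nb E K) = {p ! l}"
    using reroute_ends[OF q(1,2) hl] by metis
  have "R - {a} \<noteq> {}"
  proof
    assume "R - {a} = {}"
    then have "R \<subseteq> {a}" by auto
    then have "card R \<le> 1" using card_mono[of "{a}" R] by simp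
    then show False using a(2) by simp
  qed
  then have AK: "A - K \<noteq> {}" using A(2) K(1) by auto
  \<comment> \<open>Either \<open>A\<close> leaves \<open>K\<close>, as the other roots lie off
    \<open>K\<close>, or the path vertex \<open>x\<close> of \<open>K\<close> has a neighbour in
    \<open>A\<close>.\<close>
  have meet: "A \<inter> nb E K \<noteq> {}"
  proof (cases "A \<inter> K = {}")
    case True
    obtain k where k: "x = p ! k" "0 < k" "k < length p - 1" using induced_path_index[OF p(1) xp] by metis
    then obtain y where y: "y \<in> A" "{x, y} \<in> E" using p(2)[of k] by auto
    then have "y \<in> nb E K" using nbI[OF x(1)] True by auto
    then show ?thesis using y(1) by auto
  next
    case False
    then show ?thesis using conn_crosses[OF A(1) _ AK] by auto
  qed
  have ne: "p ! i \<noteq> p ! l" using il(1,2) q(2) by (simp add: nth_eq_iff_index_eq)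
  obtain A0 B0 where L0: "linked E (K \<union> nb E K) (nb E K - {p ! i, p ! l}) (p ! i) (p ! l) A0 B0"
    using rigidD[OF rig il(3,4) ne] by metis
  have W: "A \<union> set p \<union> K \<union> nb E K \<subseteq> V" using A(4) K(1) nb_subset[OF G, of K] by auto
  have "linked E V (A - K \<union> (nb E K - {p ! i, p ! l})) b1 b2
      (A - K \<union> A0) (set (take (Suc i) p) \<union> B0 \<union> set (drop l p))"
    using reroute_linked[OF A(1,3) meet q(1) il(1,2,5,6) L0 W] q(3,4) by simp
  moreover have "R \<subseteq> A - K \<union> (nb E K - {p ! i, p ! l})"
  proof -
    have "p ! i \<in> set p" "p ! l \<in> set p" using il(1,2) by auto
    then have "a \<notin> {p ! i, p ! l}" using A(4) by auto
    then show ?thesis using A(2) K(1,4) by auto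
  qed
  ultimately have "feas E V R b1 b2" using linked_subset unfolding feas_def by metis
  then show False using infeasible by simp
qed

lemma no_star_bypass:
  assumes p: "induced_path E b1 b2 p" "set p \<subseteq> V - R" and K: "K \<subseteq> V - S" "conn E K" "p ! i \<in> nb E K" "p ! l \<in> nb E K"
    and ijl: "i < j" "j < l" "l < length p" "p ! j \<notin> K" and star: "\<And>r. r \<in> R \<Longrightarrow> {p ! j, r} \<in> E"
  shows False
proof -
  note q = induced_pathD[OF p(1)]
  have "\<exists>B. linked E V R b1 b2 (insert (p ! j) R) B \<and> p ! j \<notin> B"
    by (rule star_bypass[OF q(1-4) _ _ ijl(1-3) K(2-4) ijl(4) star]) (use p(2) K(1) RV in auto)
  then show False using infeasible unfolding feas_def by blast
qed

text \<open>Once a final segment of \<open>p\<close> is complete to \<open>R\<close>, any of its vertices can serve as the centre of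
  a star on \<open>R\<close>, so no component off the segment can bypass it.\<close>

lemma endgame:
  assumes a: "a \<in> R" and p: "induced_path E b1 b2 p" "set p \<subseteq> V - R"
    and i0: "1 \<le> i0" "i0 < length p - 1"
    and star: "\<And>i r. i0 \<le> i \<Longrightarrow> i < length p - 1 \<Longrightarrow> r \<in> R \<Longrightarrow> {p ! i, r} \<in> E"
    and nba: "\<And>w. w \<in> V - S \<Longrightarrow> {w, a} \<in> E \<Longrightarrow> w \<in> (!) p ` {i0..<length p - 1}"
  shows "er E (V - S) {} \<le> (card R + 1) * card (V - S) + (if i0 = 1 then 1 else 0)"
proof -
  let ?I = "{i0..<length p - 1}"
  let ?C = "(!) p ` ?I" and ?W = "V - S - (!) p ` ?I"
  note q = induced_pathD[OF p(1)]
  have int: "p ! i \<in> V - S" "p ! i \<noteq> b1" "p ! i \<noteq> b2" if "i \<in> ?I" for i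
  proof -
    have "0 < i" "i < length p - 1" using that i0 by auto
    note ii = induced_path_interior[OF p(1) this]
    show "p ! i \<in> V - S" "p ! i \<noteq> b1" "p ! i \<noteq> b2" using subsetD[OF p(2) ii(4)] ii(1,2) by auto
  qed
  have CV: "?C \<subseteq> V - S" by (intro image_subsetI int(1))
  have bp: "b1 \<in> set p" "b2 \<in> set p"
    using q(3-5) hd_in_set[of p] last_in_set[of p] by auto
  have cC: "card ?C = card ?I"
    by (rule card_image) (use q(2) in \<open>auto simp: inj_on_def nth_eq_iff_index_eq\<close>)
  have "er E ?W {} \<le> (card R + 1) * card ?W"
  proof (rule all_small)
    fix K assume K: "K \<in> comps E ?W"
    note c = compsD[OF K]
    have KS: "K \<subseteq> V - S" using c(1) by auto
    let ?N = "nb E K \<inter> (?C \<union> {b1, b2})"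
    have sub: "nb E K \<subseteq> (R - {a}) \<union> ?N"
    proof
      fix v assume v: "v \<in> nb E K"
      then obtain x where x: "x \<in> K" "{x, v} \<in> E" using nbD[of v E K] by auto
      have "v \<in> V" using graph_edge[OF G x(2)] by simp
      moreover have "v \<notin> ?W" using v comps_nb[OF K] by auto
      moreover have "v \<noteq> a" using nba[of x] x c(1) by auto
      ultimately show "v \<in> (R - {a}) \<union> ?N" using v by blast
    qed
    have "card ?N \<le> 2"
    proof (rule card_nth_image_le_2)
      show "?N \<subseteq> set p" using bp by auto
      fix i j l assume ij: "i < j" "j < l" "l < length p"
        and N: "p ! i \<in> ?N" "p ! j \<in> ?N" "p ! l \<in> ?N"
      have "0 < j" "j < length p - 1" using ij by auto
      note jj = induced_path_interior[OF p(1) this]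
      then have "p ! j \<in> ?C" using N(2) by auto
      then have st: "\<And>r. r \<in> R \<Longrightarrow> {p ! j, r} \<in> E" using star by auto
      have nj: "p ! j \<notin> K" using N(2) nbD[of _ E K] by auto
      show False by (rule no_star_bypass[OF p KS c(3) _ _ ij nj st]) (use N in auto)
    qed
    moreover have "card (nb E K) \<le> card ((R - {a}) \<union> ?N)" using sub fin(3) by (intro card_mono) auto
    moreover have "card ((R - {a}) \<union> ?N) \<le> card (R - {a}) + card ?N" by (rule card_Un_le)
    moreover have "card R = Suc (card (R - {a}))" using card_Suc_Diff1[OF fin(3) a] by simp
    ultimately show "card (nb E K) \<le> card R + 1" by linarith
  qed auto
  moreover have "er E (V - S) {} = er E ?W {} + er E (V - S - ?W) ?W" by (rule er_split[OF fin(2)]) auto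
  moreover have "V - S - ?W = ?C" using CV by auto
  moreover have "er E ?C ?W \<le> card R * card ?C + card ?C + (if i0 = 1 then 1 else 0)"
  proof -
    let ?X = "(\<lambda>(x, r). {x, r}) ` (?C \<times> R)" and ?Y = "(\<lambda>i. {p ! i, p ! Suc i}) ` ?I"
    \<comment> \<open>For \<open>i0 > 1\<close> the path edge entering the segment starts in
      \<open>?W\<close> and is counted there. Only for \<open>i0 = 1\<close> does it start at the
      terminal \<open>b1\<close> and cost one more.\<close>
    let ?Z = "if i0 = 1 then {{p ! 0, p ! 1}} else {}"
    have cons: "{p ! i, p ! j} \<in> ?Y \<union> ?Z"
      if ij: "i < j" "j < length p" "{p ! i, p ! j} \<in> E" "i \<in> ?I \<or> j \<in> ?I" "p ! i \<in> ?C \<union> {b1, b2}" for i j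
    proof -
      have j: "j = Suc i" using q(8) ij by metis
      show ?thesis
      proof (cases "i \<in> ?I")
        case True
        then show ?thesis using j by auto
      next
        case False
        then have ji: "j = i0" using j ij(4) by auto
        have "p ! i \<notin> ?C"
        proof
          assume "p ! i \<in> ?C"
          then obtain k where k: "k \<in> ?I" "p ! i = p ! k" by auto
          then have "i = k" using nth_eq_iff_index_eq[OF q(2), of i k] ij(1,2) by auto
          then show False using False k(1) by simp
        qed
        then have "p ! i \<in> {b1, b2}" using ij(5) by auto
        then have "i = 0" using induced_path_interior(1,2)[OF p(1), of i] ij(1,2) by fastforce
        then show ?thesis using j ji by auto
      qed
    qed
    have "{e \<in> E. e \<inter> ?C \<noteq> {} \<and> e \<inter> ?W = {}} \<subseteq> ?X \<union> (?Y \<union> ?Z)"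
    proof
      fix e assume e: "e \<in> {e \<in> E. e \<inter> ?C \<noteq> {} \<and> e \<inter> ?W = {}}"
      then have e': "e \<in> E" "e \<inter> ?C \<noteq> {}" by auto
      obtain x y where xy: "e = {x, y}" "x \<in> ?C" "x \<noteq> y" using graph_edge_meet[OF G e'] by metis
      have yV: "y \<in> V" "y \<notin> ?W" using graph_edge[OF G, of x y] e xy(1) by auto
      show "e \<in> ?X \<union> (?Y \<union> ?Z)"
      proof (cases "y \<in> R")
        case True
        then show ?thesis using xy by auto
      next
        case False
        then have y: "y \<in> ?C \<union> {b1, b2}" using yV by auto
        obtain i where i: "i \<in> ?I" "x = p ! i" using xy(2) by auto
        have "y \<in> set p" using y bp by auto
        then obtain j where j: "j < length p" "y = p ! j" by (auto simp: in_set_conv_nth)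
        have "i \<noteq> j" using i j xy(3) by auto
        then consider "i < j" | "j < i" by linarith
        then have "{p ! i, p ! j} \<in> ?Y \<union> ?Z"
        proof cases
          case 1
          show ?thesis by (rule cons) (use 1 i j e xy(1,2) in auto)
        next
          case 2
          have "{p ! j, p ! i} \<in> ?Y \<union> ?Z"
            by (rule cons) (use 2 i j e xy(1) y in \<open>auto simp: insert_commute\<close>)
          moreover have "{p ! i, p ! j} = {p ! j, p ! i}" by (rule insert_commute)
          ultimately show ?thesis by (simp only:)
        qed
        then show ?thesis unfolding xy(1) i(2) j(2) by blast
      qed
    qed
    then have "er E ?C ?W \<le> card (?X \<union> (?Y \<union> ?Z))" unfolding er_def using fin(3) by (intro card_mono) auto
    also have "\<dots> \<le> card ?X + (card ?Y + card ?Z)"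
      using card_Un_le[of ?X "?Y \<union> ?Z"] card_Un_le[of ?Y ?Z] by linarith
    also have "card ?X \<le> card R * card ?C"
      using card_image_le[of "?C \<times> R" "\<lambda>(x, r). {x, r}"] fin(3) by (simp add: card_cartesian_product mult.commute)
    also have "card ?Y \<le> card ?C" unfolding cC by (rule card_image_le) simp
    finally show ?thesis by (auto split: if_splits)
  qed
  moreover have "card (V - S) = card ?W + card ?C"
    using CV fin(1) card_mono[OF _ CV] by (simp add: card_Diff_subset)
  ultimately show ?thesis by (simp add: add_mult_distrib2)
qed

end

section \<open>Moving along the path between neighbours of the deleted root\<close>

locale reduced_path = reduced_instance V E R b1 b2
  for V :: "'a set" and E :: "'a set set" and R :: "'a set" and b1 b2 :: 'a +
  fixes a :: 'a and A :: "'a set" and p :: "'a list"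
  assumes a: "a \<in> R" and R2: "2 \<le> card R"
    and A: "conn E A" "R - {a} \<subseteq> A" "A \<inter> set p = {}" "A \<union> set p = V - {a}"
      "\<And>x. x \<in> A \<Longrightarrow> {a, x} \<notin> E"
    and p: "induced_path E b1 b2 p"
      "\<And>i. 0 < i \<Longrightarrow> i < length p - 1 \<Longrightarrow> \<exists>x\<in>A. {p ! i, x} \<in> E"
begin

lemma swap_path: "reduced_path V E R b2 b1 a A (rev p)"
proof -
  note q = induced_pathD[OF p(1)]
  have "induced_path E b2 b1 (rev p)"
    unfolding induced_path_def
  proof (intro conjI allI impI)
    show "walk E (rev p)" by (rule walk_rev[OF q(1)])
    show "distinct (rev p)" "hd (rev p) = b2" "last (rev p) = b1" using q by (simp_all add: hd_rev last_rev)
    fix i j assume ij: "i < j" "j < length (rev p)" "{rev p ! i, rev p ! j} \<in> E"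
    then have "{p ! (length p - Suc j), p ! (length p - Suc i)} \<in> E"
      by (simp add: rev_nth insert_commute)
    then have "length p - Suc i = Suc (length p - Suc j)" using q(8)[of "length p - Suc j" "length p - Suc i"] ij by auto
    then show "j = Suc i" using ij by simp
  qed
  moreover have "\<exists>x\<in>A. {rev p ! i, x} \<in> E" if "0 < i" "i < length (rev p) - 1" for i
    using p(2)[of "length p - Suc i"] that by (simp add: rev_nth)
  ultimately show ?thesis
    unfolding reduced_path_def reduced_path_axioms_def using swap a R2 A by simp
qed

lemma p_sub: "set p \<subseteq> V - R"
  using A(2-4) a by auto

lemma ends: "b1 \<in> set p" "b2 \<in> set p"
  using induced_pathD(3-5)[OF p(1)] hd_in_set[of p] last_in_set[of p] by auto

lemma nb_a_path: "{a, w} \<in> E \<Longrightarrow> w \<in> set p"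
  using A(4,5) graph_edge[OF G, of a w] by auto

lemma path_nb: "{p ! i, p ! k} \<in> E \<Longrightarrow> i < length p \<Longrightarrow> k < length p \<Longrightarrow> k = i - 1 \<or> k = Suc i"
  using induced_pathD(8)[OF p(1), of i k] induced_pathD(8)[OF p(1), of k i] graph_edge[OF G, of "p ! i" "p ! k"]
  by (cases i k rule: linorder_cases) (auto simp: insert_commute)

text \<open>A path neighbour of \<open>p ! i\<close> makes the contraction lose an edge precisely if
  it is in this set: as a terminal seen by \<open>p ! i\<close> or as a common neighbour with
  \<open>a\<close>.\<close>

abbreviation "X \<equiv> {b1, b2} \<union> {w. {a, w} \<in> E}"

lemma interior:
  assumes "0 < i" "i < length p - 1"
  shows "p ! i \<in> V - S" "i < length p" "Suc i < length p" "p ! i \<in> set p"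
  using induced_path_interior[OF p(1) assms] subsetD[OF p_sub, of "p ! i"] assms by auto

text \<open>All neighbours of \<open>a\<close> lie on \<open>p\<close>, and \<open>p\<close> is
  induced. So besides roots only the two path neighbours of \<open>p ! i\<close> can count; the 1 is
  the edge to \<open>a\<close>.\<close>

lemma loss_le:
  assumes i: "0 < i" "i < length p - 1"
  shows "loss (p ! i) a \<le> 1 + card ((R - {a}) \<inter> {w. {p ! i, w} \<in> E}) +
    card ({p ! (i - 1)} \<inter> X) + card ({p ! Suc i} \<inter> X)"
proof -
  let ?N = "{w. {p ! i, w} \<in> E}" and ?M = "{w. {p ! i, w} \<in> E \<and> {a, w} \<in> E}"
  let ?T = "{p ! (i - 1)} \<inter> X" and ?T' = "{p ! Suc i} \<inter> X"
  have "loss (p ! i) a = card (S \<inter> ?N \<union> (V - S) \<inter> ?M)"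
    by (rule card_Un_disjoint[symmetric]) (use fin in auto)
  also have "S \<inter> ?N \<union> (V - S) \<inter> ?M \<subseteq> insert a ((R - {a}) \<inter> ?N) \<union> (?T \<union> ?T')"
  proof
    fix w assume w: "w \<in> S \<inter> ?N \<union> (V - S) \<inter> ?M"
    show "w \<in> insert a ((R - {a}) \<inter> ?N) \<union> (?T \<union> ?T')"
    proof (cases "w \<in> R")
      case False
      then have wX: "w \<in> X" "w \<in> set p" "{p ! i, w} \<in> E" using w ends nb_a_path by auto
      then obtain k where k: "k < length p" "w = p ! k" by (auto simp: in_set_conv_nth)
      then have "k = i - 1 \<or> k = Suc i" using path_nb[of i k] wX(3) interior(2)[OF i] by simp
      then show ?thesis using k wX(1) by blast
    qed (use w in auto)
  qed
  then have "card (S \<inter> ?N \<union> (V - S) \<inter> ?M) \<le> card (insert a ((R - {a}) \<inter> ?N) \<union> (?T \<union> ?T'))"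
    using fin(3) by (intro card_mono) auto
  also have "\<dots> \<le> card (insert a ((R - {a}) \<inter> ?N)) + (card ?T + card ?T')"
    using card_Un_le[of "insert a ((R - {a}) \<inter> ?N)" "?T \<union> ?T'"] card_Un_le[of ?T ?T'] by linarith
  also have "card (insert a ((R - {a}) \<inter> ?N)) = 1 + card ((R - {a}) \<inter> ?N)" using fin(3) by simp
  finally show ?thesis by simp
qed

lemma path_step:
  assumes i: "0 < i" "i < length p - 1" and ia: "{p ! i, a} \<in> E"
  obtains \<epsilon> :: nat where "\<epsilon> \<le> 1"
    "er E (V - S) {} + card R \<le> (card R + 1) * card (V - S) + \<epsilon> +
       card ((R - {a}) \<inter> {w. {p ! i, w} \<in> E}) + card ({p ! (i - 1)} \<inter> X) + card ({p ! Suc i} \<inter> X)"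
    "\<And>b. b \<in> {b1, b2} \<Longrightarrow> \<forall>w\<in>V - S. {w, a} \<in> E \<longrightarrow> {w, b} \<notin> E \<Longrightarrow>
       \<forall>w\<in>V - S. {p ! i, w} \<in> E \<longrightarrow> {w, b} \<notin> E \<Longrightarrow> \<epsilon> = 0"
proof -
  have nr: "\<not> rigid E K" if "K \<subseteq> V - S" "conn E K" "K \<noteq> {}" "a \<in> nb E K" for K
    by (rule structure_no_rigid[OF a R2 A p that])
  obtain \<epsilon> :: nat where e: "\<epsilon> \<le> 1"
    "er E (V - S) {} + (card R + 1) \<le> (card R + 1) * card (V - S) + \<epsilon> + loss (p ! i) a"
    "\<And>b. b \<in> {b1, b2} \<Longrightarrow> \<forall>w\<in>V - S. {w, a} \<in> E \<longrightarrow> {w, b} \<notin> E \<Longrightarrow>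
       \<forall>w\<in>V - S. {p ! i, w} \<in> E \<longrightarrow> {w, b} \<notin> E \<Longrightarrow> \<epsilon> = 0"
    using contract_bound[OF a interior(1)[OF i] ia nr] by blast
  have main: "er E (V - S) {} + card R \<le> (card R + 1) * card (V - S) + \<epsilon> +
       card ((R - {a}) \<inter> {w. {p ! i, w} \<in> E}) + card ({p ! (i - 1)} \<inter> X) + card ({p ! Suc i} \<inter> X)"
    using e(2) loss_le[OF i] by linarith
  show thesis
  proof (rule that[OF e(1) main])
    fix b assume "b \<in> {b1, b2}" "\<forall>w\<in>V - S. {w, a} \<in> E \<longrightarrow> {w, b} \<notin> E"
      "\<forall>w\<in>V - S. {p ! i, w} \<in> E \<longrightarrow> {w, b} \<notin> E"
    then show "\<epsilon> = 0" by (rule e(3))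
  qed
qed

lemma card_root_nb:
  shows "card ((R - {a}) \<inter> {w. {u, w} \<in> E}) + 1 \<le> card R"
    and "card R \<le> card ((R - {a}) \<inter> {w. {u, w} \<in> E}) + 1 \<Longrightarrow> r \<in> R - {a} \<Longrightarrow> {u, r} \<in> E"
proof -
  let ?N = "(R - {a}) \<inter> {w. {u, w} \<in> E}"
  have c: "card R = Suc (card (R - {a}))" using card_Suc_Diff1[OF fin(3) a] by simp
  have le: "card ?N \<le> card (R - {a})" using fin(3) by (intro card_mono) auto
  then show "card ?N + 1 \<le> card R" using c by simp
  assume "card R \<le> card ?N + 1" and r: "r \<in> R - {a}"
  then have "card ?N = card (R - {a})" using c le by simp
  then have "?N = R - {a}" using fin(3) by (intro card_subset_eq) auto
  then show "{u, r} \<in> E" using r by blast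
qed

lemma card_single: "card ({x} \<inter> Y) = (if x \<in> Y then 1 else 0)"
  by auto

lemma interior_in_X:
  assumes "0 < i" "i < length p - 1" "p ! i \<in> X"
  shows "{p ! i, a} \<in> E"
  using interior(1)[OF assms(1,2)] assms(3) by (auto simp: insert_commute)

text \<open>A violation forces equality in \<open>path_step\<close> at every interior neighbour of
  \<open>a\<close>. Adjacency to \<open>a\<close> then spreads along the path in both directions,
  every interior vertex sees all roots, and \<open>endgame\<close> applies from the first of
  them.\<close>

lemma bound_Suc: "er E (V - S) {} \<le> (card R + 1) * card (V - S) + 1"
proof (rule ccontr)
  assume big: "\<not> ?thesis"
  let ?N = "length p - 1"
  \<comment> \<open>A violation means an excess of at least 2, so the last four terms of
    \<open>path_step\<close> must reach \<open>card R + 2\<close>. Their maxima are 1,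
    \<open>card R - 1\<close>, 1 and 1, hence all are attained.\<close>
  have full: "(\<forall>r\<in>R. {p ! i, r} \<in> E) \<and> p ! (i - 1) \<in> X \<and> p ! Suc i \<in> X"
    if i: "0 < i" "i < ?N" "{p ! i, a} \<in> E" for i
  proof -
    obtain \<epsilon> :: nat where "\<epsilon> \<le> 1"
    "er E (V - S) {} + card R \<le> (card R + 1) * card (V - S) + \<epsilon> +
       card ((R - {a}) \<inter> {w. {p ! i, w} \<in> E}) + card ({p ! (i - 1)} \<inter> X) + card ({p ! Suc i} \<inter> X)"
      using path_step[OF i] by blast
    moreover note card_root_nb(1)[of "p ! i"]
    moreover have "card ({p ! (i - 1)} \<inter> X) \<le> 1" "card ({p ! Suc i} \<inter> X) \<le> 1"
      unfolding card_single by simp_all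
    ultimately have f: "card R \<le> card ((R - {a}) \<inter> {w. {p ! i, w} \<in> E}) + 1"
      "card ({p ! (i - 1)} \<inter> X) = 1" "card ({p ! Suc i} \<inter> X) = 1" using big by linarith+
    have "p ! (i - 1) \<in> X" "p ! Suc i \<in> X" using f(2,3) unfolding card_single by (metis zero_neq_one)+
    moreover have "{p ! i, r} \<in> E" if "r \<in> R" for r
      using card_root_nb(2)[OF f(1), of r] i(3) that by (cases "r = a") auto
    ultimately show ?thesis by blast
  qed
  show False
  proof (cases "\<exists>i. 0 < i \<and> i < ?N \<and> {p ! i, a} \<in> E")
    case False
    have "{w, a} \<notin> E" if w: "w \<in> V - S" for w
    proof
      assume wa: "{w, a} \<in> E"
      then have "w \<in> set p" using nb_a_path[of w] by (simp add: insert_commute)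
      then obtain i where "w = p ! i" "0 < i" "i < ?N" using induced_path_index[OF p(1), of w] w by auto
      then show False using False wa by auto
    qed
    then show False using avoid_terminal[of a] a big by auto
  next
    case True
    then obtain i where i: "0 < i" "i < ?N" "{p ! i, a} \<in> E" by blast
    have up: "k < ?N \<longrightarrow> {p ! k, a} \<in> E" if "i \<le> k" for k
      using that
    proof (induction k rule: dec_induct)
      case (step k)
      then show ?case using full[of k] interior_in_X[of "Suc k"] i(1) by auto
    qed (use i in simp)
    have down: "0 < k \<longrightarrow> {p ! k, a} \<in> E" if "k \<le> i" for k
      using that
    proof (induction k rule: inc_induct)
      case (step k)
      show ?case
      proof
        assume k: "0 < k"
        have "{p ! Suc k, a} \<in> E" "Suc k < ?N" using step i(2) by auto
        then have "p ! k \<in> X" using full[of "Suc k"] by simp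
        then show "{p ! k, a} \<in> E" using interior_in_X[OF k] \<open>Suc k < ?N\<close> by linarith
      qed
    qed (use i in simp)
    have all: "{p ! k, a} \<in> E" if "0 < k" "k < ?N" for k
      using up[of k] down[of k] that by (cases "i \<le> k") auto
    have "er E (V - S) {} \<le> (card R + 1) * card (V - S) + (if (1::nat) = 1 then 1 else 0)"
    proof (rule endgame[OF a p(1) p_sub])
      fix k r assume "1 \<le> k" "k < ?N" "r \<in> R"
      then show "{p ! k, r} \<in> E" using full[of k] all[of k] by auto
    next
      fix w assume w: "w \<in> V - S" "{w, a} \<in> E"
      then have "w \<in> set p" using nb_a_path[of w] by (simp add: insert_commute)
      then obtain i where "w = p ! i" "0 < i" "i < ?N" using induced_path_index[OF p(1), of w] w by auto
      then show "w \<in> (!) p ` {1..<?N}" by auto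
    qed (use i in auto)
    then show False using big by simp
  qed
qed

text \<open>The excess is only known to be 1, so equality needs one more vanishing term. At the
  first neighbour \<open>p ! i0\<close> of \<open>a\<close> on the path it is the term of the left
  path neighbour, at later ones it is \<open>\<epsilon>\<close>. Adjacency therefore spreads to the
  right only, and \<open>i0 > 1\<close> spares the extra edge in \<open>endgame\<close>.\<close>

lemma bound_tight:
  assumes ab: "\<forall>w\<in>V - S. {w, a} \<in> E \<longrightarrow> {w, b1} \<notin> E"
  shows "er E (V - S) {} \<le> (card R + 1) * card (V - S)"
proof (rule ccontr)
  assume big: "\<not> ?thesis"
  let ?N = "length p - 1"
  note q = induced_pathD[OF p(1)]
  let ?I = "\<lambda>i. 0 < i \<and> i < ?N \<and> {p ! i, a} \<in> E"
  have idx: "\<exists>i. w = p ! i \<and> ?I i" if w: "w \<in> V - S" "{w, a} \<in> E" for w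
  proof -
    have "w \<in> set p" using nb_a_path[of w] w(2) by (simp add: insert_commute)
    then obtain i where "w = p ! i" "0 < i" "i < ?N" using induced_path_index[OF p(1), of w] w by auto
    then show ?thesis using w(2) by auto
  qed
  show False
  proof (cases "\<exists>i. ?I i")
    case False
    then have "{w, a} \<notin> E" if "w \<in> V - S" for w using idx[of w] that by blast
    then show False using avoid_terminal[of a] a big by auto
  next
    case True
    define i0 where "i0 = (LEAST i. ?I i)"
    have i0: "0 < i0" "i0 < ?N" "{p ! i0, a} \<in> E" using LeastI_ex[OF True] unfolding i0_def by auto
    have least: "i0 \<le> i" if "?I i" for i using Least_le[of ?I i] that unfolding i0_def by blast
    \<comment> \<open>\<open>p ! 1\<close> is adjacent to \<open>b1\<close>, hence not to
      \<open>a\<close>.\<close>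
    have "i0 \<noteq> 1"
    proof
      assume "i0 = 1"
      moreover have "{p ! 0, p ! Suc 0} \<in> E" using q(1) i0 unfolding walk_def by auto
      ultimately have "{p ! i0, b1} \<in> E" using q(6) by (simp add: insert_commute)
      then show False using ab interior(1)[OF i0(1,2)] i0(3) by blast
    qed
    then have i2: "2 \<le> i0" using i0(1) by simp
    have full0: "(\<forall>r\<in>R. {p ! i0, r} \<in> E) \<and> p ! Suc i0 \<in> X"
    proof -
      obtain \<epsilon> :: nat where "\<epsilon> \<le> 1"
        "er E (V - S) {} + card R \<le> (card R + 1) * card (V - S) + \<epsilon> +
        card ((R - {a}) \<inter> {w. {p ! i0, w} \<in> E}) + card ({p ! (i0 - 1)} \<inter> X) + card ({p ! Suc i0} \<inter> X)"
        using path_step[OF i0] by blast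
      moreover note card_root_nb(1)[of "p ! i0"]
      moreover have "p ! (i0 - 1) \<notin> X"
      proof
        assume pX: "p ! (i0 - 1) \<in> X"
        have i1: "0 < i0 - 1" "i0 - 1 < ?N" using i2 i0(2) by linarith+
        have "i0 \<le> i0 - 1" using least[of "i0 - 1"] interior_in_X[OF i1 pX] i1 by blast
        then show False using i2 by linarith
      qed
      then have "card ({p ! (i0 - 1)} \<inter> X) = 0" unfolding card_single by simp
      moreover have "card ({p ! Suc i0} \<inter> X) \<le> 1" unfolding card_single by simp
      ultimately have f: "card R \<le> card ((R - {a}) \<inter> {w. {p ! i0, w} \<in> E}) + 1"
        "card ({p ! Suc i0} \<inter> X) = 1" using big by linarith+
      have "p ! Suc i0 \<in> X" using f(2) unfolding card_single by (metis zero_neq_one)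
      moreover have "{p ! i0, r} \<in> E" if "r \<in> R" for r
        using card_root_nb(2)[OF f(1), of r] i0(3) that by (cases "r = a") auto
      ultimately show ?thesis by blast
    qed
    have full: "(\<forall>r\<in>R. {p ! i, r} \<in> E) \<and> p ! Suc i \<in> X" if i: "i0 < i" "i < ?N" "{p ! i, a} \<in> E" for i
    proof -
      have ii: "0 < i" using i(1) by simp
      obtain \<epsilon> :: nat where e: "\<epsilon> \<le> 1"
        "er E (V - S) {} + card R \<le> (card R + 1) * card (V - S) + \<epsilon> +
        card ((R - {a}) \<inter> {w. {p ! i, w} \<in> E}) + card ({p ! (i - 1)} \<inter> X) + card ({p ! Suc i} \<inter> X)"
        "\<And>b. b \<in> {b1, b2} \<Longrightarrow> \<forall>w\<in>V - S. {w, a} \<in> E \<longrightarrow> {w, b} \<notin> E \<Longrightarrow>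
         \<forall>w\<in>V - S. {p ! i, w} \<in> E \<longrightarrow> {w, b} \<notin> E \<Longrightarrow> \<epsilon> = 0"
        using path_step[OF ii i(2,3)] by blast
      \<comment> \<open>A common neighbour of \<open>p ! i\<close> and \<open>b1\<close> would give
        a detour around \<open>p ! i0\<close>, which sees all roots and can become the centre of a
        star.\<close>
      have "{w, b1} \<notin> E" if w: "w \<in> V - S" "{p ! i, w} \<in> E" for w
      proof
        assume wb: "{w, b1} \<in> E"
        have "w \<notin> set p"
        proof
          assume "w \<in> set p"
          then obtain k where k: "k < length p" "w = p ! k" by (auto simp: in_set_conv_nth)
          have "k = i - 1 \<or> k = Suc i" using path_nb[of i k] w(2) k interior(2)[OF ii i(2)] by simp
          moreover have "0 = k - 1 \<or> 0 = Suc k" using path_nb[of k 0] wb k q(5,6) by simp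
          moreover have "k \<noteq> 0" using w(1) k q(6) by (metis DiffE UnI2 insertI1)
          ultimately show False using i(1) i2 by auto
        qed
        moreover have "p ! i0 \<in> set p" using interior(4)[OF i0(1,2)] .
        ultimately have n: "p ! i0 \<notin> {w}" by auto
        have nbw: "p ! 0 \<in> nb E {w}" "p ! i \<in> nb E {w}"
          using wb w q(6) graph_edge[OF G w(2)] graph_edge[OF G wb] unfolding nb_def by (auto simp: insert_commute)
        show False
          by (rule no_star_bypass[OF p(1) p_sub _ conn_singleton nbw i0(1) i(1) interior(2)[OF ii i(2)] n])
            (use w(1) full0 in auto)
      qed
      then have "\<epsilon> = 0" using e(3)[of b1] ab by blast
      moreover note card_root_nb(1)[of "p ! i"]
      moreover have "card ({p ! (i - 1)} \<inter> X) \<le> 1" "card ({p ! Suc i} \<inter> X) \<le> 1"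
        unfolding card_single by simp_all
      ultimately have f: "card R \<le> card ((R - {a}) \<inter> {w. {p ! i, w} \<in> E}) + 1"
        "card ({p ! Suc i} \<inter> X) = 1" using big e(2) by linarith+
      have "p ! Suc i \<in> X" using f(2) unfolding card_single by (metis zero_neq_one)
      moreover have "{p ! i, r} \<in> E" if "r \<in> R" for r
        using card_root_nb(2)[OF f(1), of r] i(3) that by (cases "r = a") auto
      ultimately show ?thesis by blast
    qed
    have all: "k < ?N \<longrightarrow> {p ! k, a} \<in> E" if "i0 \<le> k" for k
      using that
    proof (induction k rule: dec_induct)
      case (step k)
      then show ?case using full[of k] full0 interior_in_X[of "Suc k"] by (cases "k = i0") auto
    qed (use i0 in simp)
    have "er E (V - S) {} \<le> (card R + 1) * card (V - S) + (if i0 = 1 then 1 else 0)"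
    proof (rule endgame[OF a p(1) p_sub _ i0(2)])
      fix k r assume "i0 \<le> k" "k < ?N" "r \<in> R"
      then show "{p ! k, r} \<in> E" using full[of k] full0 all[of k] by (cases "k = i0") auto
    next
      fix w assume w: "w \<in> V - S" "{w, a} \<in> E"
      then obtain i where "w = p ! i" "?I i" using idx by blast
      then show "w \<in> (!) p ` {i0..<?N}" using least[of i] by auto
    qed (use i2 in auto)
    then show False using big i2 by simp
  qed
qed

end

section \<open>The bound for infeasible instances\<close>

context reduced_instance
begin

text \<open>With at most one root a component has at most three neighbours and is rigid, so it must
  see all terminals. Then it joins \<open>b1\<close> to \<open>b2\<close>, while \<open>R\<close> is
  connected by itself.\<close>

lemma no_nonterminals:
  assumes "card R \<le> 1"
  shows "V - S = {}"
proof (rule ccontr)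
  assume "V - S \<noteq> {}"
  then obtain x where x: "x \<in> V - S" by blast
  have finVS: "finite (V - S)" using fin(1) by simp
  obtain K where K: "K \<in> comps E (V - S)" by (rule comps_exists[OF finVS x])
  note c = compsD[OF K]
  have nbS: "nb E K \<subseteq> S" using nb_subset[OF G, of K] comps_nb[OF K] by auto
  have finS: "finite S" using fin(3) by simp
  have le: "card (nb E K) \<le> card R + 2" using card_mono[OF finS nbS] card_S by simp
  have "rigid E K" by (rule rigid_if_card_nb_le_3[OF c(3,2) _ nb_finite[OF G]]) (use le assms in simp)
  then have "\<not> card (nb E K) \<le> card R + 1" using no_rigid[OF c(1)] by blast
  then have "nb E K = S" using le card_S by (intro card_subset_eq[OF finS nbS]) simp
  then have "conn E (K \<union> {b1, b2})" by (intro conn_nb_Un[OF c(3)]) simp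
  moreover have "conn E R"
  proof (cases "R = {}")
    case False
    then have "card R = 1" using assms card_ge_1[OF fin(3)] by simp
    then show ?thesis by (auto simp: card_1_singleton_iff)
  qed simp
  ultimately show False using not_linked[of R "K \<union> {b1, b2}"] RV c(1) by auto
qed

text \<open>For each root \<open>a\<close>, either deleting it leaves the instance infeasible and
  \<open>delete_root\<close> applies, or it becomes feasible and the structure along an induced path
  is available.\<close>

lemma sparse: "sparse E (V - S) {} R b1 b2"
proof (cases "card R \<le> 1")
  case True
  show ?thesis unfolding no_nonterminals[OF True] sparse_def by simp
next
  case False
  then have R2: "2 \<le> card R" by simp
  have one: "er E (V - S) {} \<le> (card R + 1) * card (V - S) + 1 \<and>
    (\<forall>b\<in>{b1, b2}. (\<forall>w\<in>V - S. {w, a} \<in> E \<longrightarrow> {w, b} \<notin> E) \<longrightarrow>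
      er E (V - S) {} \<le> (card R + 1) * card (V - S))" if a: "a \<in> R" for a
  proof (cases "feas E (V - {a}) (R - {a}) b1 b2")
    case True
    obtain A p where "conn E A" "R - {a} \<subseteq> A" "induced_path E b1 b2 p" "A \<inter> set p = {}"
      "A \<union> set p = V - {a}" "\<And>x. x \<in> A \<Longrightarrow> {a, x} \<notin> E"
      "\<And>i. 0 < i \<Longrightarrow> i < length p - 1 \<Longrightarrow> \<exists>x\<in>A. {p ! i, x} \<in> E"
      using path_structure[OF a R2 True] by blast
    then interpret P: reduced_path V E R b1 b2 a A p
      using a R2 by unfold_locales
    interpret Q: reduced_path V E R b2 b1 a A "rev p" by (rule P.swap_path)
    show ?thesis using P.bound_Suc P.bound_tight Q.bound_tight by (simp add: insert_commute)
  next
    case False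
    let ?N = "{w. {w, a} \<in> E}"
    note d = delete_root[OF a False]
    have N: "card ((V - S) \<inter> ?N) \<le> card (V - S)" using fin(1) by (intro card_mono) auto
    show ?thesis
    proof (intro conjI ballI impI)
      show "er E (V - S) {} \<le> (card R + 1) * card (V - S) + 1" using d N by simp
      fix b assume b: "b \<in> {b1, b2}" and ab: "\<forall>w\<in>V - S. {w, a} \<in> E \<longrightarrow> {w, b} \<notin> E"
      show "er E (V - S) {} \<le> (card R + 1) * card (V - S)"
      \<comment> \<open>If every nonterminal sees \<open>a\<close>, none sees \<open>b\<close>;
        otherwise the number of neighbours of \<open>a\<close> stays below
        \<open>card (V - S)\<close> by at least 1.\<close>
      proof (cases "V - S \<subseteq> ?N")
        case True
        then show ?thesis using avoid_terminal[of b] ab b by auto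
      next
        case False
        then have "(V - S) \<inter> ?N \<subset> V - S" by blast
        then have "card ((V - S) \<inter> ?N) < card (V - S)" using fin(1) by (intro psubset_card_mono) auto
        then show ?thesis using d by simp
      qed
    qed
  qed
  have "R \<noteq> {}" using R2 by auto
  then show ?thesis unfolding sparse_def using one by blast
qed

end

theorem reduced_bound: "reduced_bound V E R s t"
proof (induction "card V" arbitrary: V E R s t rule: less_induct)
  case (less V E R s t)
  have "sparse E (V - (R \<union> {s, t})) {} R s t" if "inst V E R s t" "\<not> feas E V R s t"
    "\<forall>Y\<subseteq>V - (R \<union> {s, t}). card (nb E Y) \<le> card R + 1 \<longrightarrow> \<not> rigid E Y"
  proof -
    have "reduced_instance V E R s t" using less that by unfold_locales auto
    then show ?thesis by (rule reduced_instance.sparse)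
  qed
  then show ?case unfolding reduced_bound_def by blast
qed

subsection \<open>Critically feasible instances\<close>

lemma nth_take_drop_index:
  assumes "distinct p" "k < length p"
  shows "p ! k \<in> set (take (Suc i) p) \<Longrightarrow> k \<le> i" "p ! k \<in> set (drop l p) \<Longrightarrow> l \<le> k"
proof -
  assume "p ! k \<in> set (take (Suc i) p)"
  then obtain j where j: "j < length (take (Suc i) p)" "take (Suc i) p ! j = p ! k"
    unfolding in_set_conv_nth by auto
  then have "j < length p" "j \<le> i" "p ! j = p ! k" by auto
  then show "k \<le> i" using nth_eq_iff_index_eq[OF assms(1), of j k] assms(2) by simp
next
  assume "p ! k \<in> set (drop l p)"
  then obtain j where j: "j < length (drop l p)" "drop l p ! j = p ! k"
    unfolding in_set_conv_nth by auto
  then have "l + j < length p" "p ! (l + j) = p ! k" by auto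
  then show "l \<le> k" using nth_eq_iff_index_eq[OF assms(1), of "l + j" k] assms(2) by simp
qed

text \<open>Nothing is assumed about rigid subsets: they are collected in \<open>D\<close>, whose
  components have smaller order and are bounded separately. For that reason \<open>D\<close> cannot
  be all of \<open>Y\<close>.\<close>

lemma nonrigid_decomposition:
  assumes G: "graph V E" and Y: "Y \<subseteq> V" "conn E Y" "Y \<noteq> {}" "\<not> rigid E Y"
  obtains D where "D \<subset> Y" "\<And>K. K \<in> comps E D \<Longrightarrow> card (nb E K) < card (nb E Y)"
    "er E (Y - D) D \<le> (card (nb E Y) - 1) * card (Y - D) + 1" "2 \<le> card (nb E Y)"
proof -
  obtain s t where st: "s \<in> nb E Y" "t \<in> nb E Y" "s \<noteq> t"
    and inf: "\<not> feas E (Y \<union> nb E Y) (nb E Y - {s, t}) s t"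
    using Y unfolding rigid_def by blast
  let ?V = "Y \<union> nb E Y" and ?P = "nb E Y - {s, t}"
  let ?E = "{e \<in> E. e \<subseteq> ?V}"
  note c = card_nb_minus2[OF G st]
  have inf': "\<not> feas ?E ?V ?P s t" using inf feas_restrict[of ?V ?V] by auto
  note W = nonterminals_nb[OF st(1,2)]
  obtain D where D: "D \<subseteq> Y" "\<forall>K\<in>comps ?E D. card (nb ?E K) \<le> card ?P + 1"
    "sparse ?E (Y - D) D ?P s t"
    using infeasible_decomposition[OF reduced_bound inst_nb[OF G st Y(1)] inf', unfolded W] by blast
  have small: "card (nb E K) < card (nb E Y)" if K: "K \<in> comps E D" for K
  proof -
    note k = compsD[OF K]
    have "K \<subseteq> ?V" using k(1) D(1) by auto
    then have "conn ?E K" using k(3) conn_restrict by metis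
    moreover have "\<forall>x\<in>K. \<forall>y\<in>D - K. {x, y} \<notin> ?E" using k(4) by blast
    ultimately have "K \<in> comps ?E D" using k(1,2) unfolding comps_def by blast
    then have "card (nb ?E K) \<le> card ?P + 1" using D(2) by blast
    moreover have "nb ?E K = nb E K" using nb_restrict[of K Y E] k(1) D(1) by auto
    ultimately show ?thesis using c by simp
  qed
  have "D \<noteq> Y"
  proof
    assume DY: "D = Y"
    have "Y \<in> comps E D" using Y(2,3) unfolding comps_def DY by auto
    then show False using small by auto
  qed
  moreover have "er E (Y - D) D = er ?E (Y - D) D" using er_restrict[OF G, of "Y - D" Y] by auto
  moreover have "card ?P + 1 = card (nb E Y) - 1" using c by simp
  ultimately show thesis using that[of D] D small c unfolding sparse_def by auto
qed

text \<open>Only rigid sets off \<open>U\<close> are excluded, since only those may be absorbed by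
  the collection. Rigid sets that meet \<open>U\<close> remain and are bounded through the instances
  they span.\<close>

definition critical_bound ::
  "'a set \<Rightarrow> 'a set set \<Rightarrow> 'a set \<Rightarrow> 'a \<Rightarrow> 'a \<Rightarrow> 'a set \<Rightarrow> bool" where
  "critical_bound V E R b1 b2 U \<longleftrightarrow>
     (inst V E R b1 b2 \<longrightarrow> feas E V R b1 b2 \<longrightarrow> U \<subseteq> V - (R \<union> {b1, b2}) \<longrightarrow> U \<noteq> {} \<longrightarrow>
      (\<forall>A B. linked E V R b1 b2 A B \<longrightarrow> U \<subseteq> B) \<longrightarrow>
      (\<forall>Y\<subseteq>V - (R \<union> {b1, b2}) - U. card (nb E Y) \<le> card R + 2 \<longrightarrow> \<not> rigid E Y) \<longrightarrow>
      er E (V - (R \<union> {b1, b2})) {} + card U \<le> (card R + 2) * card (V - (R \<union> {b1, b2})) + 1)"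

section \<open>Rigid and nonrigid sets in a critical instance\<close>

locale critical_path =
  fixes V :: "'a set" and E :: "'a set set" and R :: "'a set" and b1 b2 :: 'a
    and U A :: "'a set" and p :: "'a list"
  assumes inst: "inst V E R b1 b2"
    and U: "U \<subseteq> V - (R \<union> {b1, b2})"
    and critical: "\<And>A B. linked E V R b1 b2 A B \<Longrightarrow> U \<subseteq> B"
    and no_rigid: "\<And>Y. Y \<subseteq> V - (R \<union> {b1, b2}) - U \<Longrightarrow> card (nb E Y) \<le> card R + 2 \<Longrightarrow> \<not> rigid E Y"
    and IH: "\<And>V' E' R' s t U'. card V' < card V \<Longrightarrow> critical_bound V' E' R' s t (U' :: 'a set)"
    and A: "conn E A" "R \<subseteq> A" "A \<subseteq> V"
    and p: "induced_path E b1 b2 p" "set p \<subseteq> V" "A \<inter> set p = {}"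
begin

abbreviation "S \<equiv> R \<union> {b1, b2}"

lemma G: "graph V E" and RV: "R \<subseteq> V" "b1 \<in> V" "b2 \<in> V" "b1 \<noteq> b2" "b1 \<notin> R" "b2 \<notin> R"
  using inst unfolding inst_def by auto

lemma fin: "finite V" "finite E" "finite R" "\<And>e. e \<in> E \<Longrightarrow> card e = 2" "finite U"
proof -
  show V: "finite V" and "finite E" "\<And>e. e \<in> E \<Longrightarrow> card e = 2"
    using graph_finite[OF G] G unfolding graph_def by auto
  have "R \<subseteq> V" "U \<subseteq> V" using RV(1) U by auto
  then show "finite R" "finite U" using V by (simp_all add: finite_subset)
qed

lemma card_S: "card S = card R + 2"
  using RV fin(3) by simp

lemma ends: "b1 \<in> set p" "b2 \<in> set p"
  using induced_pathD(3-5)[OF p(1)] hd_in_set[of p] last_in_set[of p] by auto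

lemma U_path: "U \<subseteq> set p"
proof (rule critical)
  show "linked E V R b1 b2 A (set p)"
    unfolding linked_def using A p ends walk_conn induced_pathD(1)[OF p(1)] by blast
qed

text \<open>A linkage inside \<open>Y\<close> between the first and last contact of \<open>p\<close>
  with \<open>nb E Y\<close> extends to one of the whole instance. So criticality passes down to
  local linkages.\<close>

lemma rigid_reroute:
  assumes Y: "rigid E Y" "Y \<subseteq> V - S" "U \<inter> Y \<noteq> {}"
  obtains i l where "i < l" "l < length p" "p ! i \<in> nb E Y" "p ! l \<in> nb E Y"
    "\<And>k. k < length p \<Longrightarrow> p ! k \<in> Y \<Longrightarrow> i < k \<and> k < l"
    "\<And>k. k < length p \<Longrightarrow> p ! k \<in> nb E Y \<Longrightarrow> i \<le> k \<and> k \<le> l"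
    "\<And>A0 B0. linked E (Y \<union> nb E Y) (nb E Y - {p ! i, p ! l}) (p ! i) (p ! l) A0 B0 \<Longrightarrow>
       U \<subseteq> set (take (Suc i) p) \<union> B0 \<union> set (drop l p)"
proof -
  note q = induced_pathD[OF p(1)]
  have hl: "hd p \<notin> Y" "last p \<notin> Y" "set p \<inter> Y \<noteq> {}" using q(3,4) Y(2,3) U_path by auto
  obtain i l where il: "i < l" "l < length p" "p ! i \<in> nb E Y" "p ! l \<in> nb E Y"
    and it: "set (take (Suc i) p) \<inter> (Y \<union> nb E Y) = {p ! i}" "set (drop l p) \<inter> (Y \<union> nb E Y) = {p ! l}"
    and k: "\<And>k. k < length p \<Longrightarrow> p ! k \<in> Y \<Longrightarrow> i < k \<and> k < l"
      "\<And>k. k < length p \<Longrightarrow> p ! k \<in> nb E Y \<Longrightarrow> i \<le> k \<and> k \<le> l"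
    using reroute_ends[OF q(1,2) hl] by blast
  have "U \<subseteq> set (take (Suc i) p) \<union> B0 \<union> set (drop l p)"
    if L: "linked E (Y \<union> nb E Y) (nb E Y - {p ! i, p ! l}) (p ! i) (p ! l) A0 B0" for A0 B0
  proof (cases "A \<inter> nb E Y = {}")
    case False
    have "A \<union> set p \<union> Y \<union> nb E Y \<subseteq> V" using A(3) p(2) Y(2) nb_subset[OF G, of Y] by auto
    then have "linked E V (A - Y \<union> (nb E Y - {p ! i, p ! l})) b1 b2 (A - Y \<union> A0)
        (set (take (Suc i) p) \<union> B0 \<union> set (drop l p))"
      using reroute_linked[OF A(1) p(3) False q(1) il(1,2) it L] q(3,4) by simp
    then have "linked E V R b1 b2 (A - Y \<union> A0) (set (take (Suc i) p) \<union> B0 \<union> set (drop l p))"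
      by (rule linked_subset) (use A(2) Y(2) in auto)
    then show ?thesis by (rule critical)
  next
    case True
    have L': "B0 \<subseteq> Y \<union> nb E Y" "p ! i \<in> B0" "p ! l \<in> B0" "conn E B0"
      using L unfolding linked_def by auto
    \<comment> \<open>When \<open>A\<close> misses \<open>nb E Y\<close> and there are roots,
      \<open>A\<close> lies off \<open>Y\<close>. Without roots it might lie inside
      \<open>Y\<close>, and the empty set takes its place.\<close>
    let ?A = "if R = {} then {} else A" and ?B = "set (take (Suc i) p) \<union> B0 \<union> set (drop l p)"
    have "A \<inter> Y = {}" if "R \<noteq> {}"
    proof (rule ccontr)
      assume "A \<inter> Y \<noteq> {}"
      moreover have "A - Y \<noteq> {}" using that A(2) Y(2) by auto
      ultimately show False using conn_crosses[OF A(1), of Y] True by auto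
    qed
    then have "?A \<inter> (set p \<union> (Y \<union> nb E Y)) = {}" using True p(3) by auto
    moreover have "?B \<subseteq> set p \<union> (Y \<union> nb E Y)" using L'(1) by (auto dest: in_set_takeD in_set_dropD)
    ultimately have "?A \<inter> ?B = {}" by blast
    moreover have "?B \<subseteq> V"
      using L'(1) p(2) Y(2) nb_subset[OF G, of Y] by (auto dest: in_set_takeD in_set_dropD)
    moreover have "conn E ?B" by (rule reroute_path_conn[OF q(1) il(1,2) L'(4,2,3)])
    moreover have "b1 \<in> ?B" using q(3) il by (cases p) auto
    moreover have "b2 \<in> ?B" using q(4) il by (metis UnI2 drop_eq_Nil2 last_drop last_in_set not_le)
    ultimately have "linked E V R b1 b2 ?A ?B" unfolding linked_def using A by auto
    then show ?thesis by (rule critical)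
  qed
  then show thesis using that[OF il k] by blast
qed

lemma rigid_meets: 
  assumes "rigid E Y" "Y \<subseteq> V - S" "card (nb E Y) \<le> card R + 2"
  shows "U \<inter> Y \<noteq> {}"
  using no_rigid[of Y] assms by auto

text \<open>Such a vertex of \<open>U\<close> must be on the local path side, which consists of the
  two contacts and vertices of \<open>Y\<close>, the other neighbours being on the root
  side.\<close>

lemma rigid_between:
  assumes Y: "rigid E Y" "Y \<subseteq> V - S" "card (nb E Y) \<le> card R + 2"
  obtains i k l where "i < k" "k < l" "l < length p" "p ! i \<in> nb E Y" "p ! l \<in> nb E Y" "p ! k \<in> U"
    "\<And>k. i < k \<Longrightarrow> k < l \<Longrightarrow> p ! k \<in> U \<Longrightarrow> p ! k \<in> Y"
    "\<And>k. k < length p \<Longrightarrow> p ! k \<in> nb E Y \<Longrightarrow> i \<le> k \<and> k \<le> l"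
proof -
  note q = induced_pathD[OF p(1)]
  obtain i l where il: "i < l" "l < length p" "p ! i \<in> nb E Y" "p ! l \<in> nb E Y"
    and k: "\<And>k. k < length p \<Longrightarrow> p ! k \<in> Y \<Longrightarrow> i < k \<and> k < l"
      "\<And>k. k < length p \<Longrightarrow> p ! k \<in> nb E Y \<Longrightarrow> i \<le> k \<and> k \<le> l"
    and L: "\<And>A0 B0. linked E (Y \<union> nb E Y) (nb E Y - {p ! i, p ! l}) (p ! i) (p ! l) A0 B0 \<Longrightarrow>
       U \<subseteq> set (take (Suc i) p) \<union> B0 \<union> set (drop l p)"
    using rigid_reroute[OF Y(1,2) rigid_meets[OF Y]] by blast
  have "p ! i \<noteq> p ! l" using il(1,2) q(2) by (simp add: nth_eq_iff_index_eq)
  then obtain A0 B0 where AB: "linked E (Y \<union> nb E Y) (nb E Y - {p ! i, p ! l}) (p ! i) (p ! l) A0 B0"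
    using rigidD[OF Y(1) il(3,4)] by metis
  have btw: "p ! k \<in> Y" if k: "i < k" "k < l" "p ! k \<in> U" for k
  proof -
    have kl: "k < length p" using k il by simp
    have "p ! k \<notin> set (take (Suc i) p)" "p ! k \<notin> set (drop l p)"
      using nth_take_drop_index[OF q(2) kl] k by (meson not_le)+
    then have "p ! k \<in> B0" using L[OF AB] k(3) by auto
    moreover have "p ! k \<noteq> p ! i" "p ! k \<noteq> p ! l" using k il kl q(2) by (simp_all add: nth_eq_iff_index_eq)
    ultimately show ?thesis using AB unfolding linked_def by auto
  qed
  obtain x where x: "x \<in> U" "x \<in> Y" using rigid_meets[OF Y] by auto
  then have "x \<in> set p" using U_path by auto
  then obtain j where j: "j < length p" "x = p ! j" by (auto simp: in_set_conv_nth)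
  have ij: "i < j" "j < l" using k(1)[of j] j x by auto
  show thesis by (rule that[OF ij il(2-4) _ btw k(2)]) (use x j in auto)
qed

text \<open>With the two contacts as ends, the instance on \<open>Y \<union> nb E Y\<close> is
  critical for \<open>Y \<inter> U\<close>, by \<open>rigid_reroute\<close>. Its
  \<open>card (nb E Y) - 2\<close> roots produce the coefficient
  \<open>card (nb E Y)\<close>.\<close>

lemma rigid_bound:
  assumes Y: "rigid E Y" "Y \<subseteq> V - S" "card (nb E Y) \<le> card R + 2" and ne: "Y \<union> nb E Y \<noteq> V"
  shows "er E Y {} + card (Y \<inter> U) \<le> card (nb E Y) * card Y + 1"
proof -
  note q = induced_pathD[OF p(1)]
  obtain i l where il: "i < l" "l < length p" "p ! i \<in> nb E Y" "p ! l \<in> nb E Y"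
    and k: "\<And>k. k < length p \<Longrightarrow> p ! k \<in> Y \<Longrightarrow> i < k \<and> k < l"
      "\<And>k. k < length p \<Longrightarrow> p ! k \<in> nb E Y \<Longrightarrow> i \<le> k \<and> k \<le> l"
    and L: "\<And>A0 B0. linked E (Y \<union> nb E Y) (nb E Y - {p ! i, p ! l}) (p ! i) (p ! l) A0 B0 \<Longrightarrow>
       U \<subseteq> set (take (Suc i) p) \<union> B0 \<union> set (drop l p)"
    using rigid_reroute[OF Y(1,2) rigid_meets[OF Y]] by blast
  have st: "p ! i \<noteq> p ! l" using il(1,2) q(2) by (simp add: nth_eq_iff_index_eq)
  let ?s = "p ! i" and ?t = "p ! l"
  let ?V = "Y \<union> nb E Y" and ?P = "nb E Y - {?s, ?t}"
  let ?E = "{e \<in> E. e \<subseteq> ?V}"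
  have YV: "Y \<subseteq> V" using Y(2) by auto
  note c = card_nb_minus2[OF G il(3,4) st] and W = nonterminals_nb[OF il(3,4)]
  have "?V \<subset> V" using ne YV nb_subset[OF G, of Y] by auto
  then have "card ?V < card V" by (rule psubset_card_mono[OF fin(1)])
  then have cb: "critical_bound ?V ?E ?P ?s ?t (Y \<inter> U)" by (rule IH)
  have 1: "inst ?V ?E ?P ?s ?t" by (rule inst_nb[OF G il(3,4) st YV])
  have "feas E ?V ?P ?s ?t" using Y(1) il(3,4) st unfolding rigid_def by blast
  then have 2: "feas ?E ?V ?P ?s ?t" using feas_restrict[of ?V ?V E] by blast
  have 3: "Y \<inter> U \<subseteq> B0" if L0: "linked ?E ?V ?P ?s ?t A0 B0" for A0 B0
  proof
    fix x assume x: "x \<in> Y \<inter> U"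
    have "linked E ?V ?P ?s ?t A0 B0" using L0 conn_mono[of ?E _ E] unfolding linked_def by auto
    then have "U \<subseteq> set (take (Suc i) p) \<union> B0 \<union> set (drop l p)" by (rule L)
    moreover have "x \<in> set p" using x U_path by auto
    then obtain j where j: "j < length p" "x = p ! j" by (auto simp: in_set_conv_nth)
    then have "i < j" "j < l" using k(1)[of j] x by auto
    then have "x \<notin> set (take (Suc i) p)" "x \<notin> set (drop l p)"
      using nth_take_drop_index[OF q(2) j(1)] j(2) by (meson not_le)+
    ultimately show "x \<in> B0" using x by auto
  qed
  have 4: "\<not> rigid ?E Z" if Z: "Z \<subseteq> Y - Y \<inter> U" "card (nb ?E Z) \<le> card ?P + 2" for Z
  proof -
    have ZY: "Z \<subseteq> Y" using Z(1) by auto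
    have "card (nb E Z) \<le> card R + 2" using Z(2) c Y(3) nb_restrict[OF ZY, of E] by simp
    then have "\<not> rigid E Z" using no_rigid[of Z] Z(1) Y(2) by auto
    then show ?thesis using rigid_restrict[OF ZY] by blast
  qed
  have 5: "Y \<inter> U \<noteq> {}" using rigid_meets[OF Y] by auto
  have "er ?E Y {} + card (Y \<inter> U) \<le> (card ?P + 2) * card Y + 1"
    using cb 1 2 3 4 5 unfolding critical_bound_def W by auto
  then show ?thesis using er_restrict[OF G subset_refl, of Y "{}"] c by simp
qed

lemma nb_ne:
  assumes "Y \<subseteq> V - S" "card (nb E Y) \<le> card R + 1"
  shows "Y \<union> nb E Y \<noteq> V"
proof
  assume "Y \<union> nb E Y = V"
  then have "S \<subseteq> nb E Y" using assms(1) RV by auto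
  then have "card S \<le> card (nb E Y)" by (rule card_mono[OF nb_finite[OF G]])
  then show False using assms(2) card_S by simp
qed

text \<open>In the rigid case a vertex of \<open>Y \<inter> U\<close> repays the surplus 1. In the
  other case the rest \<open>Y - D\<close> has coefficient at most \<open>card R\<close>, and any of
  its vertices repays it.\<close>

lemma small_sets:
  assumes "Y \<subseteq> V - S" "conn E Y" "Y \<noteq> {}" "card (nb E Y) \<le> card R + 1"
  shows "er E Y {} \<le> (card R + 1) * card Y"
  using assms
proof (induction "card Y" arbitrary: Y rule: less_induct)
  case (less Y)
  have finY: "finite Y" using less.prems(1) fin(1) finite_subset by auto
  show ?case
  proof (cases "rigid E Y")
    case True
    have "er E Y {} + card (Y \<inter> U) \<le> card (nb E Y) * card Y + 1"
      by (rule rigid_bound[OF True less.prems(1) _ nb_ne[OF less.prems(1,4)]]) (use less.prems(4) in simp)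
    moreover have "1 \<le> card (Y \<inter> U)"
      using rigid_meets[OF True less.prems(1)] less.prems(4) finY by (intro card_ge_1) auto
    moreover have "card (nb E Y) * card Y \<le> (card R + 1) * card Y" using less.prems(4) by (rule mult_le_mono1)
    ultimately show ?thesis by linarith
  next
    case False
    have YV: "Y \<subseteq> V" using less.prems(1) by auto
    obtain D where D: "D \<subset> Y" "\<And>K. K \<in> comps E D \<Longrightarrow> card (nb E K) < card (nb E Y)"
      "er E (Y - D) D \<le> (card (nb E Y) - 1) * card (Y - D) + 1"
      using nonrigid_decomposition[OF G YV less.prems(2,3) False] by metis
    have finD: "finite D" using D(1) finY finite_subset by auto
    have DY: "D \<subseteq> Y" using D(1) by auto
    have "er E D {} \<le> (card R + 1) * card D + card (D \<inter> {})"
    proof (rule comps_er_le[OF finD fin(2,4)])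
      fix K assume K: "K \<in> comps E D"
      note k = compsD[OF K]
      have "card K < card Y" using k(1) D(1) by (intro psubset_card_mono[OF finY]) auto
      then have "er E K {} \<le> (card R + 1) * card K"
        using less.hyps[of K] k(1-3) D(2)[OF K] less.prems(1,4) DY by auto
      then show "er E K {} \<le> (card R + 1) * card K + card (K \<inter> {})" by simp
    qed
    moreover have "er E Y {} = er E D {} + er E (Y - D) D" by (rule er_split[OF fin(2) DY])
    moreover have cY: "card Y = card D + card (Y - D)"
      using DY finY finD by (simp add: card_Diff_subset card_mono)
    moreover have "card R * card Y = card R * card D + card R * card (Y - D)"
      unfolding cY by (rule add_mult_distrib2)
    moreover have "card (D \<inter> {}) = 0" by simp
    moreover have "1 \<le> card (Y - D)" using D(1) finY by (intro card_ge_1) auto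
    moreover have "(card (nb E Y) - 1) * card (Y - D) \<le> card R * card (Y - D)"
      using less.prems(4) by (intro mult_le_mono1) simp
    ultimately show ?thesis using D(3) unfolding add_mult_distrib by linarith
  qed
qed

text \<open>With one more neighbour than in \<open>small_sets\<close>, the rest \<open>Y - D\<close>
  may use the full coefficient, so the surplus 1 stays.\<close>

lemma nonrigid_bound:
  assumes Y: "Y \<subseteq> V - S" "conn E Y" "Y \<noteq> {}" "card (nb E Y) \<le> card R + 2" "\<not> rigid E Y"
  shows "er E Y {} \<le> (card R + 1) * card Y + 1"
proof -
  have YV: "Y \<subseteq> V" using Y(1) by auto
  have finY: "finite Y" using YV fin(1) finite_subset by auto
  obtain D where D: "D \<subset> Y" "\<And>K. K \<in> comps E D \<Longrightarrow> card (nb E K) < card (nb E Y)"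
    "er E (Y - D) D \<le> (card (nb E Y) - 1) * card (Y - D) + 1"
    using nonrigid_decomposition[OF G YV Y(2,3,5)] by metis
  have DY: "D \<subseteq> Y" using D(1) by auto
  have finD: "finite D" using DY finY finite_subset by auto
  have "er E D {} \<le> (card R + 1) * card D + card (D \<inter> {})"
  proof (rule comps_er_le[OF finD fin(2,4)])
    fix K assume K: "K \<in> comps E D"
    note k = compsD[OF K]
    have "er E K {} \<le> (card R + 1) * card K"
      using small_sets[of K] k(1-3) D(2)[OF K] Y(1,4) DY by auto
    then show "er E K {} \<le> (card R + 1) * card K + card (K \<inter> {})" by simp
  qed
  moreover have "er E Y {} = er E D {} + er E (Y - D) D" by (rule er_split[OF fin(2) DY])
  moreover have cY: "card Y = card D + card (Y - D)"
    using DY finY finD by (simp add: card_Diff_subset card_mono)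
  moreover have "card R * card Y = card R * card D + card R * card (Y - D)"
    unfolding cY by (rule add_mult_distrib2)
  moreover have "card (D \<inter> {}) = 0" by simp
  moreover have "(card (nb E Y) - 1) * card (Y - D) \<le> (card R + 1) * card (Y - D)"
    using Y(4) by (intro mult_le_mono1) simp
  ultimately show ?thesis using D(3) unfolding add_mult_distrib by linarith
qed

end

section \<open>Counting around vertices of the critical set\<close>

context critical_path
begin

lemma path_nb: "{p ! i, p ! k} \<in> E \<Longrightarrow> i < length p \<Longrightarrow> k < length p \<Longrightarrow> k = i - 1 \<and> 0 < i \<or> k = Suc i"
  using induced_pathD(8)[OF p(1), of i k] induced_pathD(8)[OF p(1), of k i] graph_edge[OF G, of "p ! i" "p ! k"]
  by (cases i k rule: linorder_cases) (auto simp: insert_commute)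

lemma interior_in_U:
  assumes "0 < i" "i < length p - 1" "p ! i \<in> U \<union> {b1, b2}"
  shows "p ! i \<in> U"
  using induced_path_interior[OF p(1) assms(1,2)] assms(3) by auto

text \<open>\<open>T\<close> consists of the vertices of \<open>U \<union> {b1, b2}\<close> that precede and follow \<open>u\<close> on \<open>p\<close>. A rigid set
  next to \<open>u\<close> contains one of them because rerouting \<open>p\<close> through it may not skip a vertex of \<open>U\<close>.\<close>

lemma exit_set:
  assumes u: "u \<in> U"
  obtains T where "finite T" "card T \<le> 2" "\<And>x. x \<in> U \<union> {b1, b2} \<Longrightarrow> {u, x} \<in> E \<Longrightarrow> x \<in> T"
    "\<And>K. rigid E K \<Longrightarrow> K \<subseteq> V - S \<Longrightarrow> card (nb E K) \<le> card R + 2 \<Longrightarrow> u \<in> nb E K \<Longrightarrow> K \<inter> T \<noteq> {}"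
proof -
  note q = induced_pathD[OF p(1)]
  let ?Q = "U \<union> {b1, b2}" and ?N = "length p - 1"
  have "u \<in> set p" "u \<noteq> b1" "u \<noteq> b2" using u U U_path by auto
  then obtain i0 where i0: "u = p ! i0" "0 < i0" "i0 < ?N" using induced_path_index[OF p(1)] by metis
  let ?I = "{k. i0 < k \<and> k < length p \<and> p ! k \<in> ?Q}" and ?J = "{k. k < i0 \<and> p ! k \<in> ?Q}"
  have "?N \<in> ?I" "0 \<in> ?J" using i0 q(6,7) by auto
  then have ne: "?I \<noteq> {}" "?J \<noteq> {}" by blast+
  define n m where "n = Min ?I" and "m = Max ?J"
  have fin': "finite ?I" "finite ?J" by auto
  have n: "n \<in> ?I" and m: "m \<in> ?J" unfolding n_def m_def using Min_in[OF fin'(1) ne(1)] Max_in[OF fin'(2) ne(2)] by auto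
  have n_le: "n \<le> k" if "k \<in> ?I" for k unfolding n_def using Min_le[OF fin'(1) that] .
  have m_ge: "k \<le> m" if "k \<in> ?J" for k unfolding m_def using Max_ge[OF fin'(2) that] .
  show thesis
  proof (rule that[of "{p ! n, p ! m}"])
    show "card {p ! n, p ! m} \<le> 2" by (simp add: card_insert_if)
    fix x assume x: "x \<in> ?Q" "{u, x} \<in> E"
    then have "x \<in> set p" using U_path ends by auto
    then obtain k where k: "k < length p" "x = p ! k" by (auto simp: in_set_conv_nth)
    then have "k = i0 - 1 \<and> 0 < i0 \<or> k = Suc i0" using path_nb[of i0 k] x(2) i0 by auto
    then show "x \<in> {p ! n, p ! m}"
    proof (elim disjE conjE)
      assume e: "k = i0 - 1" "0 < i0"
      then have "k \<le> m" using m_ge[of k] k x(1) by auto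
      then have "k = m" using m e by auto
      then show ?thesis using k by simp
    next
      assume e: "k = Suc i0"
      then have "n \<le> k" using n_le[of k] k x(1) by auto
      then have "k = n" using n e by auto
      then show ?thesis using k by simp
    qed
  next
    fix K assume K: "rigid E K" "K \<subseteq> V - S" "card (nb E K) \<le> card R + 2" "u \<in> nb E K"
    obtain i k l where ikl: "i < k" "k < l" "l < length p" "p ! i \<in> nb E K" "p ! l \<in> nb E K" "p ! k \<in> U"
      and btw: "\<And>k. i < k \<Longrightarrow> k < l \<Longrightarrow> p ! k \<in> U \<Longrightarrow> p ! k \<in> K"
      and rng: "\<And>k. k < length p \<Longrightarrow> p ! k \<in> nb E K \<Longrightarrow> i \<le> k \<and> k \<le> l"
      using rigid_between[OF K(1-3)] by blast
    have "i \<le> i0" "i0 \<le> l" using rng[of i0] i0 K(4) by auto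
    moreover have "\<not> (i < i0 \<and> i0 < l)"
      using btw[of i0] u i0(1) nbD[OF K(4)] by auto
    ultimately consider "i = i0" | "l = i0" by linarith
    then have "p ! n \<in> K \<or> p ! m \<in> K"
    proof cases
      case 1
      then have "k \<in> ?I" using ikl by auto
      then have nl: "i < n" "n < l" using n_le[of k] n 1 ikl by auto
      then have "p ! n \<in> U" using interior_in_U[of n] n ikl(3) by auto
      then show ?thesis using btw[OF nl] by blast
    next
      case 2
      then have "k \<in> ?J" using ikl by auto
      then have ml: "i < m" "m < l" using m_ge[of k] m 2 ikl by auto
      then have "p ! m \<in> U" using interior_in_U[of m] m ikl(3) by auto
      then show ?thesis using btw[OF ml] by blast
    qed
    then show "K \<inter> {p ! n, p ! m} \<noteq> {}" by blast
  qed simp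
qed

text \<open>The budget for \<open>u\<close> is \<open>card R + 2\<close> plus the 1 allowed in the
  bound. Against it stand 1 from the infeasible rest, 1 for \<open>u\<close> in
  \<open>card U\<close>, at most \<open>card R - 1\<close> root neighbours of \<open>u\<close>, and
  at most 2 charges to \<open>T\<close>. The count closes exactly because \<open>r\<close> is
  missed.\<close>

lemma nonadjacent_bound:
  assumes u: "u \<in> U" and r: "r \<in> R" "{u, r} \<notin> E"
  shows "er E (V - S) {} + card U \<le> (card R + 2) * card (V - S) + 1"
proof -
  let ?E = "{e \<in> E. u \<notin> e}" and ?V = "V - {u}" and ?N = "{w. {u, w} \<in> E}"
  obtain T where T: "finite T" "card T \<le> 2" "\<And>x. x \<in> U \<union> {b1, b2} \<Longrightarrow> {u, x} \<in> E \<Longrightarrow> x \<in> T"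
    "\<And>K. rigid E K \<Longrightarrow> K \<subseteq> V - S \<Longrightarrow> card (nb E K) \<le> card R + 2 \<Longrightarrow> u \<in> nb E K \<Longrightarrow> K \<inter> T \<noteq> {}"
    using exit_set[OF u] by blast
  have uV: "u \<in> V - S" using u U by auto
  have i: "inst ?V ?E R b1 b2" using graph_delete[OF G] RV uV unfolding inst_def by auto
  have nf: "\<not> feas ?E ?V R b1 b2"
  proof
    assume "feas ?E ?V R b1 b2"
    then have "feas E ?V R b1 b2" using feas_delete[of u ?V E] by auto
    then obtain A B where "linked E ?V R b1 b2 A B" unfolding feas_def by blast
    then have "linked E V R b1 b2 A B" "B \<subseteq> ?V" unfolding linked_def by auto
    then show False using critical[of A B] u by auto
  qed
  obtain D where D: "D \<subseteq> ?V - S" "\<forall>K\<in>comps ?E D. card (nb ?E K) \<le> card R + 1"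
    "sparse ?E (?V - S - D) D R b1 b2"
    using infeasible_decomposition[OF reduced_bound i nf] by blast
  let ?W = "?V - S - D"
  have DV: "D \<subseteq> V - S" "u \<notin> D" using D(1) by auto
  have finD: "finite D" using DV(1) fin(1) finite_subset by auto
  have e1: "er E D {} + card (D \<inter> U) \<le> (card R + 2) * card D + card (D \<inter> T)"
  proof (rule comps_er_Int_le[OF finD fin(2,4)])
    fix K assume K: "K \<in> comps E D"
    note c = compsD[OF K]
    have KV: "K \<subseteq> V - S" "u \<notin> K" using c(1) DV by auto
    have finK: "finite K" using c(1) finD finite_subset by auto
    have "conn ?E K" using c(3) conn_delete[OF KV(2)] by auto
    then have "K \<in> comps ?E D" using K unfolding comps_def by auto
    then have le: "card (nb ?E K) \<le> card R + 1" using D(2) by auto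
    have sub: "nb E K - {u} \<subseteq> nb ?E K" using KV(2) unfolding nb_def by auto
    have fnb: "finite (nb ?E K)" using nb_finite[OF graph_delete[OF G]] by auto
    have c1: "card (nb E K - {u}) \<le> card R + 1" using card_mono[OF fnb sub] le by linarith
    have KU: "card (K \<inter> U) \<le> card K" using finK by (intro card_mono) auto
    have m: "(card R + 2) * card K = (card R + 1) * card K + card K" by simp
    show "er E K {} + card (K \<inter> U) \<le> (card R + 2) * card K + card (K \<inter> T)"
    proof (cases "card (nb E K) \<le> card R + 1")
      case True
      then show ?thesis using small_sets[OF KV(1) c(3,2) True] KU m by linarith
    next
      case False
      have uK: "u \<in> nb E K" using c1 False by (cases "u \<in> nb E K") auto
      have cK: "card (nb E K) = card R + 2"
        using False c1 card_Suc_Diff1[OF nb_finite[OF G] uK] by linarith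
      then have cK': "card (nb E K) \<le> card R + 2" by simp
      show ?thesis
      proof (cases "rigid E K")
        case True
        have "K \<union> nb E K \<noteq> V"
        proof
          assume "K \<union> nb E K = V"
          then have "insert u S \<subseteq> nb E K" using KV(1) RV uK by auto
          then have "card (insert u S) \<le> card (nb E K)" by (rule card_mono[OF nb_finite[OF G]])
          then show False using cK card_S uV fin(3) by simp
        qed
        then have "er E K {} + card (K \<inter> U) \<le> (card R + 2) * card K + 1"
          using rigid_bound[OF True KV(1) cK'] unfolding cK by blast
        moreover have "1 \<le> card (K \<inter> T)" using T(4)[OF True KV(1) cK' uK] finK by (intro card_ge_1) auto
        ultimately show ?thesis by linarith
      next
        case nr: False
        note nb = nonrigid_bound[OF KV(1) c(3,2) cK' nr]
        show ?thesis
        \<comment> \<open>If \<open>K\<close> lies in \<open>U\<close>, a neighbour of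
          \<open>u\<close> in \<open>K\<close> belongs to \<open>T\<close> and takes the charge;
          otherwise a vertex of \<open>K\<close> off \<open>U\<close> leaves one unit free.\<close>
        proof (cases "K \<subseteq> U")
          case True
          obtain x where x: "x \<in> K" "{x, u} \<in> E" using nbD[OF uK] by auto
          then have "{u, x} \<in> E" by (simp add: insert_commute)
          then have "x \<in> K \<inter> T" using T(3)[of x] x(1) True by auto
          then have "1 \<le> card (K \<inter> T)" using finK by (intro card_ge_1) auto
          then show ?thesis using nb KU m by linarith
        next
          case False
          then have "K \<inter> U \<subset> K" by blast
          then have "card (K \<inter> U) < card K" using finK by (intro psubset_card_mono) auto
          then show ?thesis using nb m by linarith
        qed
      qed
    qed
  qed
  have e2: "er E (V - S) {} = er E D {} + er E (V - S - D) D" by (rule er_split[OF fin(2) DV(1)])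
  have WU: "V - S - D = insert u ?W" using uV DV(2) by auto
  have e3: "er E (insert u ?W) D \<le> er ?E ?W D + (card (?W \<inter> ?N) + card (S \<inter> ?N))"
  proof -
    let ?F = "{e \<in> ?E. e \<inter> ?W \<noteq> {} \<and> e \<inter> D = {}}" and ?M = "?W \<inter> ?N \<union> S \<inter> ?N"
    have "{e \<in> E. e \<inter> insert u ?W \<noteq> {} \<and> e \<inter> D = {}} \<subseteq> ?F \<union> (\<lambda>w. {u, w}) ` ?M"
    proof
      fix e assume e: "e \<in> {e \<in> E. e \<inter> insert u ?W \<noteq> {} \<and> e \<inter> D = {}}"
      show "e \<in> ?F \<union> (\<lambda>w. {u, w}) ` ?M"
      proof (cases "u \<in> e")
        case True
        then have "e \<in> E" using e by simp
        then obtain w where w: "e = {u, w}" "u \<noteq> w" using graph_edge_at[OF G _ True] by metis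
        then have "w \<in> V" using graph_edge[OF G, of u w] e by auto
        then have "w \<in> ?M" using w e by auto
        then show ?thesis using w by blast
      qed (use e in auto)
    qed
    moreover have fs: "finite ?F" "finite ?M" using fin by auto
    ultimately have "er E (insert u ?W) D \<le> card (?F \<union> (\<lambda>w. {u, w}) ` ?M)"
      unfolding er_def by (intro card_mono) auto
    also have "\<dots> \<le> card ?F + card ((\<lambda>w. {u, w}) ` ?M)" by (rule card_Un_le)
    also have "\<dots> \<le> card ?F + card ?M" using card_image_le[OF fs(2)] by simp
    also have "\<dots> \<le> card ?F + (card (?W \<inter> ?N) + card (S \<inter> ?N))" using card_Un_le by simp
    finally show ?thesis unfolding er_def .
  qed
  have e4: "er ?E ?W D \<le> (card R + 1) * card ?W + 1" using D(3) unfolding sparse_def by blast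
  have e5: "card (S \<inter> ?N) + 1 \<le> card R + card ({b1, b2} \<inter> T)"
  proof -
    have "S \<inter> ?N \<subseteq> (R - {r}) \<union> {b1, b2} \<inter> T" using r(2) T(3) by auto
    then have "card (S \<inter> ?N) \<le> card ((R - {r}) \<union> {b1, b2} \<inter> T)" using fin(3) by (intro card_mono) auto
    also have "\<dots> \<le> card (R - {r}) + card ({b1, b2} \<inter> T)" by (rule card_Un_le)
    finally show ?thesis using card_Suc_Diff1[OF fin(3) r(1)] by linarith
  qed
  have finW: "finite ?W" using fin(1) by simp
  \<comment> \<open>A neighbour of \<open>u\<close> costs its edge to \<open>u\<close>, a vertex of
    \<open>U\<close> costs one in \<open>card U\<close>. Only a vertex of both kinds exceeds its
    spare unit, and it lies in \<open>T\<close>.\<close>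
  have e6: "card (?W \<inter> ?N) + card (?W \<inter> U) \<le> card ?W + card (?W \<inter> T)"
  proof -
    have "card (?W \<inter> ?N) + card (?W \<inter> U) =
        card (?W \<inter> ?N \<union> ?W \<inter> U) + card (?W \<inter> ?N \<inter> (?W \<inter> U))"
      by (rule card_Un_Int) (use finW in auto)
    moreover have "card (?W \<inter> ?N \<union> ?W \<inter> U) \<le> card ?W" using finW by (intro card_mono) auto
    moreover have "card (?W \<inter> ?N \<inter> (?W \<inter> U)) \<le> card (?W \<inter> T)"
      using finW T(3) by (intro card_mono) auto
    ultimately show ?thesis by linarith
  qed
  have e7: "card U = card (D \<inter> U) + card (?W \<inter> U) + 1"
  proof -
    have "U = insert u (D \<inter> U \<union> ?W \<inter> U)" using u U by auto
    then have "card U = card (insert u (D \<inter> U \<union> ?W \<inter> U))" by simp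
    also have "\<dots> = Suc (card (D \<inter> U \<union> ?W \<inter> U))"
      using finD finW DV(2) by (intro card_insert_disjoint) auto
    also have "card (D \<inter> U \<union> ?W \<inter> U) = card (D \<inter> U) + card (?W \<inter> U)"
      by (rule card_Un_disjoint) (use finD finW in auto)
    finally show ?thesis by simp
  qed
  \<comment> \<open>The three kinds of charges fall on disjoint parts of \<open>T\<close>.\<close>
  have e8: "card (D \<inter> T) + card (?W \<inter> T) + card ({b1, b2} \<inter> T) \<le> 2"
  proof -
    have "card (D \<inter> T) + card (?W \<inter> T) = card (D \<inter> T \<union> ?W \<inter> T)"
      by (rule card_Un_disjoint[symmetric]) (use T(1) in auto)
    moreover have "card (D \<inter> T \<union> ?W \<inter> T) + card ({b1, b2} \<inter> T) = card (D \<inter> T \<union> ?W \<inter> T \<union> {b1, b2} \<inter> T)"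
      by (rule card_Un_disjoint[symmetric]) (use T(1) DV(1) in auto)
    moreover have "card (D \<inter> T \<union> ?W \<inter> T \<union> {b1, b2} \<inter> T) \<le> card T" using T(1) by (intro card_mono) auto
    ultimately show ?thesis using T(2) by linarith
  qed
  have cV: "card (V - S) = card D + card ?W + 1"
  proof -
    have "card (V - S) = card D + card (V - S - D)"
      using DV(1) fin(1) finD by (simp add: card_Diff_subset card_mono)
    then show ?thesis unfolding WU using fin(1) by simp
  qed
  have "(card R + 2) * card (V - S) = (card R + 2) * card D + ((card R + 1) * card ?W + card ?W) + (card R + 2)"
    unfolding cV by (simp add: algebra_simps)
  then show ?thesis using e1 e2 e3 e4 e5 e6 e7 e8 unfolding WU by linarith
qed

text \<open>Each vertex of \<open>U\<close> can be the centre of a star on \<open>R\<close>, so a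
  component off \<open>U\<close> sees at most two vertices of \<open>U \<union> {b1, b2}\<close>.
  Having at most \<open>card R + 2\<close> neighbours, it is not rigid, and its surplus fits into
  the coefficient.\<close>

lemma adjacent_bound:
  assumes star: "\<And>u r. u \<in> U \<Longrightarrow> r \<in> R \<Longrightarrow> {u, r} \<in> E"
  shows "er E (V - S) {} + card U \<le> (card R + 2) * card (V - S) + 1"
proof -
  let ?W = "V - S - U" and ?Q = "U \<union> {b1, b2}"
  note q = induced_pathD[OF p(1)]
  have finW: "finite ?W" using fin(1) by simp
  have "er E ?W {} \<le> (card R + 2) * card ?W + card (?W \<inter> {})"
  proof (rule comps_er_le[OF finW fin(2,4)])
    fix K assume K: "K \<in> comps E ?W"
    note c = compsD[OF K]
    have KS: "K \<subseteq> V - S" using c(1) by auto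
    let ?M = "nb E K \<inter> ?Q"
    have sub: "nb E K \<subseteq> R \<union> ?M" using nb_subset[OF G, of K] comps_nb[OF K] by auto
    have "card ?M \<le> 2"
    proof (rule card_nth_image_le_2)
      show "?M \<subseteq> set p" using ends U_path by auto
      fix i j l assume ij: "i < j" "j < l" "l < length p" and M: "p ! i \<in> ?M" "p ! j \<in> ?M" "p ! l \<in> ?M"
      have jU: "p ! j \<in> U" using interior_in_U[of j] ij M(2) by auto
      have nj: "p ! j \<notin> K" using M(2) nbD[of _ E K] by auto
      have "\<exists>B. linked E V R b1 b2 (insert (p ! j) R) B \<and> p ! j \<notin> B"
        by (rule star_bypass[OF q(1-4) _ _ ij c(3) _ _ nj star[OF jU]]) (use p(2,3) KS A(2) RV M in auto)
      then show False using critical jU by blast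
    qed
    moreover have "card (nb E K) \<le> card (R \<union> ?M)" using sub fin(3,5) by (intro card_mono) auto
    ultimately have cK: "card (nb E K) \<le> card R + 2" using card_Un_le[of R ?M] by linarith
    then have "\<not> rigid E K" using no_rigid[OF c(1)] by blast
    then have "er E K {} \<le> (card R + 1) * card K + 1" by (rule nonrigid_bound[OF KS c(3,2) cK])
    moreover have "1 \<le> card K" using card_ge_1[OF _ c(2)] finite_subset[OF c(1) finW] by blast
    ultimately show "er E K {} \<le> (card R + 2) * card K + card (K \<inter> {})" by simp
  qed
  then have e1: "er E ?W {} \<le> (card R + 2) * card ?W" by simp
  have e2: "er E (V - S) {} = er E ?W {} + er E (V - S - ?W) ?W" by (rule er_split[OF fin(2)]) auto
  have UW: "V - S - ?W = U" using U by auto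
  have e3: "er E U ?W \<le> card R * card U + (card U + 1)"
  proof -
    \<comment> \<open>Path edges are indexed by their earlier vertex, which is in \<open>U\<close>
      or equals \<open>b1\<close>; hence the bound \<open>card U + 1\<close>.\<close>
    let ?I = "{i. Suc i < length p \<and> p ! i \<in> insert b1 U}"
    let ?X = "(\<lambda>(x, r). {x, r}) ` (U \<times> R)" and ?Y = "(\<lambda>i. {p ! i, p ! Suc i}) ` ?I"
    have cons: "{p ! i, p ! j} \<in> ?Y"
      if ij: "i < j" "j < length p" "{p ! i, p ! j} \<in> E" "p ! i \<in> ?Q" for i j
    proof -
      have j: "j = Suc i" using q(8)[OF ij(1-3)] .
      have "p ! i \<noteq> p ! (length p - 1)" using ij(1,2) nth_eq_iff_index_eq[OF q(2), of i "length p - 1"] by auto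
      then have "p ! i \<noteq> b2" using q(7) by simp
      then have "i \<in> ?I" using ij j by auto
      then show ?thesis unfolding j by (rule imageI)
    qed
    have "{e \<in> E. e \<inter> U \<noteq> {} \<and> e \<inter> ?W = {}} \<subseteq> ?X \<union> ?Y"
    proof
      fix e assume e: "e \<in> {e \<in> E. e \<inter> U \<noteq> {} \<and> e \<inter> ?W = {}}"
      then have e': "e \<in> E" "e \<inter> U \<noteq> {}" by auto
      obtain x y where xy: "e = {x, y}" "x \<in> U" "x \<noteq> y" using graph_edge_meet[OF G e'] by metis
      have yV: "y \<in> V" "y \<notin> ?W" using graph_edge[OF G, of x y] e xy(1) by auto
      show "e \<in> ?X \<union> ?Y"
      proof (cases "y \<in> R")
        case True
        then show ?thesis using xy by auto
      next
        case False
        then have y: "y \<in> ?Q" using yV by auto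
        have "x \<in> set p" using xy(2) U_path by auto
        then obtain i where i: "i < length p" "x = p ! i" by (auto simp: in_set_conv_nth)
        have "y \<in> set p" using y ends U_path by auto
        then obtain j where j: "j < length p" "y = p ! j" by (auto simp: in_set_conv_nth)
        have ij: "{p ! i, p ! j} \<in> E" using e' xy(1) i j by simp
        have "i \<noteq> j" using i j xy(3) by auto
        then consider "i < j" | "j < i" by linarith
        then have "{p ! i, p ! j} \<in> ?Y"
        proof cases
          case 1
          show ?thesis by (rule cons[OF 1 j(1) ij]) (use xy(2) i in auto)
        next
          case 2
          have eq: "{p ! i, p ! j} = {p ! j, p ! i}" by (rule insert_commute)
          show ?thesis unfolding eq by (rule cons[OF 2 i(1) ij[unfolded eq]]) (use y j in auto)
        qed
        then show ?thesis unfolding xy(1) i(2) j(2) by blast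
      qed
    qed
    moreover have fI: "finite ?I" by (rule finite_subset[of _ "{..<length p}"]) auto
    ultimately have "er E U ?W \<le> card (?X \<union> ?Y)" unfolding er_def using fin(3,5) by (intro card_mono) auto
    also have "\<dots> \<le> card ?X + card ?Y" by (rule card_Un_le)
    also have "card ?X \<le> card R * card U"
      using card_image_le[of "U \<times> R" "\<lambda>(x, r). {x, r}"] fin(3,5) by (simp add: card_cartesian_product mult.commute)
    also have "card ?Y \<le> card ?I" by (rule card_image_le[OF fI])
    also have "card ?I \<le> card (insert b1 U)"
    proof (rule card_inj_on_le)
      show "inj_on ((!) p) ?I" using q(2) by (auto simp: inj_on_def nth_eq_iff_index_eq)
    qed (use fin(5) in auto)
    also have "\<dots> \<le> card U + 1" by (simp add: card_insert_le_m1 card_insert_if fin(5))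
    finally show ?thesis by simp
  qed
  have "card (V - S) = card ?W + card U"
    using U fin(1,5) card_mono[OF _ U] by (simp add: card_Diff_subset)
  then have "(card R + 2) * card (V - S) = (card R + 2) * card ?W + (card R * card U + 2 * card U)"
    by (simp add: algebra_simps)
  then show ?thesis using e1 e2 e3 unfolding UW by linarith
qed

lemma bound: "er E (V - S) {} + card U \<le> (card R + 2) * card (V - S) + 1"
  using nonadjacent_bound adjacent_bound by blast

end

theorem critical_bound: "critical_bound V E R s t U"
proof (induction "card V" arbitrary: V E R s t U rule: less_induct)
  case (less V E R s t U)
  have "er E (V - (R \<union> {s, t})) {} + card U \<le> (card R + 2) * card (V - (R \<union> {s, t})) + 1"
    if *: "inst V E R s t" "feas E V R s t" "U \<subseteq> V - (R \<union> {s, t})"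
      "\<forall>A B. linked E V R s t A B \<longrightarrow> U \<subseteq> B"
      "\<forall>Y\<subseteq>V - (R \<union> {s, t}) - U. card (nb E Y) \<le> card R + 2 \<longrightarrow> \<not> rigid E Y"
  proof -
    obtain A B where AB: "A \<subseteq> V" "B \<subseteq> V" "A \<inter> B = {}" "R \<subseteq> A" "s \<in> B" "t \<in> B" "conn E A" "conn E B"
      using *(2) unfolding feas_def linked_def by metis
    obtain p where p: "induced_path E s t p" "set p \<subseteq> B" using conn_induced_path[OF AB(8,5,6)] by metis
    interpret critical_path V E R s t U A p
    proof
      show "set p \<subseteq> V" "A \<inter> set p = {}" using p(2) AB by auto
    qed (use * p(1) AB less in auto)
    show ?thesis by (rule bound)
  qed
  then show ?case unfolding critical_bound_def by blast
qed

subsection \<open>The collection\<close>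

text \<open>The simultaneous form of \<open>quot\<close>, agreeing with the edges of
  \<open>quotient_graph\<close>. Successive replacements are compared with it by inclusion.\<close>

definition quot_edges :: "'a set set \<Rightarrow> 'a set set \<Rightarrow> 'a set set" where
  "quot_edges E \<X> = {e \<in> E. e \<inter> \<Union>\<X> = {}} \<union>
     {{u, v} |u v X. X \<in> \<X> \<and> u \<in> nb E X \<and> v \<in> nb E X \<and> u \<noteq> v}"

definition pairs :: "'a set \<Rightarrow> 'a set set" where
  "pairs S = {{u, v} |u v. u \<in> S \<and> v \<in> S \<and> u \<noteq> v}"

lemma pairs_eq: "pairs S = {e. e \<subseteq> S \<and> card e = 2}"
  unfolding pairs_def card_2_iff by blast

lemma pairs_finite: "finite S \<Longrightarrow> finite (pairs S)"
  unfolding pairs_eq by (rule finite_subset[of _ "Pow S"]) auto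

lemma card_pairs: "finite S \<Longrightarrow> card (pairs S) = card S choose 2"
  unfolding pairs_eq by (rule n_subsets)

lemma quot_edges_finite:
  assumes "graph V E"
  shows "finite (quot_edges E \<X>)"
proof (rule finite_subset)
  show "quot_edges E \<X> \<subseteq> E \<union> pairs V"
    using nb_subset[OF assms] unfolding quot_edges_def pairs_def by blast
  show "finite (E \<union> pairs V)" using graph_finite[OF assms] pairs_finite by auto
qed

lemma quot_edgesE:
  assumes "e \<in> quot_edges E \<X>"
  obtains "e \<in> E" "e \<inter> \<Union>\<X> = {}"
    | u v X where "e = {u, v}" "X \<in> \<X>" "u \<in> nb E X" "v \<in> nb E X" "u \<noteq> v"
  using assms unfolding quot_edges_def by blast

section \<open>Undoing one replacement in a collection\<close>

lemma nb_quot_away: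
  assumes "X \<inter> Y = {}" "X \<inter> nb E Y = {}"
  shows "nb E X \<subseteq> nb (quot E Y) X" "nb E X \<inter> Y = {}"
proof -
  have noY: "v \<notin> Y" if "x \<in> X" "{x, v} \<in> E" for x v
  proof
    assume "v \<in> Y"
    then have "x \<in> nb E Y" using nbI[of v Y x E] that assms(1) by (auto simp: insert_commute)
    then show False using assms(2) that(1) by auto
  qed
  show "nb E X \<inter> Y = {}"
  proof (rule ccontr)
    assume "nb E X \<inter> Y \<noteq> {}"
    then obtain v where "v \<in> nb E X" "v \<in> Y" by auto
    then show False using nbD[of v E X] noY by auto
  qed
  show "nb E X \<subseteq> nb (quot E Y) X"
  proof
    fix v assume "v \<in> nb E X"
    then obtain x where x: "x \<in> X" "{x, v} \<in> E" "v \<notin> X" using nbD[of v E X] by auto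
    have "{x, v} \<in> quot E Y" using x noY[OF x(1,2)] assms(1) quot_edge[of x v E Y] by auto
    then show "v \<in> nb (quot E Y) X" using x by (auto intro: nbI)
  qed
qed

lemma nb_quot_merge:
  assumes "X \<inter> Y = {}" "X \<inter> nb E Y \<noteq> {}"
  shows "nb E (X \<union> Y) \<subseteq> nb (quot E Y) X"
proof
  fix v assume "v \<in> nb E (X \<union> Y)"
  then obtain x where x: "x \<in> X \<union> Y" "{x, v} \<in> E" "v \<notin> X \<union> Y" using nbD[of v E "X \<union> Y"] by auto
  obtain z where z: "z \<in> X" "z \<in> nb E Y" using assms(2) by auto
  show "v \<in> nb (quot E Y) X"
  proof (cases "x \<in> Y")
    case True
    then have "v \<in> nb E Y" using x by (auto intro: nbI)
    then have "{z, v} \<in> quot E Y" using z x(3) quot_edge[of z v E Y] by auto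
    then show ?thesis using z(1) x(3) by (auto intro: nbI)
  next
    case False
    then have "{x, v} \<in> quot E Y" using x quot_edge[of x v E Y] by auto
    then show ?thesis using x False by (auto intro: nbI)
  qed
qed

text \<open>At most one member can meet \<open>nb E Y\<close>, since that set is a clique in the
  quotient and members are separated. Such a member absorbs \<open>Y\<close>; if there is none,
  \<open>Y\<close> becomes a member of its own. Either way no edge arises that the iterated quotient
  lacks.\<close>

lemma lift_collection:
  assumes \<X>: "\<And>X. X \<in> \<X> \<Longrightarrow> X \<subseteq> V - Y - T"
      "\<And>X1 X2. X1 \<in> \<X> \<Longrightarrow> X2 \<in> \<X> \<Longrightarrow> X1 \<noteq> X2 \<Longrightarrow> (nb (quot E Y) X1 \<union> X1) \<inter> X2 = {}"
      "\<And>X. X \<in> \<X> \<Longrightarrow> card (nb (quot E Y) X) \<le> k"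
    and G: "graph V E" and Y: "Y \<subseteq> V - T" "card (nb E Y) \<le> k"
  shows "\<exists>\<Y>. (\<forall>X\<in>\<Y>. X \<subseteq> V - T) \<and>
    (\<forall>X1\<in>\<Y>. \<forall>X2\<in>\<Y>. X1 \<noteq> X2 \<longrightarrow> (nb E X1 \<union> X1) \<inter> X2 = {}) \<and>
    (\<forall>X\<in>\<Y>. card (nb E X) \<le> k) \<and> \<Union>\<Y> = \<Union>\<X> \<union> Y \<and> quot_edges E \<Y> \<subseteq> quot_edges (quot E Y) \<X>"
proof -
  let ?F = "quot E Y"
  note fF = nb_finite[OF graph_quot[OF G]]
  have XY: "X \<inter> Y = {}" if "X \<in> \<X>" for X using \<X>(1)[OF that] by auto
  have kept: "e \<in> quot_edges ?F \<X>" if "e \<in> E" "e \<inter> (\<Union>\<X> \<union> Y) = {}" for e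
    using that unfolding quot_edges_def quot_def by auto
  have cl: "{u, v} \<in> quot_edges ?F \<X>" if "X \<in> \<X>" "u \<in> nb ?F X" "v \<in> nb ?F X" "u \<noteq> v" for u v X
    using that unfolding quot_edges_def by auto
  show ?thesis
  proof (cases "\<exists>X\<in>\<X>. X \<inter> nb E Y \<noteq> {}")
    case False
    have away: "nb E X \<subseteq> nb ?F X" "nb E X \<inter> Y = {}" "nb E Y \<inter> X = {}" if "X \<in> \<X>" for X
      using nb_quot_away[OF XY[OF that], of E] False that by auto
    have "card (nb E X) \<le> k" if "X \<in> insert Y \<X>" for X
      using that Y(2) card_mono[OF fF away(1)] \<X>(3) by (auto intro: order_trans)
    moreover have "(nb E X1 \<union> X1) \<inter> X2 = {}" if X12: "X1 \<in> insert Y \<X>" "X2 \<in> insert Y \<X>" "X1 \<noteq> X2" for X1 X2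
    proof -
      consider "X1 = Y" "X2 \<in> \<X>" | "X1 \<in> \<X>" "X2 = Y" | "X1 \<in> \<X>" "X2 \<in> \<X>" using X12 by auto
      then show ?thesis
      proof cases
        case 1
        then show ?thesis using away(3)[of X2] XY[of X2] by auto
      next
        case 2
        then show ?thesis using away(2)[of X1] XY[of X1] by auto
      next
        case 3
        then show ?thesis using away(1)[of X1] \<X>(2)[OF 3 X12(3)] by auto
      qed
    qed
    moreover have "quot_edges E (insert Y \<X>) \<subseteq> quot_edges ?F \<X>"
    proof
      fix e assume "e \<in> quot_edges E (insert Y \<X>)"
      then show "e \<in> quot_edges ?F \<X>"
      proof (cases rule: quot_edgesE)
        case 1
        then show ?thesis by (intro kept) auto
      next
        case (2 u v X)
        show ?thesis
        proof (cases "X = Y")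
          case True
          then have uv: "u \<in> nb E Y" "v \<in> nb E Y" using 2(3,4) by simp_all
          then have "e \<in> ?F" using quot_edge[of u v E Y] 2(1,5) by simp
          moreover have "e \<inter> \<Union>\<X> = {}" using uv 2(1) away(3) by blast
          ultimately show ?thesis unfolding quot_edges_def by blast
        next
          case False
          then have X: "X \<in> \<X>" using 2(2) by simp
          show ?thesis unfolding 2(1) by (rule cl[OF X subsetD[OF away(1)[OF X]] subsetD[OF away(1)[OF X]] 2(5)]) (rule 2)+
        qed
      qed
    qed
    moreover have "X \<subseteq> V - T" if "X \<in> insert Y \<X>" for X using that \<X>(1) Y(1) by auto
    ultimately show ?thesis by (intro exI[of _ "insert Y \<X>"]) auto
  next
    case True
    then obtain X0 where X0: "X0 \<in> \<X>" "X0 \<inter> nb E Y \<noteq> {}" by auto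
    then obtain z where z: "z \<in> X0" "z \<in> nb E Y" by auto
    let ?Z = "X0 \<union> Y"
    have mg: "nb E ?Z \<subseteq> nb ?F X0" by (rule nb_quot_merge[OF XY[OF X0(1)] X0(2)])
    have away: "nb E X \<subseteq> nb ?F X" "nb E X \<inter> Y = {}" if X: "X \<in> \<X> - {X0}" for X
    proof -
      have "X \<inter> nb E Y = {}"
      proof (rule ccontr)
        assume "X \<inter> nb E Y \<noteq> {}"
        then obtain x where x: "x \<in> X" "x \<in> nb E Y" by auto
        have sep: "(nb ?F X0 \<union> X0) \<inter> X = {}" using \<X>(2)[of X0 X] X X0(1) by auto
        then have "x \<noteq> z" "x \<notin> X0" using x z by auto
        then have "{z, x} \<in> ?F" using x(2) z(2) quot_edge[of z x E Y] by auto
        then have "x \<in> nb ?F X0" using z(1) \<open>x \<notin> X0\<close> by (auto intro: nbI)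
        then show False using sep x(1) by auto
      qed
      then show "nb E X \<subseteq> nb ?F X" "nb E X \<inter> Y = {}" using nb_quot_away[of X Y E] XY[of X] X by auto
    qed
    let ?Y = "insert ?Z (\<X> - {X0})"
    have f3: "card (nb E X) \<le> k" if "X \<in> ?Y" for X
    proof (cases "X = ?Z")
      case True
      then show ?thesis using card_mono[OF fF mg] \<X>(3)[OF X0(1)] by simp
    next
      case False
      then have X: "X \<in> \<X> - {X0}" using that by auto
      then show ?thesis using card_mono[OF fF away(1)[OF X]] \<X>(3)[of X] by auto
    qed
    have f2: "(nb E X1 \<union> X1) \<inter> X2 = {}" if X12: "X1 \<in> ?Y" "X2 \<in> ?Y" "X1 \<noteq> X2" for X1 X2
    proof -
      consider "X1 = ?Z" "X2 \<in> \<X> - {X0}" | "X1 \<in> \<X> - {X0}" "X2 = ?Z" | "X1 \<in> \<X> - {X0}" "X2 \<in> \<X> - {X0}"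
        using X12 by blast
      then show ?thesis
      proof cases
        case 1
        then have "(nb ?F X0 \<union> X0) \<inter> X2 = {}" using \<X>(2)[of X0 X2] X0(1) by auto
        then show ?thesis using mg 1 XY[of X2] by auto
      next
        case 2
        then have "(nb ?F X1 \<union> X1) \<inter> X0 = {}" using \<X>(2)[of X1 X0] X0(1) by auto
        then show ?thesis using away[OF 2(1)] 2 XY[of X1] by auto
      next
        case 3
        then have "(nb ?F X1 \<union> X1) \<inter> X2 = {}" using \<X>(2)[of X1 X2] X12(3) by auto
        then show ?thesis using away(1)[OF 3(1)] by auto
      qed
    qed
    have un: "\<Union>?Y = \<Union>\<X> \<union> Y" using X0(1) by auto
    have f5: "quot_edges E ?Y \<subseteq> quot_edges ?F \<X>"
    proof
      fix e assume "e \<in> quot_edges E ?Y"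
      then show "e \<in> quot_edges ?F \<X>"
      proof (cases rule: quot_edgesE)
        case 1
        then show ?thesis unfolding un by (rule kept)
      next
        case (2 u v X)
        show ?thesis
        proof (cases "X = ?Z")
          case True
          show ?thesis unfolding 2(1)
            by (rule cl[OF X0(1) subsetD[OF mg] subsetD[OF mg] 2(5)]) (use 2(3,4) True in simp_all)
        next
          case False
          then have X: "X \<in> \<X> - {X0}" using 2 by auto
          show ?thesis unfolding 2(1) by (rule cl[OF _ subsetD[OF away(1)[OF X]] subsetD[OF away(1)[OF X]] 2(5)])
            (use X 2(3,4) in blast)+
        qed
      qed
    qed
    have f1: "X \<subseteq> V - T" if "X \<in> ?Y" for X using that \<X>(1) X0(1) Y(1) by blast
    show ?thesis by (intro exI[of _ ?Y] conjI ballI impI) (rule f1 f2 f3 un f5; assumption)+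
  qed
qed

text \<open>Terminal pairs are counted by the binomial coefficient, everything else per surviving
  nonterminal. Rigid sets off \<open>U\<close> are removed by induction until
  \<open>critical_bound\<close> applies.\<close>

lemma critical_collection:
  assumes "inst V E R s t" "feas E V R s t" "U \<subseteq> V - (R \<union> {s, t})"
    and "\<And>A B. linked E V R s t A B \<Longrightarrow> U \<subseteq> B"
  shows "\<exists>\<X>. (\<forall>X\<in>\<X>. X \<subseteq> V - (R \<union> {s, t} \<union> U)) \<and>
    (\<forall>X1\<in>\<X>. \<forall>X2\<in>\<X>. X1 \<noteq> X2 \<longrightarrow> (nb E X1 \<union> X1) \<inter> X2 = {}) \<and>
    (\<forall>X\<in>\<X>. card (nb E X) \<le> card R + 2) \<and>
    card (quot_edges E \<X> \<union> (pairs (R \<union> {s, t}) - {{s, t}})) + card U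
      \<le> (card R + 2 choose 2) + (card R + 2) * card (V - (R \<union> {s, t}) - \<Union>\<X>)"
  using assms
proof (induction "card V" arbitrary: V E rule: less_induct)
  case (less V E)
  let ?S = "R \<union> {s, t}"
  have G: "graph V E" and I: "R \<subseteq> V" "s \<in> V" "t \<in> V" "s \<noteq> t" "s \<notin> R" "t \<notin> R"
    using less.prems(1) unfolding inst_def by auto
  have fin: "finite V" "finite E" "finite R" using graph_finite[OF G] I(1) finite_subset by auto
  have finS: "finite ?S" using fin(3) by simp
  have cS: "card ?S = card R + 2" using I fin(3) by simp
  have cP: "card (pairs ?S) = (card R + 2 choose 2)" using card_pairs[OF finS] cS by simp
  consider "U = {}"
    | Y where "U \<noteq> {}" "Y \<subseteq> V - ?S - U" "card (nb E Y) \<le> card R + 2" "rigid E Y"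
    | "U \<noteq> {}" "\<forall>Y\<subseteq>V - ?S - U. card (nb E Y) \<le> card R + 2 \<longrightarrow> \<not> rigid E Y" by blast
  then show ?case
  proof cases
    case 1
    \<comment> \<open>With \<open>U\<close> empty a single member can swallow all nonterminals,
      leaving only terminal pairs.\<close>
    have nbS: "nb E (V - ?S) \<subseteq> ?S" using nb_subset[OF G, of "V - ?S"] nbD[of _ E "V - ?S"] by auto
    have "quot_edges E {V - ?S} \<subseteq> pairs ?S"
    proof
      fix e assume "e \<in> quot_edges E {V - ?S}"
      then show "e \<in> pairs ?S"
      proof (cases rule: quot_edgesE)
        case 1
        then have "e \<subseteq> V" "card e = 2" using G unfolding graph_def by auto
        then show ?thesis using 1 unfolding pairs_eq by auto
      next
        case (2 u v X)
        then show ?thesis using nbS unfolding pairs_def by blast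
      qed
    qed
    then have "card (quot_edges E {V - ?S} \<union> (pairs ?S - {{s, t}})) \<le> card (pairs ?S)"
      by (intro card_mono pairs_finite[OF finS]) auto
    moreover have "card (nb E (V - ?S)) \<le> card R + 2" using card_mono[OF finS nbS] cS by simp
    ultimately show ?thesis using 1 cP by (intro exI[of _ "{V - ?S}"]) simp
  next
    case 2
    let ?F = "quot E Y"
    have Yc: "conn E Y" "Y \<noteq> {}" using 2(4) unfolding rigid_def by auto
    have lt: "card (V - Y) < card V" using 2(2) Yc(2) fin(1) by (intro psubset_card_mono) auto
    have i: "inst (V - Y) ?F R s t" unfolding inst_def using graph_quot[OF G] I 2(2) by auto
    obtain A B where AB: "A \<subseteq> V" "B \<subseteq> V" "A \<inter> B = {}" "R \<subseteq> A" "s \<in> B" "t \<in> B" "conn E A" "conn E B"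
      using less.prems(2) unfolding feas_def linked_def by metis
    have "linked ?F (V - Y) R s t (A - Y) (B - Y)"
      unfolding linked_def using AB 2(2) conn_quot[OF AB(7), of Y] conn_quot[OF AB(8), of Y] by auto
    then have f: "feas ?F (V - Y) R s t" unfolding feas_def by blast
    \<comment> \<open>Lifting adds to the path side only vertices of \<open>Y\<close>, and
      \<open>Y\<close> avoids \<open>U\<close>.\<close>
    have cr: "U \<subseteq> B'" if L: "linked ?F (V - Y) R s t A' B'" for A' B'
    proof -
      have "Y \<subseteq> V" using 2(2) by auto
      then obtain A B where "linked E V R s t A B" "B \<subseteq> B' \<union> Y"
        using linked_quot_lift[OF 2(4) _ nb_subset[OF G] L] by blast
      then show ?thesis using less.prems(4)[of A B] 2(2) by auto
    qed
    have US: "U \<subseteq> V - Y - ?S" using less.prems(3) 2(2) by auto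
    from less.hyps[OF lt i f US cr] obtain \<X> where X': "(\<forall>X\<in>\<X>. X \<subseteq> V - Y - (?S \<union> U)) \<and>
      (\<forall>X1\<in>\<X>. \<forall>X2\<in>\<X>. X1 \<noteq> X2 \<longrightarrow> (nb ?F X1 \<union> X1) \<inter> X2 = {}) \<and>
      (\<forall>X\<in>\<X>. card (nb ?F X) \<le> card R + 2) \<and>
      card (quot_edges ?F \<X> \<union> (pairs ?S - {{s, t}})) + card U
        \<le> (card R + 2 choose 2) + (card R + 2) * card (V - Y - ?S - \<Union>\<X>)" ..
    note X = X'[THEN conjunct1] X'[THEN conjunct2, THEN conjunct1]
      X'[THEN conjunct2, THEN conjunct2, THEN conjunct1] X'[THEN conjunct2, THEN conjunct2, THEN conjunct2]
    have YT: "Y \<subseteq> V - (?S \<union> U)" using 2(2) by auto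
    have "\<exists>\<Y>. (\<forall>X\<in>\<Y>. X \<subseteq> V - (?S \<union> U)) \<and>
      (\<forall>X1\<in>\<Y>. \<forall>X2\<in>\<Y>. X1 \<noteq> X2 \<longrightarrow> (nb E X1 \<union> X1) \<inter> X2 = {}) \<and>
      (\<forall>X\<in>\<Y>. card (nb E X) \<le> card R + 2) \<and> \<Union>\<Y> = \<Union>\<X> \<union> Y \<and>
      quot_edges E \<Y> \<subseteq> quot_edges ?F \<X>"
      by (rule lift_collection[OF _ _ _ G YT 2(3)]) (use X(1-3) in blast)+
    then obtain \<Y> where Y: "\<forall>X\<in>\<Y>. X \<subseteq> V - (?S \<union> U)"
      "\<forall>X1\<in>\<Y>. \<forall>X2\<in>\<Y>. X1 \<noteq> X2 \<longrightarrow> (nb E X1 \<union> X1) \<inter> X2 = {}"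
      "\<forall>X\<in>\<Y>. card (nb E X) \<le> card R + 2" "\<Union>\<Y> = \<Union>\<X> \<union> Y"
      "quot_edges E \<Y> \<subseteq> quot_edges ?F \<X>" by metis
    have "card (quot_edges E \<Y> \<union> (pairs ?S - {{s, t}})) \<le> card (quot_edges ?F \<X> \<union> (pairs ?S - {{s, t}}))"
      using Y(5) quot_edges_finite[OF graph_quot[OF G]] pairs_finite[OF finS] by (intro card_mono) auto
    moreover have "V - ?S - \<Union>\<Y> = V - Y - ?S - \<Union>\<X>" using Y(4) by auto
    ultimately show ?thesis using X(4) Y(1-3) by (intro exI[of _ \<Y>]) auto
  next
    case 3
    have "critical_bound V E R s t U" by (rule critical_bound)
    then have cb: "er E (V - ?S) {} + card U \<le> (card R + 2) * card (V - ?S) + 1"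
      unfolding critical_bound_def using less.prems 3 by blast
    obtain A B where AB: "A \<subseteq> V" "B \<subseteq> V" "A \<inter> B = {}" "R \<subseteq> A" "s \<in> B" "t \<in> B" "conn E A" "conn E B"
      using less.prems(2) unfolding feas_def linked_def by metis
    \<comment> \<open>Such an edge would be a path side that avoids \<open>U\<close>. The absent
      pair cancels the \<open>+ 1\<close> of \<open>critical_bound\<close>.\<close>
    have st: "{s, t} \<notin> E"
    proof
      assume "{s, t} \<in> E"
      then have "conn E {s, t}" using conn_insert[of E "{t}" t s] by simp
      then have "linked E V R s t A {s, t}" unfolding linked_def using AB I by auto
      then show False using less.prems(3,4) 3(1) by blast
    qed
    have stP: "{s, t} \<in> pairs ?S" using I(4) unfolding pairs_def by blast
    let ?T = "{e \<in> E. e \<inter> (V - ?S) \<noteq> {}}"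
    have "quot_edges E {} \<union> (pairs ?S - {{s, t}}) \<subseteq> ?T \<union> (pairs ?S - {{s, t}})"
    proof -
      have "e \<in> pairs ?S - {{s, t}}" if e: "e \<in> E" "e \<inter> (V - ?S) = {}" for e
      proof -
        have "e \<subseteq> V" "card e = 2" using G e(1) unfolding graph_def by auto
        then show ?thesis using e st unfolding pairs_eq by auto
      qed
      then show ?thesis unfolding quot_edges_def by auto
    qed
    then have "card (quot_edges E {} \<union> (pairs ?S - {{s, t}})) \<le> card (?T \<union> (pairs ?S - {{s, t}}))"
      using fin(2) pairs_finite[OF finS] by (intro card_mono) auto
    also have "\<dots> \<le> card ?T + card (pairs ?S - {{s, t}})" by (rule card_Un_le)
    also have "card ?T = er E (V - ?S) {}" unfolding er_def by simp
    finally have "card (quot_edges E {} \<union> (pairs ?S - {{s, t}})) + 1 \<le> er E (V - ?S) {} + (card R + 2 choose 2)"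
      using card_Suc_Diff1[OF pairs_finite[OF finS] stP] cP by linarith
    then have "card (quot_edges E {} \<union> (pairs ?S - {{s, t}})) + card U
        \<le> (card R + 2 choose 2) + (card R + 2) * card (V - ?S - \<Union>{})"
      using cb by simp
    then show ?thesis by (intro exI[of _ "{}"]) simp
  qed
qed

subsection \<open>Linkage pairs as pairs of vertex sets\<close>

lemma connected_graph_conn:
  assumes A: "connected_graph A" "simple_graph A" "edges A \<subseteq> E"
  shows "conn E (verts A)"
proof (rule connI, rule ccontr)
  fix C assume C: "C \<subseteq> verts A" "C \<noteq> {}" "C \<noteq> verts A"
    and none: "\<not> (\<exists>x\<in>C. \<exists>y\<in>verts A - C. {x, y} \<in> E)"
  obtain u v where uv: "u \<in> C" "v \<in> verts A" "v \<notin> C" using C by auto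
  have "(u, v) \<in> {(x, y). {x, y} \<in> edges A}\<^sup>*" using A(1) C(1) uv unfolding connected_graph_def by blast
  then have "v \<in> C"
  proof induction
    case (step y z)
    then have yz: "{y, z} \<in> edges A" by simp
    then have "z \<in> verts A" "{y, z} \<in> E" using A(2,3) unfolding simple_graph_def by auto
    then show ?case using none step.IH by blast
  qed (rule uv(1))
  then show False using uv(3) by simp
qed

lemma conn_connected_graph:
  assumes "conn E A" "A \<noteq> {}"
  shows "connected_graph \<lparr>verts = A, edges = {e \<in> E. e \<subseteq> A}\<rparr>"
proof -
  let ?r = "{(x, y). {x, y} \<in> {e \<in> E. e \<subseteq> A}}"
  have "(u, v) \<in> ?r\<^sup>*" if uv: "u \<in> A" "v \<in> A" for u v
  proof -
    let ?C = "{v \<in> A. (u, v) \<in> ?r\<^sup>*}"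
    have "?C = A"
    proof (rule ccontr)
      assume ne: "?C \<noteq> A"
      have C: "?C \<subseteq> A" "?C \<noteq> {}" using uv(1) by auto
      obtain x y where xy: "x \<in> ?C" "y \<in> A" "y \<notin> ?C" "{x, y} \<in> E" by (rule connD[OF assms(1) C ne])
      then have "(x, y) \<in> ?r" by simp
      moreover have "(u, x) \<in> ?r\<^sup>*" using xy(1) by simp
      ultimately have "(u, y) \<in> ?r\<^sup>*" by (rule rtrancl_into_rtrancl[rotated])
      then show False using xy(2,3) by simp
    qed
    then show ?thesis using uv(2) by blast
  qed
  then show ?thesis unfolding connected_graph_def using assms(2) by simp
qed

lemma linkage_pair_linked:
  assumes "linkage_pair G R b1 b2 A B"
  shows "linked (edges G) (verts G) R b1 b2 (verts A) (verts B)"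
proof -
  have sA: "simple_graph A" "verts A \<subseteq> verts G" "edges A \<subseteq> edges G"
    and sB: "verts B \<subseteq> verts G" "edges B \<subseteq> edges G"
    and AB: "verts A \<inter> verts B = {}" "connected_graph A \<or> R = {} \<and> A = empty_graph" "R \<subseteq> verts A"
    and B: "is_path B b1 b2"
    using assms unfolding linkage_pair_def subgraph_def by auto
  obtain p where p: "p \<noteq> []" "distinct p" "hd p = b1" "last p = b2" "verts B = set p"
    "edges B = {{p ! i, p ! Suc i} |i. Suc i < length p}" using B unfolding is_path_def by blast
  have "walk (edges G) p" unfolding walk_def using p(1,6) sB(2) by blast
  then have "conn (edges G) (verts B)" unfolding p(5) by (rule walk_conn)
  moreover have "conn (edges G) (verts A)"
    using AB(2) connected_graph_conn[OF _ sA(1,3)] by (auto simp: empty_graph_def)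
  moreover have "b1 \<in> verts B" "b2 \<in> verts B"
    using p(1,3-5) hd_in_set[of p] last_in_set[of p] by auto
  ultimately show ?thesis unfolding linked_def using AB sA sB by blast
qed

text \<open>Thinning the path side to an induced path only shrinks it, so \<open>U\<close> inside
  the path forces \<open>U\<close> inside \<open>B\<close>.\<close>

lemma linked_linkage_pair:
  assumes G: "simple_graph G" and L: "linked (edges G) (verts G) R b1 b2 A B"
  obtains A' B' where "linkage_pair G R b1 b2 A' B'" "verts B' \<subseteq> B"
proof -
  have AB: "A \<subseteq> verts G" "B \<subseteq> verts G" "A \<inter> B = {}" "R \<subseteq> A" "b1 \<in> B" "b2 \<in> B"
    "conn (edges G) A" "conn (edges G) B" using L unfolding linked_def by auto
  have E: "e \<subseteq> verts G" "card e = 2" if "e \<in> edges G" for e using G that unfolding simple_graph_def by auto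
  have fV: "finite (verts G)" using G unfolding simple_graph_def by simp
  obtain p where p: "induced_path (edges G) b1 b2 p" "set p \<subseteq> B" using conn_induced_path[OF AB(8,5,6)] by metis
  note q = induced_pathD[OF p(1)]
  let ?A = "\<lparr>verts = A, edges = {e \<in> edges G. e \<subseteq> A}\<rparr>"
  let ?B = "\<lparr>verts = set p, edges = {{p ! i, p ! Suc i} |i. Suc i < length p}\<rparr>"
  have sA: "subgraph ?A G"
    unfolding subgraph_def simple_graph_def using AB(1) E finite_subset[OF AB(1) fV] by auto
  have eB: "{{p ! i, p ! Suc i} |i. Suc i < length p} \<subseteq> edges G" using q(1) unfolding walk_def by blast
  have "{p ! i, p ! Suc i} \<subseteq> set p" if "Suc i < length p" for i using that by auto
  then have "e \<subseteq> set p" if "e \<in> edges ?B" for e using that by auto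
  then have sB: "subgraph ?B G"
    unfolding subgraph_def simple_graph_def using eB E(2) p(2) AB(2) by auto
  have "connected_graph ?A \<or> (R = {} \<and> ?A = empty_graph)"
  proof (cases "A = {}")
    case True
    moreover have "{} \<notin> edges G" using E(2)[of "{}"] by auto
    ultimately show ?thesis using AB(4) by (auto simp: empty_graph_def)
  next
    case False
    then show ?thesis using conn_connected_graph[OF AB(7)] by blast
  qed
  moreover have "is_path ?B b1 b2" unfolding is_path_def using q(2-5) by (intro exI[of _ p]) simp
  moreover have "A \<inter> set p = {}" using AB(3) p(2) by blast
  ultimately have "linkage_pair G R b1 b2 ?A ?B" unfolding linkage_pair_def using sA sB AB(4) by simp
  then show thesis using that[of ?A ?B] p(2) by simp
qed

lemma two_choose_Suc_Suc: "2 * (m + 2 choose 2) = (m + 2) * (m + 1)"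
  by (induction m) (auto simp: numeral_2_eq_2 algebra_simps)

theorem theorem2p2:
  fixes m :: nat and G :: "'a ugraph" and R U :: "'a set" and b1 b2 :: 'a
  assumes "rooted_graph m G R b1 b2"
    and "U \<subseteq> verts G - (R \<union> {b1, b2})"
    and "critically_feasible G R b1 b2 U"
  shows "\<exists>\<X>. collection G (R \<union> {b1, b2} \<union> U) \<X> \<and>
    (\<forall>X\<in>\<X>. card (nbhd G X) \<le> m + 2) \<and>
    real (card (edges (rooted_quotient G R b1 b2 \<X>)))
      \<le> (real m + 2) * real (card (verts (quotient_graph G \<X>)))
         - (real m)\<^sup>2 / 2 - 5 * real m / 2 - 3 - real (card U)"
proof -
  let ?V = "verts G" and ?E = "edges G" and ?S = "R \<union> {b1, b2}"
  have sG: "simple_graph G" and I: "R \<subseteq> ?V" "card R = m" "b1 \<in> ?V" "b2 \<in> ?V" "b1 \<noteq> b2" "b1 \<notin> R" "b2 \<notin> R"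
    using assms(1) unfolding rooted_graph_def by auto
  have g: "graph ?V ?E" using sG unfolding graph_def simple_graph_def .
  have i: "inst ?V ?E R b1 b2" unfolding inst_def using g I by blast
  have f: "feas ?E ?V R b1 b2"
    using assms(3) linkage_pair_linked unfolding critically_feasible_def feasible_def feas_def by metis
  have c: "U \<subseteq> B" if L: "linked ?E ?V R b1 b2 A B" for A B
  proof -
    obtain A' B' where "linkage_pair G R b1 b2 A' B'" "verts B' \<subseteq> B" using linked_linkage_pair[OF sG L] by metis
    then show ?thesis using assms(3) unfolding critically_feasible_def by blast
  qed
  have nb: "nbhd G X = nb ?E X" for X
    using nb_subset[OF g, of X] unfolding nbhd_def nb_def by blast
  from critical_collection[OF i f assms(2) c] obtain \<X> where X: "(\<forall>X\<in>\<X>. X \<subseteq> ?V - (?S \<union> U)) \<and>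
    (\<forall>X1\<in>\<X>. \<forall>X2\<in>\<X>. X1 \<noteq> X2 \<longrightarrow> (nb ?E X1 \<union> X1) \<inter> X2 = {}) \<and>
    (\<forall>X\<in>\<X>. card (nb ?E X) \<le> card R + 2) \<and>
    card (quot_edges ?E \<X> \<union> (pairs ?S - {{b1, b2}})) + card U
      \<le> (card R + 2 choose 2) + (card R + 2) * card (?V - ?S - \<Union>\<X>)" ..
  have "collection G (?S \<union> U) \<X>"
    unfolding collection_def closed_nbhd_def nb using X by (intro conjI) blast+
  moreover have "\<forall>X\<in>\<X>. card (nbhd G X) \<le> m + 2" unfolding nb using X I(2) by simp
  moreover have e: "edges (rooted_quotient G R b1 b2 \<X>) = quot_edges ?E \<X> \<union> (pairs ?S - {{b1, b2}})"
    unfolding rooted_quotient_def quotient_graph_def quot_edges_def pairs_def nb by simp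
  moreover have "real (card (quot_edges ?E \<X> \<union> (pairs ?S - {{b1, b2}})))
      \<le> (real m + 2) * real (card (verts (quotient_graph G \<X>)))
         - (real m)\<^sup>2 / 2 - 5 * real m / 2 - 3 - real (card U)"
  proof -
    let ?e = "card (quot_edges ?E \<X> \<union> (pairs ?S - {{b1, b2}}))" and ?n = "card (?V - ?S - \<Union>\<X>)"
    have fV: "finite ?V" using graph_finite(1)[OF g] .
    have fR: "finite R" using finite_subset[OF I(1) fV] .
    have "card (verts (quotient_graph G \<X>)) = card (?S \<union> (?V - ?S - \<Union>\<X>))"
    proof -
      have "\<Union>\<X> \<inter> ?S = {}" using X by blast
      then have "?V - \<Union>\<X> = ?S \<union> (?V - ?S - \<Union>\<X>)" using I(1,3,4) by auto
      then show ?thesis unfolding quotient_graph_def by simp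
    qed
    also have "\<dots> = card ?S + ?n" by (rule card_Un_disjoint) (use fV fR in auto)
    also have "card ?S = m + 2" using I fR by simp
    \<comment> \<open>With \<open>n\<close> surviving nonterminals, \<open>v = m + 2 + n\<close>.
      The constant is \<open>(m + 2) (m + 1) / 2 - (m + 2)\<^sup>2\<close>, that is
      \<open>- m\<^sup>2 / 2 - 5 m / 2 - 3\<close>.\<close>
    finally have v: "real (card (verts (quotient_graph G \<X>))) = real m + 2 + real ?n" by simp
    have "2 * (?e + card U) \<le> 2 * ((m + 2 choose 2) + (m + 2) * ?n)" using X I(2) by auto
    also have "\<dots> = (m + 2) * (m + 1) + 2 * ((m + 2) * ?n)" using two_choose_Suc_Suc[of m] by simp
    finally have "real (2 * (?e + card U)) \<le> real ((m + 2) * (m + 1) + 2 * ((m + 2) * ?n))"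
      by (rule of_nat_mono)
    then have "2 * real ?e + 2 * real (card U) \<le> (real m + 2) * (real m + 1) + 2 * ((real m + 2) * real ?n)"
      by (simp add: algebra_simps)
    then show ?thesis unfolding v by (simp add: field_simps power2_eq_square)
  qed
  ultimately show ?thesis unfolding e[symmetric] by blast
qed

end
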